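(* Suppose Player 2 runs the Player-2 algorithm described in the context with $\gamma=\sqrt{|\mathcal S|\log|\mathcal B|/K}$, against an arbitrary, potentially adversarial policy sequence $\{\mu^k\}_{k=1}^K$ of Player 1. Then, with probability at least $1-2\delta$, $$\mathrm{Regret}_2(K)\le\tilde O\big(C\sqrt T\big),$$ where $T=KH$ and $C=\sqrt{|\mathcal S|^2|\mathcal A|H^3}+\sqrt{|\mathcal S||\mathcal A||\mathcal B|H}$.
   Context: Notation. $[n]=\{1,\dots,n\}$; $\Delta_X$ is the probability simplex over a finite set $X$; $\langle f,g\rangle_X=\sum_{x\in X}f(x)g(x)$; $\boldsymbol 1,\boldsymbol 0$ are all-ones and zero vectors/functions; $\mathbf 1_{\{\cdot\}}$ is the indicator. $\tilde O(\cdot)$ hides absolute constants and logarithmic factors in $|\mathcal S|,|\mathcal A|,|\mathcal B|,H,K,1/\delta$. $\delta\in(0,1)$. Game (single-controller transition). $\mathcal S,\mathcal A,\mathcal B$ are finite sets (states, actions of Player 1, actions of Player 2), $H$ is the episode length, $K$ the number of episodes. The transitions, unknown to the players, are controlled by Player 1 only: $\mathcal P_h(s'|s,a,b)=\mathcal P_h(s'|s,a)$, $h\in[H]$. Mean rewards are $r_h:\mathcal S\times\mathcal A\times\mathcal B\to[0,1]$. Policies are $\mu=\{\mu_h\}_{h=1}^H$, $\mu_h(\cdot|s)\in\Delta_{\mathcal A}$ (Player 1) and $\nu=\{\nu_h\}_{h=1}^H$, $\nu_h(\cdot|s)\in\Delta_{\mathcal B}$ (Player 2). The value function is $V_h^{\mu,\nu}(s)=\mathbb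 E[\sum_{h'=h}^H r_{h'}(s_{h'},a_{h'},b_{h'})\mid s_h=s]$ under $\mu,\nu,\mathcal P$. Protocol. Every episode $k\in[K]$ starts at a fixed $s_1$. Before episode $k$ each player observes the opponent's policy of episode $k-1$; the players choose $\mu^k,\nu^k$ simultaneously, and a trajectory $\{(s_h^k,a_h^k,b_h^k,s_{h+1}^k)\}_{h=1}^H$ is generated with $a_h^k\sim\mu_h^k(\cdot|s_h^k)$, $b_h^k\sim\nu_h^k(\cdot|s_h^k)$, $s_{h+1}^k\sim\mathcal P_h(\cdot|s_h^k,a_h^k)$. At the end of the episode the players observe only the trajectory and the bandit rewards $r_h^k(s_h^k,a_h^k,b_h^k)\in[0,1]$, random with mean $r_h(s_h^k,a_h^k,b_h^k)$ conditionally on the past. Regret. $\mathrm{Regret}_2(K)=\sum_{k=1}^K[V_1^{\mu^k,\nu^k}(s_1)-V_1^{\mu^k,\nu^*}(s_1)]$, where $\nu^*\in\arg\min_\nu\sum_{k=1}^K V_1^{\mu^k,\nu}(s_1)$ is the best policy in hindsight. Estimates. For $k\ge1$ let $N_h^k(s,a,b)$, $N_h^k(s,a)$ be the numbers of episodes $\tau\le k$ in which the indicated tuple is visited at step $h$, and $\hat r_h^k(s,a,b)=\frac{\sum_{\tau=1}^k\mathbf 1_{\{(s,a,b)=(s_h^\tau,a_h^\tau,b_h^\tau)\}}r_h^\tau(s,a,b)}{\max\{N_h^k(s,a,b),1\}}$, $\hat{\mathcal P}_h^k(s'|s,a)=\frac{\sum_{\tau=1}^k\mathbf 1_{\{(s,a,s')=(s_h^\tau,a_h^\tau,s_{h+1}^\tau)\}}}{\max\{N_h^k(s,a),1\}}$,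 $\beta_h^{r,k}(s,a,b)=\sqrt{\frac{4\log(|\mathcal S||\mathcal A||\mathcal B|HK/\delta)}{\max\{N_h^k(s,a,b),1\}}}$. For $k=0$: $\hat{\mathcal P}_h^0(\cdot|s,a)=\boldsymbol 1/|\mathcal S|$, $\hat r_h^0=\beta_h^{r,0}=\boldsymbol 0$. The empirical state reaching probability $d_h^{\mu^k,\hat{\mathcal P}^k}(s)$ is that of $s_h=s$ from $s_1$ under $\mu^k$ and $\hat{\mathcal P}^k$, i.e. $d_1(s)=\mathbf 1_{\{s=s_1\}}$, $d_h(s)=\sum_{s',a'}d_{h-1}(s')\mu_{h-1}^k(a'|s')\hat{\mathcal P}_{h-1}^k(s|s',a')$. Player-2 algorithm. $\nu_h^0(\cdot|s)=\boldsymbol 1/|\mathcal B|$. In episode $k=1,\dots,K$: observe $\mu^{k-1}$; for all $h$ set $\tilde r_h^{k-1}(s,a,b)=\max\{\hat r_h^{k-1}(s,a,b)-\beta_h^{r,k-1}(s,a,b),0\}$ and compute $d_h^{\mu^{k-1},\hat{\mathcal P}^{k-1}}(s)$; with step size $\gamma>0$ do the mirror descent update $\nu_h^k(b|s)\propto\nu_h^{k-1}(b|s)\exp\{-\gamma\,d_h^{\mu^{k-1},\hat{\mathcal P}^{k-1}}(s)\,\langle\tilde r_h^{k-1}(s,\cdot,b),\mu_h^{k-1}(\cdot|s)\rangle_{\mathcal A}\}$ (normalized over $b\in\mathcal B$); play $\nu^k$ and observe the trajectory and rewards. *)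

theory Defs
  imports "HOL-Probability.Probability"
begin

text \<open>The three finite sets are carrier sets inside arbitrary types, and not finite types: the
  absolute constants of a bound must be chosen before the sets, which is impossible if the
  cardinalities are determined by the types. Steps \<open>h\<close> and episodes \<open>k\<close> are counted from 1.
  Only Player 1's action enters the transition kernel.\<close>

record ('s, 'a, 'b) game =
  states :: "'s set"
  acts1 :: "'a set"
  acts2 :: "'b set"
  horizon :: nat
  trans :: "nat \<Rightarrow> 's \<Rightarrow> 'a \<Rightarrow> 's pmf"
  mean_reward :: "nat \<Rightarrow> 's \<Rightarrow> 'a \<Rightarrow> 'b \<Rightarrow> real"
  init :: 's

definition wf_game :: "('s, 'a, 'b) game \<Rightarrow> bool" where
  "wf_game G \<longleftrightarrow>
     finite (states G) \<and> states G \<noteq> {} \<and> finite (acts1 G) \<and> acts1 G \<noteq> {} \<and>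
     finite (acts2 G) \<and> acts2 G \<noteq> {} \<and> 1 \<le> horizon G \<and> init G \<in> states G \<and>
     (\<forall>h\<in>{1..horizon G}. \<forall>s\<in>states G. \<forall>a\<in>acts1 G.
        set_pmf (trans G h s a) \<subseteq> states G \<and>
        (\<forall>b\<in>acts2 G. mean_reward G h s a b \<in> {0..1}))"

type_synonym ('s, 'c) policy = "nat \<Rightarrow> 's \<Rightarrow> 'c pmf"

definition is_policy :: "('s, 'a, 'b) game \<Rightarrow> 'c set \<Rightarrow> ('s, 'c) policy \<Rightarrow> bool" where
  "is_policy G C \<pi> \<longleftrightarrow> (\<forall>h\<in>{1..horizon G}. \<forall>s\<in>states G. set_pmf (\<pi> h s) \<subseteq> C)"


text \<open>Law of the next \<open>n\<close> triples (state, action 1, action 2), starting at step \<open>h\<close> in state \<open>s\<close>.\<close>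

primrec trajectory ::
  "('s, 'a, 'b) game \<Rightarrow> ('s, 'a) policy \<Rightarrow> ('s, 'b) policy \<Rightarrow> nat \<Rightarrow> nat \<Rightarrow> 's \<Rightarrow> ('s \<times> 'a \<times> 'b) list pmf"
where
  "trajectory G \<mu> \<nu> 0 h s = return_pmf []"
| "trajectory G \<mu> \<nu> (Suc n) h s =
     bind_pmf (\<mu> h s) (\<lambda>a.
     bind_pmf (\<nu> h s) (\<lambda>b.
     bind_pmf (trans G h s a) (\<lambda>s'.
     map_pmf (\<lambda>xs. (s, a, b) # xs) (trajectory G \<mu> \<nu> n (Suc h) s'))))"

definition V ::
  "('s, 'a, 'b) game \<Rightarrow> ('s, 'a) policy \<Rightarrow> ('s, 'b) policy \<Rightarrow> nat \<Rightarrow> 's \<Rightarrow> real"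
where
  "V G \<mu> \<nu> h s =
     measure_pmf.expectation (trajectory G \<mu> \<nu> (Suc (horizon G) - h) h s)
       (\<lambda>xs. \<Sum>h'=h..horizon G. case xs ! (h' - h) of (s', a', b') \<Rightarrow> mean_reward G h' s' a' b')"


text \<open>One realisation of the whole interaction: \<open>pol1 x k\<close> and \<open>pol2 x k\<close> are \<open>\<mu>\<^sup>k\<close> and \<open>\<nu>\<^sup>k\<close>, and
  \<open>state x k h\<close>, \<open>act1 x k h\<close>, \<open>act2 x k h\<close>, \<open>rew x k h\<close> are the state, the two actions and the
  observed reward at step \<open>h\<close> of episode \<open>k\<close>.\<close>

record ('s, 'a, 'b) play =
  pol1 :: "nat \<Rightarrow> ('s, 'a) policy"
  pol2 :: "nat \<Rightarrow> ('s, 'b) policy"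
  state :: "nat \<Rightarrow> nat \<Rightarrow> 's"
  act1 :: "nat \<Rightarrow> nat \<Rightarrow> 'a"
  act2 :: "nat \<Rightarrow> nat \<Rightarrow> 'b"
  rew :: "nat \<Rightarrow> nat \<Rightarrow> real"

text \<open>\<open>F k h\<close> is the information available just before the actions at step \<open>h\<close> of episode \<open>k\<close> are
  drawn (\<open>F k (H + 1)\<close>: at the end of the episode), and \<open>F' k h\<close> the information just after they
  are drawn, before the reward and the next state are. The \<open>\<sigma>\<close>-algebras may contain more than
  the history, so that Player 1 may be adaptive and use private randomness. No independence of
  reward and next state is required.\<close>

definition protocol ::
  "('s, 'a, 'b) game \<Rightarrow> nat \<Rightarrow> 'w measure \<Rightarrow> (nat \<Rightarrow> nat \<Rightarrow> 'w measure) \<Rightarrow> (nat \<Rightarrow> nat \<Rightarrow> 'w measure) \<Rightarrow>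
   ('w \<Rightarrow> ('s, 'a, 'b) play) \<Rightarrow> bool"
where
  "protocol G K M F F' X \<longleftrightarrow>
     prob_space M \<and>
     (\<forall>k\<in>{1..K}.
        (\<forall>h\<in>{1..horizon G}. subalgebra (F' k h) (F k h) \<and> subalgebra (F k (Suc h)) (F' k h)) \<and>
        subalgebra M (F k (Suc (horizon G))) \<and>
        (k < K \<longrightarrow> subalgebra (F (Suc k) 1) (F k (Suc (horizon G)))) \<and>
        (\<forall>\<omega>\<in>space M. is_policy G (acts1 G) (pol1 (X \<omega>) k) \<and> is_policy G (acts2 G) (pol2 (X \<omega>) k)) \<and>
        (\<forall>h\<in>{1..horizon G}. \<forall>s\<in>states G.
           (\<forall>a\<in>acts1 G. (\<lambda>\<omega>. pmf (pol1 (X \<omega>) k h s) a) \<in> borel_measurable (F k 1)) \<and>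
           (\<forall>b\<in>acts2 G. (\<lambda>\<omega>. pmf (pol2 (X \<omega>) k h s) b) \<in> borel_measurable (F k 1))) \<and>
        (\<forall>\<omega>\<in>space M. state (X \<omega>) k 1 = init G) \<and>
        (\<forall>h\<in>{1..Suc (horizon G)}. (\<lambda>\<omega>. state (X \<omega>) k h) \<in> F k h \<rightarrow>\<^sub>M count_space (states G)) \<and>
        (\<forall>h\<in>{1..horizon G}.
           (\<lambda>\<omega>. act1 (X \<omega>) k h) \<in> F' k h \<rightarrow>\<^sub>M count_space (acts1 G) \<and>
           (\<lambda>\<omega>. act2 (X \<omega>) k h) \<in> F' k h \<rightarrow>\<^sub>M count_space (acts2 G) \<and>
           (\<lambda>\<omega>. rew (X \<omega>) k h) \<in> borel_measurable (F k (Suc h)) \<and>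
           (\<forall>\<omega>\<in>space M. rew (X \<omega>) k h \<in> {0..1}) \<and>
           (\<forall>a\<in>acts1 G. \<forall>b\<in>acts2 G. AE \<omega> in M.
              real_cond_exp M (F k h) (\<lambda>\<omega>. of_bool (act1 (X \<omega>) k h = a \<and> act2 (X \<omega>) k h = b)) \<omega> =
              pmf (pol1 (X \<omega>) k h (state (X \<omega>) k h)) a * pmf (pol2 (X \<omega>) k h (state (X \<omega>) k h)) b) \<and>
           (\<forall>s'\<in>states G. AE \<omega> in M.
              real_cond_exp M (F' k h) (\<lambda>\<omega>. of_bool (state (X \<omega>) k (Suc h) = s')) \<omega> =
              pmf (trans G h (state (X \<omega>) k h) (act1 (X \<omega>) k h)) s') \<and>
           (AE \<omega> in M.
              real_cond_exp M (F' k h) (\<lambda>\<omega>. rew (X \<omega>) k h) \<omega> =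
              mean_reward G h (state (X \<omega>) k h) (act1 (X \<omega>) k h) (act2 (X \<omega>) k h))))"


definition regret2 :: "('s, 'a, 'b) game \<Rightarrow> nat \<Rightarrow> ('s, 'a, 'b) play \<Rightarrow> real" where
  "regret2 G K x =
     (let \<nu>opt = arg_min (\<lambda>\<nu>. \<Sum>k=1..K. V G (pol1 x k) \<nu> 1 (init G)) (is_policy G (acts2 G))
      in \<Sum>k=1..K. V G (pol1 x k) (pol2 x k) 1 (init G) - V G (pol1 x k) \<nu>opt 1 (init G))"


definition log_factor :: "('s, 'a, 'b) game \<Rightarrow> nat \<Rightarrow> real \<Rightarrow> real" where
  "log_factor G K \<delta> =
     ln (real (card (states G)) * real (card (acts1 G)) * real (card (acts2 G)) * real (horizon G) * real K / \<delta>)"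

definition visits3 :: "('s, 'a, 'b) play \<Rightarrow> nat \<Rightarrow> nat \<Rightarrow> 's \<Rightarrow> 'a \<Rightarrow> 'b \<Rightarrow> nat" where
  "visits3 x k h s a b = card {\<tau>\<in>{1..k}. state x \<tau> h = s \<and> act1 x \<tau> h = a \<and> act2 x \<tau> h = b}"

definition visits2 :: "('s, 'a, 'b) play \<Rightarrow> nat \<Rightarrow> nat \<Rightarrow> 's \<Rightarrow> 'a \<Rightarrow> nat" where
  "visits2 x k h s a = card {\<tau>\<in>{1..k}. state x \<tau> h = s \<and> act1 x \<tau> h = a}"

text \<open>For \<open>k = 0\<close> this is 0, as the initialisation demands.\<close>

definition r_hat :: "('s, 'a, 'b) play \<Rightarrow> nat \<Rightarrow> nat \<Rightarrow> 's \<Rightarrow> 'a \<Rightarrow> 'b \<Rightarrow> real" where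
  "r_hat x k h s a b =
     (\<Sum>\<tau>=1..k. of_bool (state x \<tau> h = s \<and> act1 x \<tau> h = a \<and> act2 x \<tau> h = b) * rew x \<tau> h)
       / real (max (visits3 x k h s a b) 1)"

definition P_hat :: "('s, 'a, 'b) game \<Rightarrow> ('s, 'a, 'b) play \<Rightarrow> nat \<Rightarrow> nat \<Rightarrow> 's \<Rightarrow> 'a \<Rightarrow> 's \<Rightarrow> real" where
  "P_hat G x k h s a s' =
     (if k = 0 then 1 / real (card (states G))
      else (\<Sum>\<tau>=1..k. of_bool (state x \<tau> h = s \<and> act1 x \<tau> h = a \<and> state x \<tau> (Suc h) = s'))
             / real (max (visits2 x k h s a) 1))"

definition bonus ::
  "('s, 'a, 'b) game \<Rightarrow> nat \<Rightarrow> real \<Rightarrow> ('s, 'a, 'b) play \<Rightarrow> nat \<Rightarrow> nat \<Rightarrow> 's \<Rightarrow> 'a \<Rightarrow> 'b \<Rightarrow> real"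
where
  "bonus G K \<delta> x k h s a b =
     (if k = 0 then 0
      else sqrt (4 * log_factor G K \<delta> / real (max (visits3 x k h s a b) 1)))"

definition r_tilde ::
  "('s, 'a, 'b) game \<Rightarrow> nat \<Rightarrow> real \<Rightarrow> ('s, 'a, 'b) play \<Rightarrow> nat \<Rightarrow> nat \<Rightarrow> 's \<Rightarrow> 'a \<Rightarrow> 'b \<Rightarrow> real"
where
  "r_tilde G K \<delta> x k h s a b = max (r_hat x k h s a b - bonus G K \<delta> x k h s a b) 0"

text \<open>The kernel is a real-valued function because \<open>P_hat\<close> vanishes at unvisited pairs. The value at
  step 0 is a dummy.\<close>

fun reach ::
  "('s, 'a, 'b) game \<Rightarrow> ('s, 'a) policy \<Rightarrow> (nat \<Rightarrow> 's \<Rightarrow> 'a \<Rightarrow> 's \<Rightarrow> real) \<Rightarrow> nat \<Rightarrow> 's \<Rightarrow> real"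
where
  "reach G \<mu> p 0 s = 0"
| "reach G \<mu> p (Suc 0) s = of_bool (s = init G)"
| "reach G \<mu> p (Suc (Suc h)) s =
     (\<Sum>s'\<in>states G. \<Sum>a'\<in>acts1 G. reach G \<mu> p (Suc h) s' * pmf (\<mu> (Suc h) s') a' * p (Suc h) s' a' s)"

text \<open>In the update for \<open>k = 1\<close> the policy \<open>pol1 x 0\<close> is arbitrary; it is multiplied by
  \<open>r_tilde G K \<delta> x 0 = 0\<close>.\<close>

definition md_weight ::
  "('s, 'a, 'b) game \<Rightarrow> nat \<Rightarrow> real \<Rightarrow> real \<Rightarrow> ('s, 'a, 'b) play \<Rightarrow> nat \<Rightarrow> nat \<Rightarrow> 's \<Rightarrow> 'b \<Rightarrow> real"
where
  "md_weight G K \<delta> \<gamma> x k h s b =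
     pmf (pol2 x (k - 1) h s) b *
     exp (- \<gamma> * reach G (pol1 x (k - 1)) (P_hat G x (k - 1)) h s *
            (\<Sum>a\<in>acts1 G. r_tilde G K \<delta> x (k - 1) h s a b * pmf (pol1 x (k - 1) h s) a))"

definition player2_algorithm ::
  "('s, 'a, 'b) game \<Rightarrow> nat \<Rightarrow> real \<Rightarrow> real \<Rightarrow> ('s, 'a, 'b) play \<Rightarrow> bool"
where
  "player2_algorithm G K \<delta> \<gamma> x \<longleftrightarrow>
     (\<forall>h\<in>{1..horizon G}. \<forall>s\<in>states G.
        pol2 x 0 h s = pmf_of_set (acts2 G) \<and>
        (\<forall>k\<in>{1..K}. \<forall>b\<in>acts2 G.
           pmf (pol2 x k h s) b =
             md_weight G K \<delta> \<gamma> x k h s b / (\<Sum>b'\<in>acts2 G. md_weight G K \<delta> \<gamma> x k h s b')))"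

end

theory Submission
  imports Defs
begin

text \<open>Because only Player 1 controls the transitions, the value is linear in \<open>\<nu>\<close>, with weights given
  by the occupancy \<open>d\<close> of \<open>\<mu>\<^sup>k\<close>: writing \<open>q\<close> for the mean of \<open>r\<close> over Player 1's action, the regret is the
  sum of \<open>d \<langle>\<nu>\<^sup>k - \<nu>\<^sup>*, q\<rangle>\<close> over episodes, steps and states. With the estimates \<open>d_hat\<close> and \<open>q_tilde\<close> of the
  algorithm it splits into three parts. The part \<open>d \<langle>\<nu>\<^sup>k - \<nu>\<^sup>*, q - q_tilde\<rangle>\<close> loses its \<open>\<nu>\<^sup>*\<close> term by optimism, and
  the rest is a sum of bonuses along the expected trajectory. The part \<open>(d - d_hat) \<langle>\<nu>\<^sup>k - \<nu>\<^sup>*, q_tilde\<rangle>\<close> is at most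
  the \<open>L\<^sup>1\<close> error of \<open>d_hat\<close>, which telescopes into the \<open>L\<^sup>1\<close> errors of the empirical kernels. The
  part \<open>d_hat \<langle>\<nu>\<^sup>k - \<nu>\<^sup>*, q_tilde\<rangle>\<close> is the regret of exponential weights, separately at every step and state. Both
  sums along expected trajectories are compared with actual visits, which contribute a sum
  of \<open>1 / sqrt n\<close>. All random fluctuations are controlled by one self-normalised Hoeffding bound.\<close>

section \<open>Conditional means and Hoeffding's inequality\<close>

text \<open>Two asymmetries shape the argument. The comparator is never played, so no number of
  visits controls the reward error at its actions; the estimate \<open>r_tilde\<close> is therefore
  kept below the mean reward, and that error enters with a favourable sign. The policy
  \<open>\<mu>\<close> may depend on the whole past, so occupancies and empirical kernels are random
  and correlated. Each kernel error is therefore weighted with the true occupancy, not the empirical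
  one, and the visit counts beside it are taken one episode earlier, so that these weights are known
  when the episode starts. The \<open>L\<^sup>1\<close> error of a kernel is controlled through sets
  of successor states; a union bound over all of them costs \<open>nS * ln 2\<close> in the exponent
  and is the source of one factor \<open>sqrt nS\<close>. Exponential weights give a pathwise
  inequality, so nothing probabilistic is asked about the way in which the losses were estimated. A
  single action of Player 2 makes the step size 0 and is handled apart.\<close>

definition bounded_fun :: "'w measure \<Rightarrow> ('w \<Rightarrow> real) \<Rightarrow> bool" where
  "bounded_fun M f \<longleftrightarrow> (\<exists>c. \<forall>\<omega>\<in>space M. \<bar>f \<omega>\<bar> \<le> c)"

text \<open>\<open>p\<close> is a fixed version of the conditional expectation of \<open>Y\<close>
  given \<open>F\<close>, characterised by testing against bounded \<open>F\<close>-measurable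
  functions. Since the bounds hold at every point, later manipulations are identities of integrals
  and need no choice of versions.\<close>

definition cond_mean :: "'w measure \<Rightarrow> 'w measure \<Rightarrow> ('w \<Rightarrow> real) \<Rightarrow> ('w \<Rightarrow> real) \<Rightarrow> bool" where
  "cond_mean M F Y p \<longleftrightarrow>
     Y \<in> borel_measurable M \<and> p \<in> borel_measurable F \<and> bounded_fun M Y \<and> bounded_fun M p \<and>
     (\<forall>f\<in>borel_measurable F. bounded_fun M f \<longrightarrow> (\<integral>\<omega>. f \<omega> * Y \<omega> \<partial>M) = (\<integral>\<omega>. f \<omega> * p \<omega> \<partial>M))"

lemma bounded_funI: "(\<And>\<omega>. \<omega> \<in> space M \<Longrightarrow> \<bar>f \<omega>\<bar> \<le> c) \<Longrightarrow> bounded_fun M f"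
  unfolding bounded_fun_def by blast

lemma bounded_fun_mult:
  assumes "bounded_fun M f" "bounded_fun M g"
  shows "bounded_fun M (\<lambda>\<omega>. f \<omega> * g \<omega>)"
proof -
  obtain c d where "\<forall>\<omega>\<in>space M. \<bar>f \<omega>\<bar> \<le> c" "\<forall>\<omega>\<in>space M. \<bar>g \<omega>\<bar> \<le> d"
    using assms unfolding bounded_fun_def by blast
  then show ?thesis
    by (intro bounded_funI[of _ _ "\<bar>c\<bar> * \<bar>d\<bar>"]) (force simp: abs_mult intro!: mult_mono)
qed

lemma bounded_fun_add:
  assumes "bounded_fun M f" "bounded_fun M g"
  shows "bounded_fun M (\<lambda>\<omega>. f \<omega> + g \<omega>)"
proof -
  obtain c d where "\<forall>\<omega>\<in>space M. \<bar>f \<omega>\<bar> \<le> c" "\<forall>\<omega>\<in>space M. \<bar>g \<omega>\<bar> \<le> d"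
    using assms unfolding bounded_fun_def by blast
  then show ?thesis
    by (intro bounded_funI[of _ _ "c + d"]) (smt (verit))
qed

lemma bounded_fun_const: "bounded_fun M (\<lambda>\<omega>. c)"
  by (rule bounded_funI[of _ _ "\<bar>c\<bar>"]) simp

lemma bounded_fun_sum:
  "(\<And>i. i \<in> I \<Longrightarrow> bounded_fun M (f i)) \<Longrightarrow> bounded_fun M (\<lambda>\<omega>. \<Sum>i\<in>I. f i \<omega>)"
  by (induction I rule: infinite_finite_induct) (auto intro: bounded_fun_add bounded_fun_const)

lemma bounded_fun_exp:
  assumes "bounded_fun M f"
  shows "bounded_fun M (\<lambda>\<omega>. exp (f \<omega>))"
proof -
  obtain c where "\<forall>\<omega>\<in>space M. \<bar>f \<omega>\<bar> \<le> c"
    using assms unfolding bounded_fun_def by blast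
  then show ?thesis
    by (intro bounded_funI[of _ _ "exp c"]) force
qed

lemma bounded_fun_uminus: "bounded_fun M f \<Longrightarrow> bounded_fun M (\<lambda>\<omega>. - f \<omega>)"
  unfolding bounded_fun_def by simp

lemma bounded_fun_diff:
  "bounded_fun M f \<Longrightarrow> bounded_fun M g \<Longrightarrow> bounded_fun M (\<lambda>\<omega>. f \<omega> - g \<omega>)"
  using bounded_fun_add[of M f "\<lambda>\<omega>. - g \<omega>"] bounded_fun_uminus by fastforce

lemmas bounded_fun_intros =
  bounded_fun_mult bounded_fun_add bounded_fun_const bounded_fun_sum bounded_fun_exp bounded_fun_diff

lemma bounded_fun_of_bool: "bounded_fun M (\<lambda>\<omega>. of_bool (P \<omega>))"
  by (rule bounded_funI[of _ _ 1]) auto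

section \<open>Calculus of conditional means\<close>

context prob_space
begin

lemma integrable_bounded_fun:
  assumes "f \<in> borel_measurable M" "bounded_fun M f"
  shows "integrable M f"
proof -
  obtain c where "\<forall>\<omega>\<in>space M. \<bar>f \<omega>\<bar> \<le> c"
    using assms unfolding bounded_fun_def by blast
  then have "AE \<omega> in M. norm (f \<omega>) \<le> c"
    by (intro AE_I2) simp
  then show ?thesis
    using assms(1) by (rule integrable_const_bound)
qed

text \<open>Translates the almost sure equations of the protocol. The function \<open>p\<close> is
  an explicit representative of the conditional expectation, so that null sets do not reach the
  later arguments.\<close>

lemma cond_mean_real_cond_exp:
  assumes F: "subalgebra M F" and Y: "Y \<in> borel_measurable M" "bounded_fun M Y"
    and p: "p \<in> borel_measurable F" "bounded_fun M p"
    and AE: "AE \<omega> in M. real_cond_exp M F Y \<omega> = p \<omega>"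
  shows "cond_mean M F Y p"
  unfolding cond_mean_def
proof (intro conjI ballI impI Y p)
  fix f :: "'a \<Rightarrow> real" assume f: "f \<in> borel_measurable F" "bounded_fun M f"
  interpret finite_measure_subalgebra M F
    by unfold_locales (rule F)
  have fM: "f \<in> borel_measurable M" "p \<in> borel_measurable M"
    by (rule measurable_from_subalg[OF F], fact)+
  have "(\<integral>\<omega>. f \<omega> * Y \<omega> \<partial>M) = (\<integral>\<omega>. f \<omega> * real_cond_exp M F Y \<omega> \<partial>M)"
    by (rule real_cond_exp_intg(2)[symmetric])
       (use f fM Y in \<open>auto intro: integrable_bounded_fun bounded_fun_mult borel_measurable_times\<close>)
  also have "\<dots> = (\<integral>\<omega>. f \<omega> * p \<omega> \<partial>M)"
  proof (rule integral_cong_AE)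
    show "AE \<omega> in M. f \<omega> * real_cond_exp M F Y \<omega> = f \<omega> * p \<omega>"
      using AE by eventually_elim simp
  qed (intro borel_measurable_times fM borel_measurable_cond_exp2)+
  finally show "(\<integral>\<omega>. f \<omega> * Y \<omega> \<partial>M) = (\<integral>\<omega>. f \<omega> * p \<omega> \<partial>M)" .
qed

end

lemma cond_mean_refl:
  assumes "subalgebra M F" "Y \<in> borel_measurable F" "bounded_fun M Y"
  shows "cond_mean M F Y Y"
  using assms measurable_from_subalg[OF assms(1,2)] unfolding cond_mean_def by simp

lemma bounded_fun_cong: "(\<And>\<omega>. \<omega> \<in> space M \<Longrightarrow> f \<omega> = g \<omega>) \<Longrightarrow> bounded_fun M f = bounded_fun M g"
  unfolding bounded_fun_def by simp

lemma cond_mean_cong: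
  assumes "subalgebra M F" "cond_mean M F Y p"
    and eq: "\<And>\<omega>. \<omega> \<in> space M \<Longrightarrow> Y \<omega> = Y' \<omega>" "\<And>\<omega>. \<omega> \<in> space M \<Longrightarrow> p \<omega> = p' \<omega>"
  shows "cond_mean M F Y' p'"
proof -
  have 1: "Y \<in> borel_measurable M \<longleftrightarrow> Y' \<in> borel_measurable M"
    by (rule measurable_cong) (use eq in auto)
  have 2: "p \<in> borel_measurable F \<longleftrightarrow> p' \<in> borel_measurable F"
    by (rule measurable_cong) (use eq assms(1) in \<open>auto simp: subalgebra_def\<close>)
  have 3: "(\<integral>\<omega>. f \<omega> * Y \<omega> \<partial>M) = (\<integral>\<omega>. f \<omega> * Y' \<omega> \<partial>M)"
    "(\<integral>\<omega>. f \<omega> * p \<omega> \<partial>M) = (\<integral>\<omega>. f \<omega> * p' \<omega> \<partial>M)" for f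
    by (rule Bochner_Integration.integral_cong; use eq in simp)+
  show ?thesis
    using assms(2) 1 2 3 bounded_fun_cong[of M Y Y'] bounded_fun_cong[of M p p'] eq
    unfolding cond_mean_def by simp
qed

text \<open>The known factor \<open>g\<close> is absorbed into the test function:
  \<open>f * g\<close> is again bounded and \<open>F\<close>-measurable.\<close>

lemma cond_mean_mult:
  assumes "subalgebra M F" "cond_mean M F Y p" "g \<in> borel_measurable F" "bounded_fun M g"
  shows "cond_mean M F (\<lambda>\<omega>. g \<omega> * Y \<omega>) (\<lambda>\<omega>. g \<omega> * p \<omega>)"
  unfolding cond_mean_def
proof (intro conjI ballI impI)
  have gM: "g \<in> borel_measurable M"
    by (rule measurable_from_subalg; fact)
  show "(\<lambda>\<omega>. g \<omega> * Y \<omega>) \<in> borel_measurable M" "(\<lambda>\<omega>. g \<omega> * p \<omega>) \<in> borel_measurable F"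
    "bounded_fun M (\<lambda>\<omega>. g \<omega> * Y \<omega>)" "bounded_fun M (\<lambda>\<omega>. g \<omega> * p \<omega>)"
    using assms gM unfolding cond_mean_def
    by (blast intro: bounded_fun_mult borel_measurable_times)+
  fix f :: "'a \<Rightarrow> real" assume f: "f \<in> borel_measurable F" "bounded_fun M f"
  have "(\<lambda>\<omega>. f \<omega> * g \<omega>) \<in> borel_measurable F" "bounded_fun M (\<lambda>\<omega>. f \<omega> * g \<omega>)"
    by (intro borel_measurable_times bounded_fun_mult f assms)+
  then have "(\<integral>\<omega>. f \<omega> * g \<omega> * Y \<omega> \<partial>M) = (\<integral>\<omega>. f \<omega> * g \<omega> * p \<omega> \<partial>M)"
    using assms(2) unfolding cond_mean_def by blast
  then show "(\<integral>\<omega>. f \<omega> * (g \<omega> * Y \<omega>) \<partial>M) = (\<integral>\<omega>. f \<omega> * (g \<omega> * p \<omega>) \<partial>M)"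
    by (simp only: mult.assoc)
qed

lemma cond_mean_tower:
  assumes "subalgebra G F" "cond_mean M G Y p" "cond_mean M F p q"
  shows "cond_mean M F Y q"
  unfolding cond_mean_def
proof (intro conjI ballI impI)
  fix f :: "'a \<Rightarrow> real" assume f: "f \<in> borel_measurable F" "bounded_fun M f"
  then have "f \<in> borel_measurable G"
    using measurable_from_subalg[OF assms(1)] by auto
  then show "(\<integral>\<omega>. f \<omega> * Y \<omega> \<partial>M) = (\<integral>\<omega>. f \<omega> * q \<omega> \<partial>M)"
    using assms(2,3) f unfolding cond_mean_def by simp
qed (use assms in \<open>auto simp: cond_mean_def\<close>)

lemma (in prob_space) cond_mean_sum:
  assumes F: "subalgebra M F" and Y: "\<And>i. i \<in> I \<Longrightarrow> cond_mean M F (Y i) (p i)"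
  shows "cond_mean M F (\<lambda>\<omega>. \<Sum>i\<in>I. Y i \<omega>) (\<lambda>\<omega>. \<Sum>i\<in>I. p i \<omega>)"
  unfolding cond_mean_def
proof (intro conjI ballI impI)
  have meas: "p i \<in> borel_measurable M" if "i \<in> I" for i
    using Y[OF that] measurable_from_subalg[OF F] unfolding cond_mean_def by auto
  show "(\<lambda>\<omega>. \<Sum>i\<in>I. Y i \<omega>) \<in> borel_measurable M" "(\<lambda>\<omega>. \<Sum>i\<in>I. p i \<omega>) \<in> borel_measurable F"
    "bounded_fun M (\<lambda>\<omega>. \<Sum>i\<in>I. Y i \<omega>)" "bounded_fun M (\<lambda>\<omega>. \<Sum>i\<in>I. p i \<omega>)"
    using Y unfolding cond_mean_def by (auto intro!: bounded_fun_sum borel_measurable_sum)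
  fix f :: "'a \<Rightarrow> real" assume f: "f \<in> borel_measurable F" "bounded_fun M f"
  have fM: "f \<in> borel_measurable M"
    using measurable_from_subalg[OF F f(1)] .
  have "(\<integral>\<omega>. f \<omega> * (\<Sum>i\<in>I. Y i \<omega>) \<partial>M) = (\<Sum>i\<in>I. \<integral>\<omega>. f \<omega> * Y i \<omega> \<partial>M)"
    unfolding sum_distrib_left using Y f fM
    by (intro Bochner_Integration.integral_sum integrable_bounded_fun bounded_fun_mult
        borel_measurable_times) (auto simp: cond_mean_def)
  also have "\<dots> = (\<Sum>i\<in>I. \<integral>\<omega>. f \<omega> * p i \<omega> \<partial>M)"
    using Y f by (intro sum.cong) (auto simp: cond_mean_def)
  also have "\<dots> = (\<integral>\<omega>. f \<omega> * (\<Sum>i\<in>I. p i \<omega>) \<partial>M)"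
    unfolding sum_distrib_left using Y f fM meas
    by (intro Bochner_Integration.integral_sum[symmetric] integrable_bounded_fun bounded_fun_mult
        borel_measurable_times) (auto simp: cond_mean_def)
  finally show "(\<integral>\<omega>. f \<omega> * (\<Sum>i\<in>I. Y i \<omega>) \<partial>M) = (\<integral>\<omega>. f \<omega> * (\<Sum>i\<in>I. p i \<omega>) \<partial>M)" .
qed

text \<open>Exchanges the two tails without leaving the interval from 0 to 1, which plain negation
  would do. A one-sided concentration bound thus serves both directions.\<close>

lemma (in prob_space) cond_mean_compl:
  assumes F: "subalgebra M F" and Y: "cond_mean M F Y p"
  shows "cond_mean M F (\<lambda>\<omega>. 1 - Y \<omega>) (\<lambda>\<omega>. 1 - p \<omega>)"
proof -
  have 1: "cond_mean M F (\<lambda>\<omega>. 1) (\<lambda>\<omega>. 1)"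
    by (rule cond_mean_refl[OF F]) (auto intro: bounded_fun_const)
  have 2: "cond_mean M F (\<lambda>\<omega>. -1 * Y \<omega>) (\<lambda>\<omega>. -1 * p \<omega>)"
    by (rule cond_mean_mult[OF F Y]) (auto intro: bounded_fun_const)
  \<comment> \<open>The difference is cast as a sum over the two booleans, so that
    \<open>cond_mean_sum\<close> applies.\<close>
  have "cond_mean M F (\<lambda>\<omega>. \<Sum>i\<in>UNIV. if i then 1 else -1 * Y \<omega>) (\<lambda>\<omega>. \<Sum>i\<in>UNIV. if i then 1 else -1 * p \<omega>)"
  proof (rule cond_mean_sum[OF F])
    show "cond_mean M F (\<lambda>\<omega>. if i then 1 else -1 * Y \<omega>) (\<lambda>\<omega>. if i then 1 else -1 * p \<omega>)" for i
      using 1 2 by (cases i) auto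
  qed
  then show ?thesis
    by (simp add: UNIV_bool)
qed

section \<open>Exceptional sets and a self-normalised Hoeffding bound\<close>

context prob_space
begin

text \<open>\<open>c\<close> bounds the probability of failure. \<open>Q\<close> itself need not be
  measurable: it only has to hold outside a measurable exceptional set, which makes union bounds and
  consequences immediate.\<close>

definition whp :: "real \<Rightarrow> ('a \<Rightarrow> bool) \<Rightarrow> bool" where
  "whp c Q \<longleftrightarrow> (\<exists>A\<in>events. prob A \<le> c \<and> (\<forall>\<omega>\<in>space M - A. Q \<omega>))"

lemma whp_conj:
  assumes "whp c Q" "whp c' Q'"
  shows "whp (c + c') (\<lambda>\<omega>. Q \<omega> \<and> Q' \<omega>)"
proof -
  obtain A A' where A: "A \<in> events" "prob A \<le> c" "\<forall>\<omega>\<in>space M - A. Q \<omega>"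
    and A': "A' \<in> events" "prob A' \<le> c'" "\<forall>\<omega>\<in>space M - A'. Q' \<omega>"
    using assms unfolding whp_def by blast
  have "prob (A \<union> A') \<le> c + c'"
    using measure_Un_le[OF A(1) A'(1)] A(2) A'(2) by linarith
  then show ?thesis
    unfolding whp_def using A A' by (intro bexI[of _ "A \<union> A'"]) auto
qed

lemma whp_ball:
  assumes "finite I" "\<And>i. i \<in> I \<Longrightarrow> whp c (Q i)"
  shows "whp (real (card I) * c) (\<lambda>\<omega>. \<forall>i\<in>I. Q i \<omega>)"
  using assms
proof (induction I)
  case empty
  then show ?case
    unfolding whp_def by (intro bexI[of _ "{}"]) auto
next
  case (insert i I)
  have "whp (c + real (card I) * c) (\<lambda>\<omega>. Q i \<omega> \<and> (\<forall>i\<in>I. Q i \<omega>))"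
    using insert by (intro whp_conj) auto
  then show ?case
    using insert by (simp add: algebra_simps)
qed

lemma whp_mono:
  assumes "whp c Q" "\<And>\<omega>. \<omega> \<in> space M \<Longrightarrow> Q \<omega> \<Longrightarrow> Q' \<omega>"
  shows "whp c Q'"
  using assms unfolding whp_def by blast

text \<open>One step of an exponential supermartingale. Convexity replaces the exponential by its
  chord, which is affine in \<open>Y\<close>; this allows \<open>Y\<close> to be exchanged for
  \<open>p\<close> under the integral. Hoeffding's estimate then bounds the chord at
  \<open>p\<close>. The switch \<open>w\<close> turns the factor into 1 when the round does not
  count.\<close>

lemma hoeffding_step:
  fixes f w Y p :: "'a \<Rightarrow> real" and l :: real
  assumes F: "subalgebra M F" and Y: "cond_mean M F Y p"
    and Y01: "\<And>\<omega>. \<omega> \<in> space M \<Longrightarrow> Y \<omega> \<in> {0..1}" and p01: "\<And>\<omega>. \<omega> \<in> space M \<Longrightarrow> p \<omega> \<in> {0..1}"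
    and w: "w \<in> borel_measurable F" "\<And>\<omega>. \<omega> \<in> space M \<Longrightarrow> w \<omega> \<in> {0, 1}"
    and f: "f \<in> borel_measurable F" "bounded_fun M f" "\<And>\<omega>. \<omega> \<in> space M \<Longrightarrow> 0 \<le> f \<omega>"
    and l: "0 \<le> l"
  shows "(\<integral>\<omega>. f \<omega> * exp (w \<omega> * (l * (Y \<omega> - p \<omega>) - l\<^sup>2 / 8)) \<partial>M) \<le> (\<integral>\<omega>. f \<omega> \<partial>M)"
proof -
  define g where "g \<omega> = exp (- l * p \<omega> - l\<^sup>2 / 8)" for \<omega>
  \<comment> \<open>\<open>a + b * Y\<close> is the chord majorant multiplied by \<open>f\<close>,
    with coefficients measurable in \<open>F\<close>.\<close>
  define a where "a \<omega> = f \<omega> * ((1 - w \<omega>) + w \<omega> * g \<omega>)" for \<omega>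
  define b where "b \<omega> = f \<omega> * w \<omega> * g \<omega> * (exp l - 1)" for \<omega>
  have pF: "p \<in> borel_measurable F" and YM: "Y \<in> borel_measurable M" and bY: "bounded_fun M Y"
    and bp: "bounded_fun M p"
    using Y unfolding cond_mean_def by auto
  have bw: "bounded_fun M w"
    using w(2) by (intro bounded_funI[of _ _ 1]) force
  have bg: "bounded_fun M g"
    unfolding g_def by (intro bounded_fun_intros bp)
  have gF: "g \<in> borel_measurable F"
    unfolding g_def using pF by measurable
  have aF: "a \<in> borel_measurable F" and bF: "b \<in> borel_measurable F"
    unfolding a_def b_def using f w gF by measurable
  have ba: "bounded_fun M a" and bb: "bounded_fun M b"
    unfolding a_def b_def by (intro bounded_fun_intros f bw bg)+
  note M = measurable_from_subalg[OF F]
  have step: "f \<omega> * exp (w \<omega> * (l * (Y \<omega> - p \<omega>) - l\<^sup>2 / 8)) \<le> a \<omega> + b \<omega> * Y \<omega>" if "\<omega> \<in> space M" for \<omega>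
  proof -
    have "exp (l * Y \<omega>) \<le> 1 + Y \<omega> * (exp l - 1)"
    proof -
      have "exp ((1 - Y \<omega>) * 0 + Y \<omega> * l) \<le> (1 - Y \<omega>) * exp 0 + Y \<omega> * exp l"
        using convex_onD[OF convex_on_exp[of 1], of "Y \<omega>" 0 l] Y01[OF that] by simp
      then show ?thesis
        by (simp add: algebra_simps)
    qed
    then have "exp (l * Y \<omega>) * g \<omega> \<le> (1 + Y \<omega> * (exp l - 1)) * g \<omega>"
      by (intro mult_right_mono) (auto simp: g_def)
    moreover have "exp (l * Y \<omega>) * g \<omega> = exp (l * (Y \<omega> - p \<omega>) - l\<^sup>2 / 8)"
      unfolding g_def exp_add[symmetric] by (simp add: algebra_simps)
    ultimately have "exp (w \<omega> * (l * (Y \<omega> - p \<omega>) - l\<^sup>2 / 8)) \<le> (1 - w \<omega>) + w \<omega> * ((1 + Y \<omega> * (exp l - 1)) * g \<omega>)"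
      using w(2)[OF that] by auto
    then have "f \<omega> * exp (w \<omega> * (l * (Y \<omega> - p \<omega>) - l\<^sup>2 / 8)) \<le> f \<omega> * ((1 - w \<omega>) + w \<omega> * ((1 + Y \<omega> * (exp l - 1)) * g \<omega>))"
      using f(3)[OF that] by (rule mult_left_mono)
    also have "\<dots> = a \<omega> + b \<omega> * Y \<omega>"
      unfolding a_def b_def by (simp add: algebra_simps)
    finally show ?thesis .
  qed
  \<comment> \<open>At \<open>p\<close> the chord is \<open>1 + p * (exp l - 1)\<close>, at most
    \<open>exp (l * p + l\<^sup>2 / 8)\<close>; \<open>g\<close> is exactly the reciprocal of the
    latter.\<close>
  have le: "a \<omega> + b \<omega> * p \<omega> \<le> f \<omega>" if "\<omega> \<in> space M" for \<omega>
  proof -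
    have p: "0 \<le> p \<omega>" using p01[OF that] by simp
    have pos: "1 + p \<omega> * (exp l - 1) > 0"
      using p l by (simp add: add_pos_nonneg)
    have "ln (1 + p \<omega> * (exp l - 1)) \<le> l * p \<omega> + l\<^sup>2 / 8"
      using Hoeffdings_lemma_aux[OF l p] by (simp add: algebra_simps)
    then have "1 + p \<omega> * (exp l - 1) \<le> exp (l * p \<omega> + l\<^sup>2 / 8)"
      by (metis exp_le_cancel_iff exp_ln pos)
    then have "(1 + p \<omega> * (exp l - 1)) * g \<omega> \<le> exp (l * p \<omega> + l\<^sup>2 / 8) * g \<omega>"
      by (intro mult_right_mono) (auto simp: g_def)
    also have "\<dots> = 1"
      unfolding g_def exp_add[symmetric] by simp
    finally have "(1 - w \<omega>) + w \<omega> * ((1 + p \<omega> * (exp l - 1)) * g \<omega>) \<le> 1"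
      using w(2)[OF that] by auto
    then have "f \<omega> * ((1 - w \<omega>) + w \<omega> * ((1 + p \<omega> * (exp l - 1)) * g \<omega>)) \<le> f \<omega> * 1"
      using f(3)[OF that] by (rule mult_left_mono)
    then show ?thesis
      unfolding a_def b_def by (simp add: algebra_simps)
  qed
  have iY: "integrable M (\<lambda>\<omega>. b \<omega> * Y \<omega>)" "integrable M (\<lambda>\<omega>. b \<omega> * p \<omega>)" "integrable M a" "integrable M f"
    using aF bF YM pF f M ba bb bY bp
    by (auto intro!: integrable_bounded_fun bounded_fun_mult borel_measurable_times)
  have "(\<integral>\<omega>. f \<omega> * exp (w \<omega> * (l * (Y \<omega> - p \<omega>) - l\<^sup>2 / 8)) \<partial>M) \<le> (\<integral>\<omega>. a \<omega> + b \<omega> * Y \<omega> \<partial>M)"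
  proof (rule integral_mono)
    note [measurable] = M[OF f(1)] M[OF w(1)] M[OF pF] YM
    show "integrable M (\<lambda>\<omega>. f \<omega> * exp (w \<omega> * (l * (Y \<omega> - p \<omega>) - l\<^sup>2 / 8)))"
    proof (rule integrable_bounded_fun)
      show "(\<lambda>\<omega>. f \<omega> * exp (w \<omega> * (l * (Y \<omega> - p \<omega>) - l\<^sup>2 / 8))) \<in> borel_measurable M"
        by measurable
    qed (intro bounded_fun_intros f bw bY bp)
  qed (use step iY in auto)
  also have "\<dots> = (\<integral>\<omega>. a \<omega> + b \<omega> * p \<omega> \<partial>M)"
    using Y bF bb iY unfolding cond_mean_def by simp
  also have "\<dots> \<le> (\<integral>\<omega>. f \<omega> \<partial>M)"
    using iY le by (intro integral_mono) auto
  finally show ?thesis .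
qed

text \<open>By \<open>hist\<close> the product of the earlier factors is known before the next
  round, so it can play the role of \<open>f\<close> in \<open>hoeffding_step\<close>, which then
  removes the newest factor.\<close>

lemma hoeffding_exp_moment:
  fixes F :: "nat \<Rightarrow> 'a measure" and w Y p :: "nat \<Rightarrow> 'a \<Rightarrow> real" and l :: real
  assumes F: "\<And>k. k \<in> {1..K} \<Longrightarrow> subalgebra M (F k)"
    and Y: "\<And>k. k \<in> {1..K} \<Longrightarrow> cond_mean M (F k) (Y k) (p k)"
    and w: "\<And>k. k \<in> {1..K} \<Longrightarrow> w k \<in> borel_measurable (F k)"
    and hist: "\<And>j k. 1 \<le> j \<Longrightarrow> j < k \<Longrightarrow> k \<le> K \<Longrightarrow> w j \<in> borel_measurable (F k) \<and>
                 Y j \<in> borel_measurable (F k) \<and> p j \<in> borel_measurable (F k)"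
    and Y01: "\<And>k \<omega>. k \<in> {1..K} \<Longrightarrow> \<omega> \<in> space M \<Longrightarrow> Y k \<omega> \<in> {0..1}"
    and p01: "\<And>k \<omega>. k \<in> {1..K} \<Longrightarrow> \<omega> \<in> space M \<Longrightarrow> p k \<omega> \<in> {0..1}"
    and w01: "\<And>k \<omega>. k \<in> {1..K} \<Longrightarrow> \<omega> \<in> space M \<Longrightarrow> w k \<omega> \<in> {0, 1}"
    and l: "0 \<le> l"
  shows "n \<le> K \<Longrightarrow> (\<integral>\<omega>. exp (\<Sum>k=1..n. w k \<omega> * (l * (Y k \<omega> - p k \<omega>) - l\<^sup>2 / 8)) \<partial>M) \<le> 1"
proof (induction n)
  case 0
  then show ?case by (simp add: prob_space)
next
  case (Suc n)
  let ?S = "\<lambda>\<omega>. \<Sum>k=1..n. w k \<omega> * (l * (Y k \<omega> - p k \<omega>) - l\<^sup>2 / 8)"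
  have k: "Suc n \<in> {1..K}" using Suc by auto
  have "(\<integral>\<omega>. exp (?S \<omega>) * exp (w (Suc n) \<omega> * (l * (Y (Suc n) \<omega> - p (Suc n) \<omega>) - l\<^sup>2 / 8)) \<partial>M)
        \<le> (\<integral>\<omega>. exp (?S \<omega>) \<partial>M)"
  proof (rule hoeffding_step[OF F[OF k] Y[OF k] Y01[OF k] p01[OF k] w[OF k] w01[OF k] _ _ _ l])
    have [measurable]: "w j \<in> borel_measurable (F (Suc n))" "Y j \<in> borel_measurable (F (Suc n))"
      "p j \<in> borel_measurable (F (Suc n))" if "j \<in> {1..n}" for j
      using hist[of j "Suc n"] that k by auto
    show "(\<lambda>\<omega>. exp (?S \<omega>)) \<in> borel_measurable (F (Suc n))"
      by measurable
    have "bounded_fun M (Y j)" "bounded_fun M (p j)" "bounded_fun M (w j)" if "j \<in> {1..n}" for j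
    proof -
      have "j \<in> {1..K}" using that k by auto
      then show "bounded_fun M (Y j)" "bounded_fun M (p j)" "bounded_fun M (w j)"
        using Y01[of j] p01[of j] w01[of j]
        by (intro bounded_funI[of _ _ 1]; force)+
    qed
    then show "bounded_fun M (\<lambda>\<omega>. exp (?S \<omega>))"
      by (intro bounded_fun_intros) auto
  qed auto
  then show ?case
    using Suc by (simp add: exp_add)
qed

text \<open>The width follows the number of counted rounds, not of all rounds, as rarely visited
  tuples require. One factor \<open>K\<close> of the failure probability comes from the prefix
  length \<open>k\<close>, the other from the number of counted rounds.\<close>

lemma hoeffding_self_normalised:
  fixes F :: "nat \<Rightarrow> 'a measure" and w Y p :: "nat \<Rightarrow> 'a \<Rightarrow> real" and t :: real
  assumes F: "\<And>k. k \<in> {1..K} \<Longrightarrow> subalgebra M (F k)"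
    and Y: "\<And>k. k \<in> {1..K} \<Longrightarrow> cond_mean M (F k) (Y k) (p k)"
    and w: "\<And>k. k \<in> {1..K} \<Longrightarrow> w k \<in> borel_measurable (F k)"
    and hist: "\<And>j k. 1 \<le> j \<Longrightarrow> j < k \<Longrightarrow> k \<le> K \<Longrightarrow> w j \<in> borel_measurable (F k) \<and>
                 Y j \<in> borel_measurable (F k) \<and> p j \<in> borel_measurable (F k)"
    and Y01: "\<And>k \<omega>. k \<in> {1..K} \<Longrightarrow> \<omega> \<in> space M \<Longrightarrow> Y k \<omega> \<in> {0..1}"
    and p01: "\<And>k \<omega>. k \<in> {1..K} \<Longrightarrow> \<omega> \<in> space M \<Longrightarrow> p k \<omega> \<in> {0..1}"
    and w01: "\<And>k \<omega>. k \<in> {1..K} \<Longrightarrow> \<omega> \<in> space M \<Longrightarrow> w k \<omega> \<in> {0, 1}"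
    and t: "0 < t"
  shows "whp (real K ^ 2 * exp (- t)) (\<lambda>\<omega>. \<forall>k\<in>{1..K}.
       (\<Sum>j=1..k. w j \<omega> * (Y j \<omega> - p j \<omega>)) \<le> sqrt (t * (\<Sum>j=1..k. w j \<omega>) / 2))"
proof -
  \<comment> \<open>The best exponent depends on the random number of visits, so we take a union bound over its
    possible values \<open>n\<close>, each with its own exponent \<open>l n\<close>.\<close>
  define l where "l n = sqrt (8 * t / real n)" for n :: nat
  define Z where "Z k n \<omega> = (\<Sum>j=1..k. w j \<omega> * (l n * (Y j \<omega> - p j \<omega>) - (l n)\<^sup>2 / 8))" for k n \<omega>
  define A where "A k n = {\<omega> \<in> space M. t \<le> Z k n \<omega>}" for k n
  have l0: "0 \<le> l n" for n
    using t by (simp add: l_def)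
  have wM [measurable]: "w k \<in> borel_measurable M" "p k \<in> borel_measurable M" "Y k \<in> borel_measurable M" if "k \<in> {1..K}" for k
    using w[OF that] Y[OF that] measurable_from_subalg[OF F[OF that], of _ borel] unfolding cond_mean_def by auto
  have ZM: "Z k n \<in> borel_measurable M" if "k \<in> {1..K}" for k n
  proof -
    have [measurable]: "w j \<in> borel_measurable M" "p j \<in> borel_measurable M" "Y j \<in> borel_measurable M" if "j \<in> {1..k}" for j
      using that \<open>k \<in> {1..K}\<close> by (auto intro: wM)
    show ?thesis
      unfolding Z_def by measurable
  qed
  have "bounded_fun M (w j)" "bounded_fun M (p j)" "bounded_fun M (Y j)" if "j \<in> {1..K}" for j
    using Y01[OF that] p01[OF that] w01[OF that] by (intro bounded_funI[of _ _ 1]; force)+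
  then have bZ: "bounded_fun M (Z k n)" if "k \<in> {1..K}" for k n
    unfolding Z_def using that by (intro bounded_fun_intros) auto
  have A_ev: "A k n \<in> events" if "k \<in> {1..K}" for k n
    using ZM[OF that] unfolding A_def by measurable
  have A_prob: "prob (A k n) \<le> exp (- t)" if "k \<in> {1..K}" for k n
  proof -
    have "prob {\<omega> \<in> space M. exp (Z k n \<omega>) \<ge> exp t} \<le> (\<integral>\<omega>. exp (Z k n \<omega>) \<partial>M) / exp t"
      by (rule integral_Markov_inequality_measure[where A = "{}"])
         (use ZM[OF that] bZ[OF that] in \<open>auto intro!: integrable_bounded_fun bounded_fun_intros borel_measurable_exp\<close>)
    also have "\<dots> \<le> 1 / exp t"
      using hoeffding_exp_moment[OF F Y w hist Y01 p01 w01 l0, where n = k] that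
      by (intro divide_right_mono) (auto simp: Z_def)
    finally show ?thesis
      by (simp add: A_def exp_minus inverse_eq_divide)
  qed
  let ?A = "\<Union>(k, n)\<in>{1..K} \<times> {1..K}. A k n"
  show ?thesis
    unfolding whp_def
  proof (intro bexI[of _ ?A] conjI ballI)
    show "?A \<in> events"
      using A_ev by auto
    have "prob ?A \<le> (\<Sum>(k, n)\<in>{1..K} \<times> {1..K}. prob (A k n))"
      unfolding case_prod_beta' by (rule finite_measure_subadditive_finite) (use A_ev in auto)
    also have "\<dots> \<le> (\<Sum>(k, n)\<in>{1..K} \<times> {1..K}. exp (- t))"
      using A_prob by (intro sum_mono) auto
    also have "\<dots> = real K ^ 2 * exp (- t)"
      by (simp add: power2_eq_square)
    finally show "prob ?A \<le> real K ^ 2 * exp (- t)" .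
  next
    fix \<omega> k assume \<omega>: "\<omega> \<in> space M - ?A" and k: "k \<in> {1..K}"
    define D where "D = (\<Sum>j=1..k. w j \<omega> * (Y j \<omega> - p j \<omega>))"
    define n where "n = card {j\<in>{1..k}. w j \<omega> = 1}"
    have w01': "w j \<omega> = of_bool (w j \<omega> = 1)" if "j \<in> {1..k}" for j
      using w01[of j \<omega>] that k \<omega> by auto
    have "(\<Sum>j=1..k. w j \<omega>) = (\<Sum>j=1..k. of_bool (w j \<omega> = 1))"
      by (rule sum.cong) (use w01' in auto)
    also have "\<dots> = real n"
      by (simp add: n_def Int_def)
    finally have n: "(\<Sum>j=1..k. w j \<omega>) = real n" .
    have "D \<le> sqrt (t * real n / 2)"
    \<comment> \<open>With no counted round every term vanishes. The case is separate because
      \<open>l 0\<close> is 0, by the convention for division by zero.\<close>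
    proof (cases "n = 0")
      case True
      then have "w j \<omega> \<noteq> 1" if "j \<in> {1..k}" for j
        using that by (auto simp: n_def)
      then have "w j \<omega> = 0" if "j \<in> {1..k}" for j
        using that w01' by (metis of_bool_eq(1))
      then have "D = 0"
        unfolding D_def by (intro sum.neutral) auto
      then show ?thesis using t by simp
    next
      case False
      have "card {j\<in>{1..k}. w j \<omega> = 1} \<le> card {1..k}"
        by (rule card_mono) auto
      then have nK: "n \<in> {1..K}"
        using False k unfolding n_def[symmetric] by simp
      then have "\<not> t \<le> Z k n \<omega>"
        using \<omega> k unfolding A_def by blast
      moreover have "Z k n \<omega> = l n * D - (l n)\<^sup>2 / 8 * real n"
        unfolding Z_def D_def n[symmetric] by (simp add: sum_distrib_left sum_subtractf sum.distrib sum_divide_distrib algebra_simps)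
      \<comment> \<open>Failure of the event gives \<open>D < t / l + l * n / 8\<close> for
        \<open>l = l n\<close>; the choice of \<open>l n\<close> minimises the right-hand side by
        making its two terms equal.\<close>
      moreover have "(l n)\<^sup>2 / 8 * real n = t"
        using t False by (simp add: l_def)
      ultimately have "l n * D < 2 * t" by simp
      moreover have "l n * sqrt (t * real n / 2) = 2 * t"
      proof -
        have "l n * sqrt (t * real n / 2) = sqrt (8 * t / real n * (t * real n / 2))"
          by (simp only: l_def real_sqrt_mult)
        also have "8 * t / real n * (t * real n / 2) = (2 * t)\<^sup>2"
          using False by (simp add: field_simps power2_eq_square)
        also have "sqrt ((2 * t)\<^sup>2) = 2 * t"
          using t by (intro real_sqrt_unique) auto
        finally show ?thesis .
      qed
      moreover have "l n > 0"
        using t False by (simp add: l_def)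
      ultimately show ?thesis
        by (smt (verit) mult_left_mono mult_le_cancel_left_pos)
    qed
    then show "(\<Sum>j=1..k. w j \<omega> * (Y j \<omega> - p j \<omega>)) \<le> sqrt (t * (\<Sum>j=1..k. w j \<omega>) / 2)"
      unfolding D_def n .
  qed
qed

end

section \<open>Exponential weights and visit counts\<close>

text \<open>The product of the normalisers serves as potential: its logarithm is bounded below
  through any single action and above by a second-order expansion. Losses are only assumed
  nonnegative, and the quadratic term keeps its average under \<open>p\<close>; later this preserves
  the occupancy factor. Index 0 is the uniform start, with a loss of its own.\<close>

lemma exp_weights_regret:
  fixes p l :: "nat \<Rightarrow> 'b \<Rightarrow> real" and u :: "'b \<Rightarrow> real"
  assumes B: "finite B" "B \<noteq> {}" and g: "g > 0"
    and init: "\<And>b. b \<in> B \<Longrightarrow> p 0 b = 1 / real (card B)"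
    and step: "\<And>k b. k < K \<Longrightarrow> b \<in> B \<Longrightarrow>
          p (Suc k) b = p k b * exp (- g * l k b) / (\<Sum>b'\<in>B. p k b' * exp (- g * l k b'))"
    and l: "\<And>k b. k \<le> K \<Longrightarrow> b \<in> B \<Longrightarrow> 0 \<le> l k b"
    and u: "\<And>b. b \<in> B \<Longrightarrow> 0 \<le> u b" "(\<Sum>b\<in>B. u b) = 1"
  shows "(\<Sum>k\<le>K. (\<Sum>b\<in>B. p k b * l k b) - (\<Sum>b\<in>B. u b * l k b)) \<le>
     ln (real (card B)) / g + g / 2 * (\<Sum>k\<le>K. \<Sum>b\<in>B. p k b * (l k b)\<^sup>2)"
proof -
  define Z where "Z k = (\<Sum>b\<in>B. p k b * exp (- g * l k b))" for k
  have cB: "real (card B) > 0"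
    using B by (simp add: card_gt_0_iff)
  have p_pos: "b \<in> B \<Longrightarrow> p k b > 0" if "k \<le> K" for k b
    using that
  proof (induction k arbitrary: b)
    case 0
    then show ?case using init cB by simp
  next
    case (Suc k)
    have "0 < (\<Sum>b'\<in>B. p k b' * exp (- g * l k b'))"
      using Suc B by (intro sum_pos) auto
    then show ?case
      using Suc by (simp add: step)
  qed
  have Z_pos: "Z k > 0" if "k \<le> K" for k
    unfolding Z_def using p_pos[OF that] B by (intro sum_pos) auto
  have p_sum: "(\<Sum>b\<in>B. p k b) = 1" if "k \<le> K" for k
  proof (cases k)
    case 0
    then show ?thesis using init cB by simp
  next
    case (Suc j)
    then have "(\<Sum>b\<in>B. p k b) = (\<Sum>b\<in>B. p j b * exp (- g * l j b) / Z j)"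
      using that by (intro sum.cong) (auto simp: step Z_def)
    also have "\<dots> = 1"
      using Z_pos[of j] that Suc by (simp add: Z_def flip: sum_divide_distrib)
    finally show ?thesis .
  qed
  \<comment> \<open>Unrolled update: the weights are exponentials of cumulative losses, normalised
    by the product of all earlier \<open>Z\<close>.\<close>
  have prod: "p m b * (\<Prod>k<m. Z k) = exp (- g * (\<Sum>k<m. l k b)) / real (card B)"
    if "m \<le> K" "b \<in> B" for m b
    using that
  proof (induction m)
    case 0
    then show ?case using init by simp
  next
    case (Suc m)
    have "p (Suc m) b * (\<Prod>k<Suc m. Z k) = p m b * exp (- g * l m b) / Z m * ((\<Prod>k<m. Z k) * Z m)"
      using Suc by (simp add: step Z_def)
    also have "\<dots> = exp (- g * l m b) * (p m b * (\<Prod>k<m. Z k))"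
      using Z_pos[of m] Suc.prems by simp
    also have "\<dots> = exp (- g * l m b) * (exp (- g * (\<Sum>k<m. l k b)) / real (card B))"
      using Suc by simp
    also have "\<dots> = exp (- g * (\<Sum>k<Suc m. l k b)) / real (card B)"
      by (simp add: exp_add[symmetric] algebra_simps)
    finally show ?case .
  qed
  define R where "R = ln (real (card B)) / g + g / 2 * (\<Sum>k\<le>K. \<Sum>b\<in>B. p k b * (l k b)\<^sup>2)"
  define W where "W = (\<Sum>k\<le>K. \<Sum>b\<in>B. p k b * l k b)"
  have lnZ: "ln (Z k) \<le> - g * (\<Sum>b\<in>B. p k b * l k b) + g\<^sup>2 / 2 * (\<Sum>b\<in>B. p k b * (l k b)\<^sup>2)"
    if "k \<le> K" for k
  proof -
    \<comment> \<open>The reciprocal of the Taylor bound for \<open>exp y\<close> suffices, because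
      \<open>(1 - y + y\<^sup>2 / 2) * (1 + y + y\<^sup>2 / 2)\<close> equals
      \<open>1 + y ^ 4 / 4\<close>.\<close>
    have e: "exp (- y) \<le> 1 - y + y\<^sup>2 / 2" if "y \<ge> 0" for y :: real
    proof -
      have "1 + y + y\<^sup>2 / 2 \<le> exp y"
        using exp_lower_Taylor_quadratic[OF that] by simp
      moreover have "1 + y + y\<^sup>2 / 2 > 0"
        using that by (simp add: add_pos_nonneg)
      ultimately have "exp (- y) \<le> 1 / (1 + y + y\<^sup>2 / 2)"
        by (simp add: exp_minus inverse_eq_divide frac_le)
      also have "\<dots> \<le> 1 - y + y\<^sup>2 / 2"
      proof -
        have "(1 - y + y\<^sup>2 / 2) * (1 + y + y\<^sup>2 / 2) = 1 + (y\<^sup>2)\<^sup>2 / 4"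
          by (simp add: field_simps power2_eq_square)
        then have "1 \<le> (1 - y + y\<^sup>2 / 2) * (1 + y + y\<^sup>2 / 2)"
          by simp
        then show ?thesis
          using \<open>1 + y + y\<^sup>2 / 2 > 0\<close> by (simp add: pos_divide_le_eq)
      qed
      finally show ?thesis .
    qed
    have "ln (Z k) \<le> Z k - 1"
      using Z_pos[OF that] ln_le_minus_one by blast
    also have "Z k \<le> (\<Sum>b\<in>B. p k b * (1 - g * l k b + (g * l k b)\<^sup>2 / 2))"
      unfolding Z_def
    proof (intro sum_mono mult_left_mono)
      fix b assume b: "b \<in> B"
      show "exp (- g * l k b) \<le> 1 - g * l k b + (g * l k b)\<^sup>2 / 2"
        using e[of "g * l k b"] g l[OF that b] by simp
      show "0 \<le> p k b"
        using p_pos[OF that b] by simp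
    qed
    also have "\<dots> - 1 = - g * (\<Sum>b\<in>B. p k b * l k b) + g\<^sup>2 / 2 * (\<Sum>b\<in>B. p k b * (l k b)\<^sup>2)"
    proof -
      have "p k b * (1 - g * l k b + (g * l k b)\<^sup>2 / 2) =
          p k b - g * (p k b * l k b) + g\<^sup>2 / 2 * (p k b * (l k b)\<^sup>2)" for b
        by (simp add: algebra_simps power_mult_distrib)
      then show ?thesis
        using p_sum[OF that] by (simp add: sum.distrib sum_subtractf sum_distrib_left sum_negf)
    qed
    finally show ?thesis by simp
  qed
  \<comment> \<open>The regret is affine in \<open>u\<close>, so single actions suffice; the mixture
    is recovered by averaging.\<close>
  have each: "W - (\<Sum>k\<le>K. l k b) \<le> R" if b: "b \<in> B" for b
  proof -
    have "exp (- g * (\<Sum>k\<le>K. l k b)) / real (card B) = exp (- g * l K b) * (exp (- g * (\<Sum>k<K. l k b)) / real (card B))"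
      by (simp add: exp_add[symmetric] lessThan_Suc_atMost[symmetric] algebra_simps)
    also have "\<dots> = p K b * exp (- g * l K b) * (\<Prod>k<K. Z k)"
      unfolding prod[OF order_refl b, symmetric] by (simp only: mult_ac)
    also have "\<dots> \<le> Z K * (\<Prod>k<K. Z k)"
    proof (rule mult_right_mono)
      show "p K b * exp (- g * l K b) \<le> Z K"
        unfolding Z_def using p_pos[of K] B b
        by (intro member_le_sum[of b B "\<lambda>b. p K b * exp (- g * l K b)"]) (auto intro: less_imp_le)
      show "0 \<le> (\<Prod>k<K. Z k)"
        using Z_pos by (intro prod_nonneg) (auto intro: less_imp_le)
    qed
    also have "\<dots> = (\<Prod>k\<le>K. Z k)"
      by (simp add: lessThan_Suc_atMost[symmetric])
    finally have "ln (exp (- g * (\<Sum>k\<le>K. l k b)) / real (card B)) \<le> ln (\<Prod>k\<le>K. Z k)"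
      using cB by (intro ln_mono) auto
    also have "ln (\<Prod>k\<le>K. Z k) = (\<Sum>k\<le>K. ln (Z k))"
      using Z_pos by (intro ln_prod) force+
    also have "\<dots> \<le> (\<Sum>k\<le>K. - g * (\<Sum>b\<in>B. p k b * l k b) + g\<^sup>2 / 2 * (\<Sum>b\<in>B. p k b * (l k b)\<^sup>2))"
      using lnZ by (intro sum_mono) auto
    also have "\<dots> = - g * W + g\<^sup>2 / 2 * (\<Sum>k\<le>K. \<Sum>b\<in>B. p k b * (l k b)\<^sup>2)"
      by (simp add: W_def sum.distrib sum_distrib_left)
    also have "ln (exp (- g * (\<Sum>k\<le>K. l k b)) / real (card B)) = - g * (\<Sum>k\<le>K. l k b) - ln (real (card B))"
      using cB by (simp add: ln_div)
    finally have "g * (W - (\<Sum>k\<le>K. l k b)) \<le> g * R"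
      using g by (simp add: R_def algebra_simps power2_eq_square)
    then show ?thesis using g by simp
  qed
  have "(\<Sum>b\<in>B. u b * (W - (\<Sum>k\<le>K. l k b))) \<le> (\<Sum>b\<in>B. u b * R)"
    using each u by (intro sum_mono mult_left_mono) auto
  moreover have "(\<Sum>b\<in>B. u b * R) = R"
    using u by (simp add: sum_distrib_right[symmetric])
  moreover have "(\<Sum>b\<in>B. u b * (W - (\<Sum>k\<le>K. l k b))) = W - (\<Sum>k\<le>K. \<Sum>b\<in>B. u b * l k b)"
  proof -
    have "(\<Sum>b\<in>B. u b * (W - (\<Sum>k\<le>K. l k b))) = (\<Sum>b\<in>B. u b) * W - (\<Sum>b\<in>B. \<Sum>k\<le>K. u b * l k b)"
      by (simp add: right_diff_distrib sum_subtractf sum_distrib_right sum_distrib_left)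
    then show ?thesis
      using u by (simp add: sum.swap[of _ B])
  qed
  ultimately show ?thesis
    by (simp add: R_def W_def sum_subtractf)
qed

text \<open>A potential argument: each visit to \<open>y\<close> raises
  \<open>3 * sqrt (N y)\<close> by at least the term it contributes, and Cauchy-Schwarz distributes
  at most \<open>K\<close> visits over \<open>Z\<close>. Counts stop at \<open>k - 1\<close>, hence
  the maximum with 1 for a first visit.\<close>

lemma sum_inverse_sqrt_visits:
  fixes z :: "nat \<Rightarrow> 'z"
  assumes Z: "finite Z" "\<And>k. k \<in> {1..K} \<Longrightarrow> z k \<in> Z"
  shows "(\<Sum>k=1..K. 1 / sqrt (real (max (card {t\<in>{1..k - 1}. z t = z k}) 1))) \<le> 3 * sqrt (real (card Z) * real K)"
proof -
  define N where "N k y = card {t\<in>{1..k}. z t = y}" for k y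
  have N_Suc: "N (Suc k) y = N k y + of_bool (z (Suc k) = y)" for k y
  proof -
    have "{t\<in>{1..Suc k}. z t = y} = {t\<in>{1..k}. z t = y} \<union> (if z (Suc k) = y then {Suc k} else {})"
      by (auto simp: le_Suc_eq)
    then show ?thesis
      unfolding N_def by (simp add: card_insert_if)
  qed
  have growth: "1 / sqrt (real (max n 1)) \<le> 3 * (sqrt (real (Suc n)) - sqrt (real n))" for n
  proof (cases "n = 0")
    case False
    then have n: "real n \<ge> 1" by simp
    \<comment> \<open>Since \<open>n + 1 \<le> 4 * n\<close>, the two roots together are at most
      \<open>3 * sqrt n\<close>; hence the constant 3.\<close>
    have "sqrt (real (Suc n)) \<le> sqrt (4 * real n)"
      using n by (subst real_sqrt_le_iff) simp
    then have le: "sqrt (real (Suc n)) + sqrt (real n) \<le> 3 * sqrt (real n)"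
      by (simp add: real_sqrt_mult)
    have "(sqrt (real (Suc n)) - sqrt (real n)) * (sqrt (real (Suc n)) + sqrt (real n)) = 1"
      by (simp add: algebra_simps)
    then have "1 \<le> (sqrt (real (Suc n)) - sqrt (real n)) * (3 * sqrt (real n))"
      using mult_left_mono[OF le, of "sqrt (real (Suc n)) - sqrt (real n)"] by simp
    then show ?thesis
      using n by (simp add: max_def field_simps)
  qed simp
  have main: "(\<Sum>k=1..m. 1 / sqrt (real (max (N (k - 1) (z k)) 1))) \<le> (\<Sum>y\<in>Z. 3 * sqrt (real (N m y)))"
    if "m \<le> K" for m
    using that
  proof (induction m)
    case 0
    then show ?case by (simp add: sum_nonneg)
  next
    case (Suc m)
    have "(\<Sum>y\<in>Z. 3 * sqrt (real (N (Suc m) y))) =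
          (\<Sum>y\<in>Z. 3 * sqrt (real (N m y)) + of_bool (y = z (Suc m)) * (3 * (sqrt (real (Suc (N m y))) - sqrt (real (N m y)))))"
      by (rule sum.cong) (auto simp: N_Suc)
    also have "\<dots> = (\<Sum>y\<in>Z. 3 * sqrt (real (N m y))) + 3 * (sqrt (real (Suc (N m (z (Suc m))))) - sqrt (real (N m (z (Suc m)))))"
      using Z(1) Z(2)[of "Suc m"] Suc(2) by (simp add: sum.distrib of_bool_def if_distrib[of "\<lambda>c. c * _"] cong: if_cong)
    finally show ?case
      using Suc growth[of "N m (z (Suc m))"] by simp
  qed
  have "(\<Sum>y\<in>Z. sqrt (real (N K y))) \<le> sqrt (real (card Z) * real K)"
  proof (rule real_le_rsqrt)
    have "(\<Sum>y\<in>Z. 1 * sqrt (real (N K y)))\<^sup>2 \<le> (\<Sum>y\<in>Z. 1\<^sup>2) * (\<Sum>y\<in>Z. (sqrt (real (N K y)))\<^sup>2)"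
      by (rule Cauchy_Schwarz_ineq_sum)
    also have "(\<Sum>y\<in>Z. (sqrt (real (N K y)))\<^sup>2) = real (\<Sum>y\<in>Z. N K y)"
      by simp
    also have "(\<Sum>y\<in>Z. N K y) = card (\<Union>y\<in>Z. {t\<in>{1..K}. z t = y})"
      unfolding N_def using Z(1) by (intro card_UN_disjoint[symmetric]) auto
    also have "\<dots> \<le> card {1..K}"
      by (rule card_mono) auto
    finally show "(\<Sum>y\<in>Z. sqrt (real (N K y)))\<^sup>2 \<le> real (card Z) * real K"
      by (simp add: mult_left_mono)
  qed
  then show ?thesis
    using main[of K] by (simp add: N_def sum_distrib_left[symmetric])
qed

section \<open>Values, occupancies and best responses\<close>

text \<open>The occupancy obeys the same recursion as the empirical reaching probability, so facts
  about \<open>reach\<close> with an arbitrary kernel serve both.\<close>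

abbreviation occ ::
  "('s, 'a, 'b) game \<Rightarrow> ('s, 'a) policy \<Rightarrow> nat \<Rightarrow> 's \<Rightarrow> real"
where
  "occ G \<mu> \<equiv> reach G \<mu> (\<lambda>h s a s'. pmf (trans G h s a) s')"

locale game =
  fixes G :: "('s, 'a, 'b) game"
  assumes wf: "wf_game G"
begin

abbreviation "S \<equiv> states G"
abbreviation "A \<equiv> acts1 G"
abbreviation "B \<equiv> acts2 G"
abbreviation "H \<equiv> horizon G"
abbreviation "P \<equiv> trans G"
abbreviation "r \<equiv> mean_reward G"

lemma finite_sets [simp, intro]: "finite S" "finite A" "finite B"
  and nonempty_sets: "S \<noteq> {}" "A \<noteq> {}" "B \<noteq> {}"
  and H_ge_1: "1 \<le> H" and init_in: "init G \<in> S"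
  using wf unfolding wf_game_def by auto

lemma P_subset: "h \<in> {1..H} \<Longrightarrow> s \<in> S \<Longrightarrow> a \<in> A \<Longrightarrow> set_pmf (P h s a) \<subseteq> S"
  and r_range: "h \<in> {1..H} \<Longrightarrow> s \<in> S \<Longrightarrow> a \<in> A \<Longrightarrow> b \<in> B \<Longrightarrow> r h s a b \<in> {0..1}"
  using wf unfolding wf_game_def by blast+

lemma P_sum: "h \<in> {1..H} \<Longrightarrow> s \<in> S \<Longrightarrow> a \<in> A \<Longrightarrow> (\<Sum>s'\<in>S. pmf (P h s a) s') = 1"
  using P_subset by (intro sum_pmf_eq_1) auto

lemma policy_sum:
  "is_policy G C \<pi> \<Longrightarrow> finite C \<Longrightarrow> h \<in> {1..H} \<Longrightarrow> s \<in> S \<Longrightarrow> (\<Sum>c\<in>C. pmf (\<pi> h s) c) = 1"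
  unfolding is_policy_def by (intro sum_pmf_eq_1) auto

text \<open>Finite support turns the expectations in \<open>V\<close> into finite sums and supplies
  the integrability needed in \<open>V_step\<close>.\<close>

lemma finite_trajectory:
  assumes "is_policy G A \<mu>" "is_policy G B \<nu>"
  shows "s \<in> S \<Longrightarrow> 1 \<le> h \<Longrightarrow> h + n \<le> Suc H \<Longrightarrow> finite (set_pmf (trajectory G \<mu> \<nu> n h s))"
proof (induction n arbitrary: h s)
  case (Suc n)
  then have h: "h \<in> {1..H}" by auto
  have sub: "set_pmf (\<mu> h s) \<subseteq> A" "set_pmf (\<nu> h s) \<subseteq> B"
    using assms h Suc.prems unfolding is_policy_def by auto
  have "finite (set_pmf (P h s a))" "\<And>s'. s' \<in> set_pmf (P h s a) \<Longrightarrow> s' \<in> S"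
    if "a \<in> set_pmf (\<mu> h s)" for a
    using P_subset[OF h Suc.prems(1), of a] that sub finite_subset[OF _ finite_sets(1)] by blast+
  moreover have "finite (set_pmf (\<mu> h s))" "finite (set_pmf (\<nu> h s))"
    using sub finite_subset by blast+
  ultimately show ?case
    using Suc by auto
qed simp

lemma V_end: "V G \<mu> \<nu> (Suc H) s = 0"
  by (simp add: V_def)

text \<open>Conditioning on the first triple and its successor state yields the Bellman equation;
  dropping the head of the list shifts the reward index by one.\<close>

lemma V_step:
  assumes \<mu>: "is_policy G A \<mu>" and \<nu>: "is_policy G B \<nu>" and h: "h \<in> {1..H}" and s: "s \<in> S"
  shows "V G \<mu> \<nu> h s = (\<Sum>a\<in>A. \<Sum>b\<in>B. pmf (\<mu> h s) a * pmf (\<nu> h s) b *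
           (r h s a b + (\<Sum>s'\<in>S. pmf (P h s a) s' * V G \<mu> \<nu> (Suc h) s')))"
proof -
  define n where "n = H - h"
  have n: "Suc H - h = Suc n" "Suc H - Suc h = n"
    using h by (auto simp: n_def)
  define tr where "tr s' = trajectory G \<mu> \<nu> n (Suc h) s'" for s'
  define rest where "rest xs = (\<Sum>h'=Suc h..H. case xs ! (h' - Suc h) of (s', a', b') \<Rightarrow> r h' s' a' b')"
    for xs :: "('s \<times> 'a \<times> 'b) list"
  define tot where "tot xs = (\<Sum>h'=h..H. case xs ! (h' - h) of (s', a', b') \<Rightarrow> r h' s' a' b')"
    for xs :: "('s \<times> 'a \<times> 'b) list"
  have tot: "tot ((s, a, b) # xs) = r h s a b + rest xs" for a b xs
  proof -
    have "tot ((s, a, b) # xs) = r h s a b +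
        (\<Sum>h'=Suc h..H. case ((s, a, b) # xs) ! (h' - h) of (s', a', b') \<Rightarrow> r h' s' a' b')"
      unfolding tot_def using h by (subst sum.atLeast_Suc_atMost) auto
    also have "(\<Sum>h'=Suc h..H. case ((s, a, b) # xs) ! (h' - h) of (s', a', b') \<Rightarrow> r h' s' a' b') = rest xs"
      unfolding rest_def by (rule sum.cong) (auto simp: nth_Cons')
    finally show ?thesis .
  qed
  have fin: "finite (set_pmf (tr s'))" if "s' \<in> S" for s'
    unfolding tr_def using h that by (intro finite_trajectory \<mu> \<nu>) (auto simp: n_def)
  have sub: "set_pmf (\<mu> h s) \<subseteq> A" "set_pmf (\<nu> h s) \<subseteq> B"
    using \<mu> \<nu> h s unfolding is_policy_def by auto
  have Psub: "set_pmf (P h s a) \<subseteq> S" if "a \<in> A" for a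
    using P_subset[OF h s that] .
  have finP: "finite (set_pmf (P h s a \<bind> (\<lambda>s'. map_pmf ((#) (s, a, b)) (tr s'))))" if "a \<in> A" for a b
    using Psub[OF that] fin finite_subset[OF _ finite_sets(1)] by auto
  have finB: "finite (set_pmf (\<nu> h s \<bind> (\<lambda>b. P h s a \<bind> (\<lambda>s'. map_pmf ((#) (s, a, b)) (tr s')))))"
    if "a \<in> A" for a
    using finP[OF that] finite_subset[OF sub(2)] by (simp add: set_bind_pmf)
  have "V G \<mu> \<nu> h s = measure_pmf.expectation (\<mu> h s \<bind> (\<lambda>a. \<nu> h s \<bind> (\<lambda>b. P h s a \<bind>
           (\<lambda>s'. map_pmf ((#) (s, a, b)) (tr s'))))) tot"
    by (simp add: V_def n tr_def tot_def[abs_def])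
  also have "\<dots> = (\<Sum>a\<in>A. pmf (\<mu> h s) a * (\<Sum>b\<in>B. pmf (\<nu> h s) b * (\<Sum>s'\<in>S. pmf (P h s a) s' *
            measure_pmf.expectation (map_pmf ((#) (s, a, b)) (tr s')) tot)))"
    \<comment> \<open>The three draws are expanded from the outside in; every expansion needs finite
      support of what remains.\<close>
    apply (subst pmf_expectation_bind[OF finite_sets(2) finB sub(1)])
     apply assumption
    apply (rule sum.cong[OF refl])
    apply (subst pmf_expectation_bind[OF finite_sets(3) finP sub(2)])
     apply assumption
    apply (simp only: real_scaleR_def)
    apply (intro arg_cong2[where f = "(*)"] refl sum.cong)
    apply (subst pmf_expectation_bind[OF finite_sets(1) _ Psub])
    using fin by auto
  also have "\<dots> = (\<Sum>a\<in>A. pmf (\<mu> h s) a * (\<Sum>b\<in>B. pmf (\<nu> h s) b *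
      (r h s a b + (\<Sum>s'\<in>S. pmf (P h s a) s' * V G \<mu> \<nu> (Suc h) s'))))"
  proof (intro sum.cong refl arg_cong2[where f = "(*)"])
    fix a b assume a: "a \<in> A" and b: "b \<in> B"
    have "measure_pmf.expectation (map_pmf ((#) (s, a, b)) (tr s')) tot = r h s a b + V G \<mu> \<nu> (Suc h) s'"
      if "s' \<in> S" for s'
    proof -
      have "measure_pmf.expectation (map_pmf ((#) (s, a, b)) (tr s')) tot =
          measure_pmf.expectation (tr s') (\<lambda>xs. r h s a b + rest xs)"
        by (simp add: tot)
      also have "\<dots> = r h s a b + measure_pmf.expectation (tr s') rest"
        using fin[OF that] by (subst Bochner_Integration.integral_add) (auto intro: integrable_measure_pmf_finite)
      finally show ?thesis
        by (simp add: V_def n_def tr_def rest_def[abs_def])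
    qed
    then have "(\<Sum>s'\<in>S. pmf (P h s a) s' * measure_pmf.expectation (map_pmf ((#) (s, a, b)) (tr s')) tot) =
       (\<Sum>s'\<in>S. pmf (P h s a) s' * (r h s a b + V G \<mu> \<nu> (Suc h) s'))"
      by (intro sum.cong) auto
    also have "\<dots> = (\<Sum>s'\<in>S. pmf (P h s a) s') * r h s a b + (\<Sum>s'\<in>S. pmf (P h s a) s' * V G \<mu> \<nu> (Suc h) s')"
      by (simp add: distrib_left sum.distrib sum_distrib_right)
    finally show "(\<Sum>s'\<in>S. pmf (P h s a) s' * measure_pmf.expectation (map_pmf ((#) (s, a, b)) (tr s')) tot) =
        r h s a b + (\<Sum>s'\<in>S. pmf (P h s a) s' * V G \<mu> \<nu> (Suc h) s')"
      using P_sum[OF h s a] by simp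
  qed
  finally show ?thesis
    by (simp add: sum_distrib_left mult.assoc)
qed

section \<open>Occupancies and the decomposition of the value\<close>

lemma reach_nonneg:
  assumes "\<And>h s a s'. h \<in> {1..<H} \<Longrightarrow> s \<in> S \<Longrightarrow> a \<in> A \<Longrightarrow> s' \<in> S \<Longrightarrow> 0 \<le> p h s a s'"
  shows "h \<le> H \<Longrightarrow> s \<in> S \<Longrightarrow> 0 \<le> reach G \<mu> p h s"
  using assms
  by (induction G \<mu> p h s rule: reach.induct) (auto intro!: sum_nonneg mult_nonneg_nonneg)

text \<open>Only a substochastic kernel is assumed, because the empirical kernel loses all its mass
  at unvisited pairs.\<close>

lemma reach_sum_le_1:
  assumes p: "\<And>h s a s'. h \<in> {1..<H} \<Longrightarrow> s \<in> S \<Longrightarrow> a \<in> A \<Longrightarrow> s' \<in> S \<Longrightarrow> 0 \<le> p h s a s'"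
    and p1: "\<And>h s a. h \<in> {1..<H} \<Longrightarrow> s \<in> S \<Longrightarrow> a \<in> A \<Longrightarrow> (\<Sum>s'\<in>S. p h s a s') \<le> 1"
    and \<mu>: "is_policy G A \<mu>"
  shows "h \<le> H \<Longrightarrow> (\<Sum>s\<in>S. reach G \<mu> p h s) \<le> 1"
proof (induction h)
  case (Suc h)
  show ?case
  proof (cases h)
    case 0
    then show ?thesis using init_in by (simp add: of_bool_def cong: if_cong)
  next
    case (Suc n)
    then have h: "h \<in> {1..<H}" "h \<in> {1..H}" using \<open>Suc h \<le> H\<close> by auto
    have "(\<Sum>s\<in>S. reach G \<mu> p (Suc h) s) =
        (\<Sum>s'\<in>S. \<Sum>a\<in>A. reach G \<mu> p h s' * pmf (\<mu> h s') a * (\<Sum>s\<in>S. p h s' a s))"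
      unfolding Suc reach.simps sum_distrib_left
      by (subst sum.swap, rule sum.cong[OF refl], subst sum.swap, rule refl)
    also have "\<dots> \<le> (\<Sum>s'\<in>S. \<Sum>a\<in>A. reach G \<mu> p h s' * pmf (\<mu> h s') a * 1)"
      using h p1[of h] reach_nonneg[where p = p and h = h, OF p] by (intro sum_mono mult_left_mono mult_nonneg_nonneg) auto
    also have "\<dots> = (\<Sum>s'\<in>S. reach G \<mu> p h s')"
      using policy_sum[OF \<mu> finite_sets(2) h(2)] by (simp add: sum_distrib_left[symmetric])
    finally show ?thesis
      using Suc.IH \<open>Suc h \<le> H\<close> by simp
  qed
qed simp

lemma occ_nonneg: "h \<le> H \<Longrightarrow> s \<in> S \<Longrightarrow> 0 \<le> occ G \<mu> h s"
  by (rule reach_nonneg) auto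

lemma occ_sum_le_1: "is_policy G A \<mu> \<Longrightarrow> h \<le> H \<Longrightarrow> (\<Sum>s\<in>S. occ G \<mu> h s) \<le> 1"
  by (rule reach_sum_le_1) (auto simp: P_sum)

text \<open>The Bellman equation is unrolled from step 1: after \<open>m\<close> steps the value is
  the expected reward collected so far plus the occupancy average of the remaining value, which is 0
  after step \<open>H\<close>.\<close>

lemma V_eq:
  assumes \<mu>: "is_policy G A \<mu>" and \<nu>: "is_policy G B \<nu>"
  shows "V G \<mu> \<nu> 1 (init G) =
    (\<Sum>h=1..H. \<Sum>s\<in>S. occ G \<mu> h s * (\<Sum>b\<in>B. pmf (\<nu> h s) b * (\<Sum>a\<in>A. r h s a b * pmf (\<mu> h s) a)))"
proof -
  define R where "R h s = (\<Sum>b\<in>B. pmf (\<nu> h s) b * (\<Sum>a\<in>A. r h s a b * pmf (\<mu> h s) a))" for h s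
  have "V G \<mu> \<nu> 1 (init G) = (\<Sum>h=1..m. \<Sum>s\<in>S. occ G \<mu> h s * R h s) +
      (\<Sum>s\<in>S. occ G \<mu> (Suc m) s * V G \<mu> \<nu> (Suc m) s)" if "m \<le> H" for m
    using that
  proof (induction m)
    case 0
    then show ?case using init_in by (simp add: of_bool_def if_distrib[of "\<lambda>c. c * _"] cong: if_cong)
  next
    case (Suc m)
    let ?h = "Suc m"
    have h: "?h \<in> {1..H}" using Suc by auto
    have step: "V G \<mu> \<nu> ?h s = R ?h s + (\<Sum>a\<in>A. pmf (\<mu> ?h s) a * (\<Sum>s'\<in>S. pmf (P ?h s a) s' * V G \<mu> \<nu> (Suc ?h) s'))"
      if "s \<in> S" for s
    proof -
      have "V G \<mu> \<nu> ?h s = (\<Sum>a\<in>A. \<Sum>b\<in>B. pmf (\<mu> ?h s) a * pmf (\<nu> ?h s) b * r ?h s a b) +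
          (\<Sum>a\<in>A. \<Sum>b\<in>B. pmf (\<nu> ?h s) b * (pmf (\<mu> ?h s) a * (\<Sum>s'\<in>S. pmf (P ?h s a) s' * V G \<mu> \<nu> (Suc ?h) s')))"
        unfolding V_step[OF \<mu> \<nu> h that] sum.distrib[symmetric]
        by (intro sum.cong refl) (simp add: algebra_simps)
      \<comment> \<open>The kernel does not depend on \<open>b\<close>, so Player 2's probabilities
        sum out of the successor term.\<close>
      also have "(\<Sum>a\<in>A. \<Sum>b\<in>B. pmf (\<nu> ?h s) b * (pmf (\<mu> ?h s) a * (\<Sum>s'\<in>S. pmf (P ?h s a) s' * V G \<mu> \<nu> (Suc ?h) s')))
          = (\<Sum>a\<in>A. pmf (\<mu> ?h s) a * (\<Sum>s'\<in>S. pmf (P ?h s a) s' * V G \<mu> \<nu> (Suc ?h) s'))"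
        using policy_sum[OF \<nu> finite_sets(3) h that] by (simp add: sum_distrib_right[symmetric])
      also have "(\<Sum>a\<in>A. \<Sum>b\<in>B. pmf (\<mu> ?h s) a * pmf (\<nu> ?h s) b * r ?h s a b) = R ?h s"
        unfolding R_def sum_distrib_left by (subst sum.swap) (simp add: mult_ac)
      finally show ?thesis .
    qed
    have "(\<Sum>s\<in>S. occ G \<mu> ?h s * V G \<mu> \<nu> ?h s) = (\<Sum>s\<in>S. occ G \<mu> ?h s * R ?h s) +
       (\<Sum>s\<in>S. \<Sum>a\<in>A. \<Sum>s'\<in>S. occ G \<mu> ?h s * pmf (\<mu> ?h s) a * pmf (P ?h s a) s' * V G \<mu> \<nu> (Suc ?h) s')"
      unfolding sum.distrib[symmetric]
      by (intro sum.cong refl) (simp add: step distrib_left sum_distrib_left mult_ac)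
    also have "(\<Sum>s\<in>S. \<Sum>a\<in>A. \<Sum>s'\<in>S. occ G \<mu> ?h s * pmf (\<mu> ?h s) a * pmf (P ?h s a) s' * V G \<mu> \<nu> (Suc ?h) s') =
        (\<Sum>s'\<in>S. \<Sum>s\<in>S. \<Sum>a\<in>A. occ G \<mu> ?h s * pmf (\<mu> ?h s) a * pmf (P ?h s a) s' * V G \<mu> \<nu> (Suc ?h) s')"
      by (subst (2) sum.swap, subst sum.swap, rule refl)
    also have "\<dots> = (\<Sum>s'\<in>S. occ G \<mu> (Suc ?h) s' * V G \<mu> \<nu> (Suc ?h) s')"
      by (simp add: sum_distrib_right)
    finally show ?case
      using Suc by simp
  qed
  from this[of H] show ?thesis
    by (simp add: V_end R_def)
qed

text \<open>The coefficient of \<open>pmf (\<nu> h s) b\<close> when one fixed \<open>\<nu>\<close>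
  is evaluated against all episodes.\<close>

definition loss :: "nat \<Rightarrow> (nat \<Rightarrow> ('s, 'a) policy) \<Rightarrow> nat \<Rightarrow> 's \<Rightarrow> 'b \<Rightarrow> real" where
  "loss K \<mu> h s b = (\<Sum>k=1..K. occ G (\<mu> k) h s * (\<Sum>a\<in>A. r h s a b * pmf (\<mu> k h s) a))"

lemma sum_V_eq_loss:
  assumes "\<And>k. k \<in> {1..K} \<Longrightarrow> is_policy G A (\<mu> k)" "is_policy G B \<nu>"
  shows "(\<Sum>k=1..K. V G (\<mu> k) \<nu> 1 (init G)) = (\<Sum>h=1..H. \<Sum>s\<in>S. \<Sum>b\<in>B. pmf (\<nu> h s) b * loss K \<mu> h s b)"
proof -
  have "(\<Sum>k=1..K. V G (\<mu> k) \<nu> 1 (init G)) = (\<Sum>k=1..K. \<Sum>h=1..H. \<Sum>s\<in>S. \<Sum>b\<in>B.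
      pmf (\<nu> h s) b * (occ G (\<mu> k) h s * (\<Sum>a\<in>A. r h s a b * pmf (\<mu> k h s) a)))"
    using assms by (intro sum.cong refl, subst V_eq) (simp_all add: sum_distrib_left mult_ac)
  also have "\<dots> = (\<Sum>h=1..H. \<Sum>s\<in>S. \<Sum>b\<in>B. \<Sum>k=1..K.
      pmf (\<nu> h s) b * (occ G (\<mu> k) h s * (\<Sum>a\<in>A. r h s a b * pmf (\<mu> k h s) a)))"
    by (subst sum.swap, rule sum.cong[OF refl], subst sum.swap, rule sum.cong[OF refl], rule sum.swap)
  finally show ?thesis
    by (simp add: loss_def sum_distrib_left)
qed

text \<open>Because Player 1 alone controls the transitions, the best policy in hindsight is greedy,
  separately at every step and state. This makes the regret a measurable function.\<close>

lemma best_response: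
  fixes \<mu> :: "nat \<Rightarrow> ('s, 'a) policy"
  assumes \<mu>: "\<And>k. k \<in> {1..K} \<Longrightarrow> is_policy G A (\<mu> k)"
  defines "f \<equiv> \<lambda>\<nu>. \<Sum>k=1..K. V G (\<mu> k) \<nu> 1 (init G)"
  shows "is_policy G B (arg_min f (is_policy G B))"
    and "f (arg_min f (is_policy G B)) = (\<Sum>h=1..H. \<Sum>s\<in>S. Min (loss K \<mu> h s ` B))"
proof -
  define M where "M = (\<Sum>h=1..H. \<Sum>s\<in>S. Min (loss K \<mu> h s ` B))"
  have "Min (loss K \<mu> h s ` B) \<in> loss K \<mu> h s ` B" for h s
    using nonempty_sets by (intro Min_in) auto
  then have "\<exists>b. b \<in> B \<and> loss K \<mu> h s b = Min (loss K \<mu> h s ` B)" for h s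
    by (smt (verit) imageE)
  then obtain g where g: "g h s \<in> B" "loss K \<mu> h s (g h s) = Min (loss K \<mu> h s ` B)" for h s
    by metis
  define \<nu>g where "\<nu>g h s = return_pmf (g h s)" for h s
  have \<nu>g: "is_policy G B \<nu>g"
    using g by (simp add: is_policy_def \<nu>g_def)
  have greedy: "f \<nu>g = M"
  proof -
    have "(\<Sum>b\<in>B. pmf (\<nu>g h s) b * loss K \<mu> h s b) = (\<Sum>b\<in>B. if b = g h s then loss K \<mu> h s b else 0)" for h s
      by (intro sum.cong) (auto simp: \<nu>g_def)
    then show ?thesis
      unfolding f_def M_def using \<mu> \<nu>g g by (subst sum_V_eq_loss) auto
  qed
  have lower: "M \<le> f \<nu>" if "is_policy G B \<nu>" for \<nu>
  proof -
    have "M \<le> (\<Sum>h=1..H. \<Sum>s\<in>S. \<Sum>b\<in>B. pmf (\<nu> h s) b * loss K \<mu> h s b)"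
      unfolding M_def
    proof (intro sum_mono)
      fix h s assume h: "h \<in> {1..H}" and s: "s \<in> S"
      have "Min (loss K \<mu> h s ` B) = (\<Sum>b\<in>B. pmf (\<nu> h s) b * Min (loss K \<mu> h s ` B))"
        using policy_sum[OF that finite_sets(3) h s] by (simp add: sum_distrib_right[symmetric])
      also have "\<dots> \<le> (\<Sum>b\<in>B. pmf (\<nu> h s) b * loss K \<mu> h s b)"
        by (intro sum_mono mult_left_mono) auto
      finally show "Min (loss K \<mu> h s ` B) \<le> (\<Sum>b\<in>B. pmf (\<nu> h s) b * loss K \<mu> h s b)" .
    qed
    also have "\<dots> = f \<nu>"
      unfolding f_def by (rule sum_V_eq_loss[symmetric]) (use \<mu> that in auto)
    finally show ?thesis .
  qed
  \<comment> \<open>\<open>arg_min\<close> is a choice operator; it yields a minimiser because one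
    exists, namely the greedy policy.\<close>
  have "is_arg_min f (is_policy G B) \<nu>g"
    using \<nu>g greedy lower by (simp add: is_arg_min_linorder)
  then have am: "is_arg_min f (is_policy G B) (arg_min f (is_policy G B))"
    unfolding arg_min_def by (rule someI[where P = "is_arg_min f (is_policy G B)"])
  then show "is_policy G B (arg_min f (is_policy G B))"
    by (simp add: is_arg_min_linorder)
  show "f (arg_min f (is_policy G B)) = (\<Sum>h=1..H. \<Sum>s\<in>S. Min (loss K \<mu> h s ` B))"
    using am \<nu>g greedy lower unfolding is_arg_min_linorder M_def[symmetric] by (metis order_antisym)
qed

end

section \<open>Regret on the good event\<close>

text \<open>One realisation of the interaction; every inequality in this section is deterministic.
  At least two actions of Player 2 make the step size positive and keep the logarithmic factor away
  from 0.\<close>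

locale game_run = game G for G :: "('s, 'a, 'b) game" +
  fixes K :: nat and \<delta> :: real and x :: "('s, 'a, 'b) play"
  assumes K: "1 \<le> K" and \<delta>: "0 < \<delta>" "\<delta> < 1" and card_B: "2 \<le> card (acts2 G)"
    and pol1: "\<And>k. k \<in> {1..K} \<Longrightarrow> is_policy G (acts1 G) (pol1 x k)"
    and pol2: "\<And>k. k \<in> {1..K} \<Longrightarrow> is_policy G (acts2 G) (pol2 x k)"
    and state: "\<And>k h. k \<in> {1..K} \<Longrightarrow> h \<in> {1..Suc (horizon G)} \<Longrightarrow> state x k h \<in> states G"
    and act1: "\<And>k h. k \<in> {1..K} \<Longrightarrow> h \<in> {1..horizon G} \<Longrightarrow> act1 x k h \<in> acts1 G"
    and act2: "\<And>k h. k \<in> {1..K} \<Longrightarrow> h \<in> {1..horizon G} \<Longrightarrow> act2 x k h \<in> acts2 G"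
    and rew: "\<And>k h. k \<in> {1..K} \<Longrightarrow> h \<in> {1..horizon G} \<Longrightarrow> rew x k h \<in> {0..1}"
    and alg: "player2_algorithm G K \<delta> (sqrt (real (card (states G)) * ln (real (card (acts2 G))) / real K)) x"
begin

abbreviation "\<iota> \<equiv> log_factor G K \<delta>"
abbreviation "\<mu> \<equiv> pol1 x"
abbreviation "\<nu> \<equiv> pol2 x"
abbreviation "d k \<equiv> occ G (\<mu> k)"
abbreviation "d_hat k \<equiv> reach G (\<mu> k) (P_hat G x k)"
abbreviation "q k h s b \<equiv> \<Sum>a\<in>A. r h s a b * pmf (\<mu> k h s) a"
abbreviation "q_tilde k h s b \<equiv> \<Sum>a\<in>A. r_tilde G K \<delta> x k h s a b * pmf (\<mu> k h s) a"
abbreviation "N2 \<equiv> visits2 x"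
abbreviation "N3 \<equiv> visits3 x"
abbreviation "nS \<equiv> real (card S)"
abbreviation "nA \<equiv> real (card A)"
abbreviation "nB \<equiv> real (card B)"

lemma sizes_ge_1: "1 \<le> nS" "1 \<le> nA" "2 \<le> nB" "1 \<le> real H" "1 \<le> real K"
  using nonempty_sets card_B H_ge_1 K by (auto simp: Suc_le_eq card_gt_0_iff)

text \<open>These bounds let \<open>\<iota>\<close> absorb \<open>ln nB\<close>, absolute constants
  and the roots \<open>sqrt \<iota>\<close>.\<close>

lemma ln_B_le: "ln nB \<le> \<iota>" and ln_2_le: "ln 2 \<le> \<iota>" and \<iota>_ge: "1 / 2 \<le> \<iota>"
proof -
  have "1 \<le> nS * nA" "1 \<le> real H * real K"
    using mult_mono[of 1 nS 1 nA] mult_mono[of 1 "real H" 1 "real K"] sizes_ge_1 by auto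
  then have "1 \<le> (nS * nA) * (real H * real K)"
    using mult_mono[of 1 "nS * nA" 1 "real H * real K"] by auto
  also have "\<dots> \<le> (nS * nA) * (real H * real K) / \<delta>"
  proof -
    have "c \<le> c / \<delta>" if "0 \<le> c" for c
      using \<delta> that by (simp add: pos_le_divide_eq mult_left_le)
    then show ?thesis by simp
  qed
  finally have "nB * 1 \<le> nB * ((nS * nA) * (real H * real K) / \<delta>)"
    by (intro mult_left_mono) auto
  then have "nB \<le> nS * nA * nB * real H * real K / \<delta>"
    by (simp add: mult_ac)
  then show *: "ln nB \<le> \<iota>"
    unfolding log_factor_def using sizes_ge_1 by (intro ln_mono) auto
  have "ln 2 \<le> ln nB"
    using sizes_ge_1 by (intro ln_mono) auto
  with * show "ln 2 \<le> \<iota>" by simp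
  then show "1 / 2 \<le> \<iota>"
    using ln_2_less_1 ln2_ge_two_thirds by linarith
qed

lemma r_hat_range:
  assumes "k \<le> K" "h \<in> {1..H}"
  shows "r_hat x k h s a b \<in> {0..1}"
proof -
  let ?v = "\<lambda>\<tau>. of_bool (state x \<tau> h = s \<and> act1 x \<tau> h = a \<and> act2 x \<tau> h = b) :: real"
  have 0: "0 \<le> rew x \<tau> h" "rew x \<tau> h \<le> 1" if "\<tau> \<in> {1..k}" for \<tau>
    using rew[of \<tau> h] that assms by auto
  have "(\<Sum>\<tau>=1..k. ?v \<tau> * rew x \<tau> h) \<le> (\<Sum>\<tau>=1..k. ?v \<tau>)"
    using 0 by (intro sum_mono) (auto intro: mult_left_le)
  also have "\<dots> = real (N3 k h s a b)"
    by (simp add: visits3_def Int_def)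
  also have "\<dots> \<le> real (max (N3 k h s a b) 1)"
    by simp
  finally have "(\<Sum>\<tau>=1..k. ?v \<tau> * rew x \<tau> h) \<le> real (max (N3 k h s a b) 1)" .
  moreover have "0 \<le> (\<Sum>\<tau>=1..k. ?v \<tau> * rew x \<tau> h)"
    using 0 by (intro sum_nonneg mult_nonneg_nonneg) auto
  moreover have "0 < real (max (N3 k h s a b) 1)"
    by simp
  ultimately show ?thesis
    unfolding r_hat_def atLeastAtMost_iff pos_divide_le_eq[OF \<open>0 < real (max (N3 k h s a b) 1)\<close>]
    by simp
qed

lemma bonus_nonneg: "0 \<le> bonus G K \<delta> x k h s a b"
  using \<iota>_ge by (simp add: bonus_def)

lemma r_tilde_range:
  assumes "k \<le> K" "h \<in> {1..H}"
  shows "r_tilde G K \<delta> x k h s a b \<in> {0..1}"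
  using r_hat_range[OF assms, of s a b] bonus_nonneg[of k h s a b] unfolding r_tilde_def by auto

lemma policy_mean_range:
  assumes "is_policy G C \<pi>" "finite C" "h \<in> {1..H}" "s \<in> S" "\<And>c. c \<in> C \<Longrightarrow> f c \<in> {0..1}"
  shows "(\<Sum>c\<in>C. f c * pmf (\<pi> h s) c) \<in> {0..1}"
proof -
  have "(\<Sum>c\<in>C. f c * pmf (\<pi> h s) c) \<le> (\<Sum>c\<in>C. 1 * pmf (\<pi> h s) c)"
    using assms(5) by (intro sum_mono mult_right_mono) auto
  then show ?thesis
    using policy_sum[OF assms(1-4)] assms(5) by (auto intro!: sum_nonneg mult_nonneg_nonneg)
qed

lemma q_tilde_range:
  assumes "k \<in> {1..K}" "h \<in> {1..H}" "s \<in> S"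
  shows "q_tilde k h s b \<in> {0..1}"
  using assms r_tilde_range[of k h] by (intro policy_mean_range pol1) auto

text \<open>Every visit has exactly one successor, and it lies in \<open>S\<close>.\<close>

lemma sum_visits_next:
  assumes k: "k \<le> K" and h: "h \<in> {1..H}"
  shows "(\<Sum>s'\<in>S. \<Sum>\<tau>=1..k. of_bool (state x \<tau> h = s \<and> act1 x \<tau> h = a \<and> state x \<tau> (Suc h) = s')) = real (N2 k h s a)"
proof -
  have "(\<Sum>s'\<in>S. \<Sum>\<tau>=1..k. of_bool (state x \<tau> h = s \<and> act1 x \<tau> h = a \<and> state x \<tau> (Suc h) = s') :: real) =
    (\<Sum>\<tau>=1..k. \<Sum>s'\<in>S. if s' = state x \<tau> (Suc h) then of_bool (state x \<tau> h = s \<and> act1 x \<tau> h = a) else 0)"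
    by (subst sum.swap, intro sum.cong) auto
  also have "\<dots> = (\<Sum>\<tau>=1..k. of_bool (state x \<tau> h = s \<and> act1 x \<tau> h = a))"
  proof (intro sum.cong refl)
    fix \<tau> assume "\<tau> \<in> {1..k}"
    then have "state x \<tau> (Suc h) \<in> S"
      using state[of \<tau> "Suc h"] k h by auto
    then show "(\<Sum>s'\<in>S. if s' = state x \<tau> (Suc h) then of_bool (state x \<tau> h = s \<and> act1 x \<tau> h = a) else 0) =
      (of_bool (state x \<tau> h = s \<and> act1 x \<tau> h = a) :: real)"
      by (simp add: sum.delta)
  qed
  also have "\<dots> = real (N2 k h s a)"
    by (simp add: visits2_def Int_def)
  finally show ?thesis .
qed

lemma P_hat_nonneg: "0 \<le> P_hat G x k h s a s'"
  unfolding P_hat_def by (auto intro!: divide_nonneg_nonneg sum_nonneg)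

lemma P_hat_sum:
  assumes k: "k \<in> {1..K}" and h: "h \<in> {1..H}"
  shows "(\<Sum>s'\<in>S. P_hat G x k h s a s') = of_bool (0 < N2 k h s a)"
proof -
  have "(\<Sum>s'\<in>S. P_hat G x k h s a s') = real (N2 k h s a) / real (max (N2 k h s a) 1)"
  proof -
    have "(k = 0) = False" using k by simp
    then show ?thesis
      unfolding P_hat_def using k h
      by (simp only: if_False sum_divide_distrib[symmetric]) (subst sum_visits_next, auto)
  qed
  then show ?thesis
    by (auto simp: max_def)
qed

lemma d_hat_nonneg: "h \<le> H \<Longrightarrow> s \<in> S \<Longrightarrow> 0 \<le> d_hat k h s"
  by (rule reach_nonneg) (auto simp: P_hat_nonneg)

lemma d_hat_sum_le_1:
  assumes k: "k \<in> {1..K}" and h: "h \<le> H"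
  shows "(\<Sum>s\<in>S. d_hat k h s) \<le> 1"
proof (rule reach_sum_le_1[OF _ _ pol1[OF k] h])
  show "(\<Sum>s'\<in>S. P_hat G x k h s a s') \<le> 1" if "h \<in> {1..<H}" for h s a
    using P_hat_sum[OF k, of h s a] that by auto
qed (auto simp: P_hat_nonneg)

lemma d_hat_le_1: "k \<in> {1..K} \<Longrightarrow> h \<le> H \<Longrightarrow> s \<in> S \<Longrightarrow> d_hat k h s \<le> 1"
  using d_hat_sum_le_1[of k h] member_le_sum[of s S "d_hat k h"] d_hat_nonneg[of h _ k] by force

text \<open>At each step and state the update is exponential weights with loss
  \<open>d_hat * q_tilde\<close>. The squared loss is at most \<open>d_hat\<close>, whose sum over
  states is at most 1. The quadratic term is therefore free of \<open>nS\<close>, while the term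
  with \<open>ln nB\<close> is paid once per state; this is why \<open>nS\<close> appears in the
  step size.\<close>

lemma mirror_descent_bound:
  assumes \<nu>': "is_policy G B \<nu>'"
  shows "(\<Sum>h=1..H. \<Sum>s\<in>S. \<Sum>k=1..K. d_hat k h s *
      ((\<Sum>b\<in>B. pmf (\<nu> k h s) b * q_tilde k h s b) - (\<Sum>b\<in>B. pmf (\<nu>' h s) b * q_tilde k h s b)))
      \<le> 3 / 2 * real H * sqrt (nS * ln nB * real K)"
proof -
  define g where "g = sqrt (nS * ln nB / real K)"
  have pos: "0 < nS * ln nB" "0 < real K"
    using sizes_ge_1 by auto
  then have g: "0 < g" by (simp add: g_def)
  have gK: "g * real K = sqrt (nS * ln nB * real K)"
  proof -
    have "g\<^sup>2 = nS * ln nB / real K"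
      using pos by (simp add: g_def)
    then have "(g * real K)\<^sup>2 = nS * ln nB * real K"
      using pos by (simp add: power_mult_distrib) (simp add: power2_eq_square)
    then show ?thesis
      using g by (intro real_sqrt_unique[symmetric]) auto
  qed
  \<comment> \<open>The step size balances the two terms at each step: \<open>nS\<close> copies of
    \<open>ln nB / g\<close> against \<open>g / 2\<close> times a total mass of at most
    \<open>K\<close>, up to the factor 2.\<close>
  have lg: "nS * ln nB / g = g * real K"
  proof -
    have "g * g = nS * ln nB / real K"
      using pos by (simp add: g_def)
    then show ?thesis
      using g pos by (simp add: field_simps)
  qed
  have each: "(\<Sum>k=1..K. d_hat k h s *
      ((\<Sum>b\<in>B. pmf (\<nu> k h s) b * q_tilde k h s b) - (\<Sum>b\<in>B. pmf (\<nu>' h s) b * q_tilde k h s b)))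
      \<le> ln nB / g + g / 2 * (\<Sum>k=1..K. d_hat k h s)" if h: "h \<in> {1..H}" and s: "s \<in> S" for h s
  proof -
    define l where "l k b = d_hat k h s * q_tilde k h s b" for k b
    \<comment> \<open>Round 0 carries no loss, since the reward estimates vanish there. It aligns
      the indices: the policy of episode \<open>k\<close> is built from the losses up to
      \<open>k - 1\<close>.\<close>
    have l0: "l 0 b = 0" for b
      by (simp add: l_def r_tilde_def r_hat_def bonus_def)
    have alg': "\<nu> 0 h s = pmf_of_set B" "\<And>k b. k \<in> {1..K} \<Longrightarrow> b \<in> B \<Longrightarrow>
        pmf (\<nu> k h s) b = md_weight G K \<delta> g x k h s b / (\<Sum>b'\<in>B. md_weight G K \<delta> g x k h s b')"
      using alg h s unfolding player2_algorithm_def g_def by blast+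
    have "(\<Sum>k\<le>K. (\<Sum>b\<in>B. pmf (\<nu> k h s) b * l k b) - (\<Sum>b\<in>B. pmf (\<nu>' h s) b * l k b))
        \<le> ln nB / g + g / 2 * (\<Sum>k\<le>K. \<Sum>b\<in>B. pmf (\<nu> k h s) b * (l k b)\<^sup>2)"
    proof (rule exp_weights_regret[OF finite_sets(3) nonempty_sets(3) g])
      show "pmf (\<nu> 0 h s) b = 1 / nB" if "b \<in> B" for b
        using that nonempty_sets by (simp add: alg'(1))
      show "pmf (\<nu> (Suc k) h s) b = pmf (\<nu> k h s) b * exp (- g * l k b) /
          (\<Sum>b'\<in>B. pmf (\<nu> k h s) b' * exp (- g * l k b'))" if "k < K" "b \<in> B" for k b
        using alg'(2)[of "Suc k" b] that by (simp add: md_weight_def l_def mult.assoc)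
      show "0 \<le> l k b" if "k \<le> K" for k b
      proof (cases "k = 0")
        case False
        then show ?thesis
          using that h s q_tilde_range[of k h s b] d_hat_nonneg[of h s k] by (simp add: l_def)
      qed (simp add: l0)
      show "(\<Sum>b\<in>B. pmf (\<nu>' h s) b) = 1"
        using policy_sum[OF \<nu>' finite_sets(3) h s] .
    qed simp
    also have "(\<Sum>k\<le>K. \<Sum>b\<in>B. pmf (\<nu> k h s) b * (l k b)\<^sup>2) = (\<Sum>k=1..K. \<Sum>b\<in>B. pmf (\<nu> k h s) b * (l k b)\<^sup>2)"
      by (rule sum.mono_neutral_right) (auto simp: l0 not_le)
    also have "\<dots> \<le> (\<Sum>k=1..K. d_hat k h s)"
    proof (rule sum_mono)
      fix k assume k: "k \<in> {1..K}"
      have "(\<Sum>b\<in>B. pmf (\<nu> k h s) b * (l k b)\<^sup>2) \<le> (\<Sum>b\<in>B. pmf (\<nu> k h s) b * d_hat k h s)"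
      proof (intro sum_mono mult_left_mono)
        fix b
        have d: "0 \<le> d_hat k h s" "d_hat k h s \<le> 1"
          using d_hat_nonneg[of h s k] d_hat_le_1[OF k, of h s] h s by auto
        moreover have q: "0 \<le> q_tilde k h s b" "q_tilde k h s b \<le> 1"
          using q_tilde_range[OF k h s, of b] by auto
        ultimately have "l k b \<le> d_hat k h s" "0 \<le> l k b"
          unfolding l_def by (auto intro: mult_left_le)
        then have "(l k b)\<^sup>2 \<le> (d_hat k h s)\<^sup>2"
          by (intro power_mono) auto
        also have "\<dots> \<le> d_hat k h s"
          using d by (simp add: power2_eq_square mult_left_le)
        finally show "(l k b)\<^sup>2 \<le> d_hat k h s" .
      qed simp
      also have "\<dots> = d_hat k h s"
        using policy_sum[OF pol2[OF k] finite_sets(3) h s] by (simp add: sum_distrib_right[symmetric])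
      finally show "(\<Sum>b\<in>B. pmf (\<nu> k h s) b * (l k b)\<^sup>2) \<le> d_hat k h s" .
    qed
    also have "(\<Sum>k\<le>K. (\<Sum>b\<in>B. pmf (\<nu> k h s) b * l k b) - (\<Sum>b\<in>B. pmf (\<nu>' h s) b * l k b)) =
      (\<Sum>k=1..K. (\<Sum>b\<in>B. pmf (\<nu> k h s) b * l k b) - (\<Sum>b\<in>B. pmf (\<nu>' h s) b * l k b))"
      by (rule sum.mono_neutral_right) (auto simp: l0 not_le)
    also have "\<dots> = (\<Sum>k=1..K. d_hat k h s *
      ((\<Sum>b\<in>B. pmf (\<nu> k h s) b * q_tilde k h s b) - (\<Sum>b\<in>B. pmf (\<nu>' h s) b * q_tilde k h s b)))"
      by (rule sum.cong[OF refl])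
         (simp only: l_def right_diff_distrib sum_distrib_left[of "d_hat _ h s" _ B] mult.left_commute)
    finally show ?thesis
      using g by simp
  qed
  have "(\<Sum>h=1..H. \<Sum>s\<in>S. \<Sum>k=1..K. d_hat k h s *
      ((\<Sum>b\<in>B. pmf (\<nu> k h s) b * q_tilde k h s b) - (\<Sum>b\<in>B. pmf (\<nu>' h s) b * q_tilde k h s b)))
      \<le> (\<Sum>h=1..H. \<Sum>s\<in>S. ln nB / g + g / 2 * (\<Sum>k=1..K. d_hat k h s))"
    by (intro sum_mono each)
  also have "\<dots> = real H * (nS * ln nB / g) + g / 2 * (\<Sum>h=1..H. \<Sum>s\<in>S. \<Sum>k=1..K. d_hat k h s)"
    by (simp add: sum.distrib sum_distrib_left)
  also have "(\<Sum>h=1..H. \<Sum>s\<in>S. \<Sum>k=1..K. d_hat k h s) = (\<Sum>h=1..H. \<Sum>k=1..K. \<Sum>s\<in>S. d_hat k h s)"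
    by (intro sum.cong refl sum.swap)
  also have "\<dots> \<le> (\<Sum>h=1..H. \<Sum>k=1..K. 1)"
    by (intro sum_mono d_hat_sum_le_1) auto
  also have "real H * (nS * ln nB / g) + g / 2 * (\<Sum>h=1..H. \<Sum>k=1..K. 1) = 3 / 2 * real H * (g * real K)"
    unfolding lg by (simp add: algebra_simps)
  finally show ?thesis
    using g by (simp add: gK)
qed

end

lemma visits2_mono: "visits2 x (k - 1) h s a \<le> visits2 x k h s a"
  and visits3_mono: "visits3 x (k - 1) h s a b \<le> visits3 x k h s a b"
  unfolding visits2_def visits3_def by (intro card_mono; auto)+

text \<open>The positive and negative parts of a discrepancy with total 0 are equal in size. This
  reduces an \<open>L\<^sup>1\<close> error to the error of a single set.\<close>

lemma sum_abs_eq_twice_pos: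
  fixes f :: "'c \<Rightarrow> real"
  assumes "finite I" "(\<Sum>i\<in>I. f i) = 0"
  shows "(\<Sum>i\<in>I. \<bar>f i\<bar>) = 2 * (\<Sum>i\<in>{i\<in>I. 0 \<le> f i}. f i)"
proof -
  have "(\<Sum>i\<in>I. \<bar>f i\<bar>) = (\<Sum>i\<in>I. 2 * (if 0 \<le> f i then f i else 0) - f i)"
    by (intro sum.cong) auto
  also have "\<dots> = 2 * (\<Sum>i\<in>I. if 0 \<le> f i then f i else 0)"
    using assms by (simp add: sum_subtractf sum_distrib_left)
  also have "(\<Sum>i\<in>I. if 0 \<le> f i then f i else 0) = (\<Sum>i\<in>{i\<in>I. 0 \<le> f i}. f i)"
    using assms by (simp add: sum.inter_filter)
  finally show ?thesis .
qed

text \<open>What concentration has to deliver about a realisation. Transitions are controlled for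
  all sets \<open>U\<close> at once, since the critical set depends on the data; the extra
  \<open>nS * ln 2\<close> pays for their number. In the occupancy bounds the counts belong to the
  previous episode, so that they are known before the trajectory is drawn.\<close>

locale good_run = game_run G K \<delta> x for G :: "('s, 'a, 'b) game" and K \<delta> x +
  assumes reward_conc: "\<And>k h s a b. k \<in> {1..K} \<Longrightarrow> h \<in> {1..H} \<Longrightarrow> s \<in> S \<Longrightarrow> a \<in> A \<Longrightarrow> b \<in> B \<Longrightarrow>
      \<bar>\<Sum>\<tau>=1..k. of_bool (state x \<tau> h = s \<and> act1 x \<tau> h = a \<and> act2 x \<tau> h = b) * (rew x \<tau> h - r h s a b)\<bar>
        \<le> sqrt (4 * \<iota> * real (N3 k h s a b) / 2)"
    and trans_conc: "\<And>k h s a U. k \<in> {1..K} \<Longrightarrow> h \<in> {1..H} \<Longrightarrow> s \<in> S \<Longrightarrow> a \<in> A \<Longrightarrow> U \<subseteq> S \<Longrightarrow>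
      (\<Sum>\<tau>=1..k. of_bool (state x \<tau> h = s \<and> act1 x \<tau> h = a) *
          (of_bool (state x \<tau> (Suc h) \<in> U) - (\<Sum>s'\<in>U. pmf (P h s a) s')))
        \<le> sqrt ((4 * \<iota> + nS * ln 2) * real (N2 k h s a) / 2)"
    and occ2_conc: "\<And>h. h \<in> {1..H} \<Longrightarrow>
      (\<Sum>k=1..K. (\<Sum>s\<in>S. \<Sum>a\<in>A. d k h s * pmf (\<mu> k h s) a / sqrt (real (max (N2 (k - 1) h s a) 1)))
          - 1 / sqrt (real (max (N2 (k - 1) h (state x k h) (act1 x k h)) 1))) \<le> sqrt (4 * \<iota> * real K / 2)"
    and occ3_conc: "\<And>h. h \<in> {1..H} \<Longrightarrow>
      (\<Sum>k=1..K. (\<Sum>s\<in>S. \<Sum>a\<in>A. \<Sum>b\<in>B. d k h s * pmf (\<mu> k h s) a * pmf (\<nu> k h s) b / sqrt (real (max (N3 (k - 1) h s a b) 1)))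
          - 1 / sqrt (real (max (N3 (k - 1) h (state x k h) (act1 x k h) (act2 x k h)) 1))) \<le> sqrt (4 * \<iota> * real K / 2)"
begin

lemma sum_occ2:
  assumes h: "h \<in> {1..H}"
  shows "(\<Sum>k=1..K. \<Sum>s\<in>S. \<Sum>a\<in>A. d k h s * pmf (\<mu> k h s) a / sqrt (real (max (N2 (k - 1) h s a) 1)))
     \<le> sqrt (2 * \<iota> * real K) + 3 * sqrt (nS * nA * real K)"
proof -
  have "(\<Sum>k=1..K. 1 / sqrt (real (max (N2 (k - 1) h (state x k h) (act1 x k h)) 1)))
      \<le> 3 * sqrt (real (card (S \<times> A)) * real K)"
    using sum_inverse_sqrt_visits[of "S \<times> A" K "\<lambda>k. (state x k h, act1 x k h)"] h state act1
    by (simp add: visits2_def)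
  then show ?thesis
    using occ2_conc[OF h] by (simp add: sum_subtractf card_cartesian_product mult_ac)
qed

lemma sum_occ3:
  assumes h: "h \<in> {1..H}"
  shows "(\<Sum>k=1..K. \<Sum>s\<in>S. \<Sum>a\<in>A. \<Sum>b\<in>B. d k h s * pmf (\<mu> k h s) a * pmf (\<nu> k h s) b / sqrt (real (max (N3 (k - 1) h s a b) 1)))
     \<le> sqrt (2 * \<iota> * real K) + 3 * sqrt (nS * nA * nB * real K)"
proof -
  have "(\<Sum>k=1..K. 1 / sqrt (real (max (N3 (k - 1) h (state x k h) (act1 x k h) (act2 x k h)) 1)))
      \<le> 3 * sqrt (real (card (S \<times> A \<times> B)) * real K)"
    using sum_inverse_sqrt_visits[of "S \<times> A \<times> B" K "\<lambda>k. (state x k h, act1 x k h, act2 x k h)"] h state act1 act2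
    by (simp add: visits3_def)
  then show ?thesis
    using occ3_conc[OF h] by (simp add: sum_subtractf card_cartesian_product mult_ac)
qed

text \<open>The deviation of \<open>r_hat\<close> is at most the bonus, so subtracting the bonus
  gives a lower estimate whose gap is at most two bonuses. Clipping at 0 keeps it a lower estimate
  because mean rewards are nonnegative.\<close>

lemma r_tilde_gap:
  assumes k: "k \<in> {1..K}" and h: "h \<in> {1..H}" and s: "s \<in> S" and a: "a \<in> A" and b: "b \<in> B"
  shows "r_tilde G K \<delta> x k h s a b \<le> r h s a b"
    and "r h s a b - r_tilde G K \<delta> x k h s a b \<le> 4 * sqrt \<iota> / sqrt (real (max (N3 (k - 1) h s a b) 1))"
proof -
  define n where "n = real (max (N3 k h s a b) 1)"
  let ?v = "\<lambda>\<tau>. of_bool (state x \<tau> h = s \<and> act1 x \<tau> h = a \<and> act2 x \<tau> h = b) :: real"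
  have n: "1 \<le> n" by (simp add: n_def)
  have \<beta>: "bonus G K \<delta> x k h s a b = 2 * sqrt \<iota> / sqrt n"
    using k by (simp add: bonus_def n_def real_sqrt_divide real_sqrt_mult)
  have R: "r h s a b \<in> {0..1}"
    using r_range[OF h s a b] .
  have close: "\<bar>r_hat x k h s a b - r h s a b\<bar> \<le> 2 * sqrt \<iota> / sqrt n"
  proof (cases "N3 k h s a b = 0")
    \<comment> \<open>At an unvisited tuple the estimate is 0 and the bonus is at least 1, hence at
      least any mean reward.\<close>
    case True
    then have "?v \<tau> * rew x \<tau> h = 0" if "\<tau> \<in> {1..k}" for \<tau>
      using that by (auto simp: visits3_def)
    then have "(\<Sum>\<tau>=1..k. ?v \<tau> * rew x \<tau> h) = 0"
      by (intro sum.neutral) blast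
    then have "r_hat x k h s a b = 0"
      unfolding r_hat_def by simp
    moreover have "1 \<le> 2 * sqrt \<iota>"
      using \<iota>_ge real_sqrt_le_mono[of "1/4" \<iota>] by (simp add: real_sqrt_divide)
    ultimately show ?thesis
      using R True by (simp add: n_def)
  next
    case False
    then have nN: "n = real (N3 k h s a b)"
      by (simp add: n_def max_def)
    have "(\<Sum>\<tau>=1..k. ?v \<tau> * (rew x \<tau> h - r h s a b)) = (\<Sum>\<tau>=1..k. ?v \<tau> * rew x \<tau> h) - (\<Sum>\<tau>=1..k. ?v \<tau>) * r h s a b"
      by (simp add: right_diff_distrib sum_subtractf sum_distrib_right)
    also have "(\<Sum>\<tau>=1..k. ?v \<tau>) = n"
      unfolding nN by (simp add: visits3_def Int_def)
    also have "(\<Sum>\<tau>=1..k. ?v \<tau> * rew x \<tau> h) = n * r_hat x k h s a b"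
      unfolding r_hat_def n_def[symmetric] using n by simp
    finally have "\<bar>n * r_hat x k h s a b - n * r h s a b\<bar> \<le> sqrt (2 * \<iota> * n)"
      using reward_conc[OF k h s a b] by (simp add: nN mult.assoc)
    also have "\<dots> \<le> sqrt (4 * \<iota> * n)"
      using \<iota>_ge n by (intro real_sqrt_le_mono mult_right_mono) auto
    also have "\<dots> = 2 * sqrt \<iota> * sqrt n"
      by (simp add: real_sqrt_mult)
    also have "\<bar>n * r_hat x k h s a b - n * r h s a b\<bar> = n * \<bar>r_hat x k h s a b - r h s a b\<bar>"
      using n by (simp add: abs_mult flip: right_diff_distrib)
    finally have "\<bar>r_hat x k h s a b - r h s a b\<bar> \<le> 2 * sqrt \<iota> * sqrt n / n"
      using n by (simp add: pos_le_divide_eq mult.commute)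
    also have "\<dots> = 2 * sqrt \<iota> / sqrt n"
      using n by (simp add: field_simps)
    finally show ?thesis .
  qed
  show "r_tilde G K \<delta> x k h s a b \<le> r h s a b"
    using close R unfolding r_tilde_def \<beta> by auto
  have "r h s a b - r_tilde G K \<delta> x k h s a b \<le> 4 * sqrt \<iota> / sqrt n"
    using close unfolding r_tilde_def \<beta> by auto
  \<comment> \<open>Fewer visits only weaken the bound; the earlier count is the one for which the
    occupancy comparison is available.\<close>
  also have "\<dots> \<le> 4 * sqrt \<iota> / sqrt (real (max (N3 (k - 1) h s a b) 1))"
    using visits3_mono[of x k h s a b] \<iota>_ge unfolding n_def
    by (intro divide_left_mono mult_pos_pos real_sqrt_le_mono) auto
  finally show "r h s a b - r_tilde G K \<delta> x k h s a b \<le> 4 * sqrt \<iota> / sqrt (real (max (N3 (k - 1) h s a b) 1))" .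
qed

text \<open>The set \<open>U\<close> on which the empirical kernel is not below the true one carries
  half of the \<open>L\<^sup>1\<close> error, and its deviation is a sum over visits. The factor
  \<open>sqrt nS\<close> comes from the simultaneous control of all sets.\<close>

lemma P_hat_gap:
  assumes k: "k \<in> {1..K}" and h: "h \<in> {1..H}" and s: "s \<in> S" and a: "a \<in> A"
  shows "(\<Sum>s'\<in>S. \<bar>P_hat G x k h s a s' - pmf (P h s a) s'\<bar>) \<le> 4 * sqrt nS * sqrt \<iota> / sqrt (real (max (N2 (k - 1) h s a) 1))"
proof -
  define n where "n = real (max (N2 k h s a) 1)"
  have n: "1 \<le> n" by (simp add: n_def)
  have "(\<Sum>s'\<in>S. \<bar>P_hat G x k h s a s' - pmf (P h s a) s'\<bar>) \<le> 4 * sqrt nS * sqrt \<iota> / sqrt n"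
  proof (cases "N2 k h s a = 0")
    \<comment> \<open>An unvisited pair has empirical kernel 0, so its error is exactly 1.\<close>
    case True
    then have "(\<Sum>s'\<in>S. P_hat G x k h s a s') = 0"
      using P_hat_sum[OF k h, of s a] by simp
    then have "P_hat G x k h s a s' = 0" if "s' \<in> S" for s'
      using that by (simp add: sum_nonneg_eq_0_iff P_hat_nonneg)
    then have "(\<Sum>s'\<in>S. \<bar>P_hat G x k h s a s' - pmf (P h s a) s'\<bar>) = 1"
      using P_sum[OF h s a] by simp
    also have "1 \<le> sqrt nS * (2 * sqrt \<iota>)"
    proof -
      have "1 \<le> 2 * sqrt \<iota>"
        using \<iota>_ge real_sqrt_le_mono[of "1/4" \<iota>] by (simp add: real_sqrt_divide)
      moreover have "1 \<le> sqrt nS"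
        using sizes_ge_1 by simp
      ultimately show ?thesis
        using mult_mono[of 1 "sqrt nS" 1 "2 * sqrt \<iota>"] by simp
    qed
    also have "\<dots> \<le> 4 * sqrt nS * sqrt \<iota> / sqrt n"
      using True \<iota>_ge by (simp add: n_def)
    finally show ?thesis .
  next
    case False
    then have nN: "n = real (N2 k h s a)"
      by (simp add: n_def max_def)
    define f where "f s' = P_hat G x k h s a s' - pmf (P h s a) s'" for s'
    define U where "U = {s'\<in>S. 0 \<le> f s'}"
    have U: "U \<subseteq> S" "finite U"
      unfolding U_def by auto
    let ?v = "\<lambda>\<tau>. of_bool (state x \<tau> h = s \<and> act1 x \<tau> h = a) :: real"
    have "n * (\<Sum>s'\<in>U. f s') = (\<Sum>\<tau>=1..k. ?v \<tau> * (of_bool (state x \<tau> (Suc h) \<in> U) - (\<Sum>s'\<in>U. pmf (P h s a) s')))"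
    proof -
      have "n * P_hat G x k h s a s' = (\<Sum>\<tau>=1..k. of_bool (state x \<tau> h = s \<and> act1 x \<tau> h = a \<and> state x \<tau> (Suc h) = s'))" for s'
        using k n unfolding P_hat_def n_def[symmetric] by simp
      also have "(\<Sum>\<tau>=1..k. of_bool (state x \<tau> h = s \<and> act1 x \<tau> h = a \<and> state x \<tau> (Suc h) = s')) =
          (\<Sum>\<tau>=1..k. ?v \<tau> * of_bool (state x \<tau> (Suc h) = s'))" for s'
        by (intro sum.cong) auto
      finally have "n * (\<Sum>s'\<in>U. P_hat G x k h s a s') = (\<Sum>\<tau>=1..k. ?v \<tau> * (\<Sum>s'\<in>U. of_bool (state x \<tau> (Suc h) = s')))"
        by (simp add: sum_distrib_left sum.swap[of _ U])
      also have "\<dots> = (\<Sum>\<tau>=1..k. ?v \<tau> * of_bool (state x \<tau> (Suc h) \<in> U))"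
        using U by (intro sum.cong refl arg_cong2[where f = "(*)"]) (simp add: of_bool_def)
      finally have 1: "n * (\<Sum>s'\<in>U. P_hat G x k h s a s') = (\<Sum>\<tau>=1..k. ?v \<tau> * of_bool (state x \<tau> (Suc h) \<in> U))" .
      have "(\<Sum>\<tau>=1..k. ?v \<tau>) = n"
        unfolding nN by (simp add: visits2_def Int_def)
      then have 2: "n * (\<Sum>s'\<in>U. pmf (P h s a) s') = (\<Sum>\<tau>=1..k. ?v \<tau> * (\<Sum>s'\<in>U. pmf (P h s a) s'))"
        by (simp only: sum_distrib_right[symmetric])
      show ?thesis
        unfolding f_def sum_subtractf right_diff_distrib 1 2 ..
    qed
    also have "\<dots> \<le> sqrt ((4 * \<iota> + nS * ln 2) * n / 2)"
      using trans_conc[OF k h s a U(1)] by (simp add: nN)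
    also have "\<dots> \<le> sqrt ((2\<^sup>2 * nS * \<iota>) * n)"
    proof (rule real_sqrt_le_mono)
      have "nS * ln 2 \<le> nS * \<iota>" "\<iota> \<le> nS * \<iota>"
        using ln_2_le sizes_ge_1 \<iota>_ge by (auto simp: mult_le_cancel_right1 intro: mult_left_mono)
      then have "4 * \<iota> + nS * ln 2 \<le> 8 * (nS * \<iota>)"
        using \<iota>_ge by linarith
      then have "(4 * \<iota> + nS * ln 2) / 2 \<le> 2\<^sup>2 * nS * \<iota>"
        by simp
      then show "(4 * \<iota> + nS * ln 2) * n / 2 \<le> 2\<^sup>2 * nS * \<iota> * n"
        using n mult_right_mono[of "(4 * \<iota> + nS * ln 2) / 2" "2\<^sup>2 * nS * \<iota>" n] by simp
    qed
    also have "\<dots> = 2 * sqrt nS * sqrt \<iota> * sqrt n"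
      by (simp add: real_sqrt_mult)
    finally have "(\<Sum>s'\<in>U. f s') \<le> 2 * sqrt nS * sqrt \<iota> * sqrt n / n"
      using n by (simp add: pos_le_divide_eq mult.commute)
    also have "\<dots> = 2 * sqrt nS * sqrt \<iota> / sqrt n"
      using n by (simp add: field_simps)
    finally have "(\<Sum>s'\<in>U. f s') \<le> 2 * sqrt nS * sqrt \<iota> / sqrt n" .
    moreover have "(\<Sum>s'\<in>S. f s') = 0"
      using P_hat_sum[OF k h, of s a] P_sum[OF h s a] False by (simp add: f_def sum_subtractf)
    then have "(\<Sum>s'\<in>S. \<bar>f s'\<bar>) = 2 * (\<Sum>s'\<in>U. f s')"
      unfolding U_def by (intro sum_abs_eq_twice_pos) auto
    ultimately show ?thesis
      by (simp add: f_def)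
  qed
  also have "\<dots> \<le> 4 * sqrt nS * sqrt \<iota> / sqrt (real (max (N2 (k - 1) h s a) 1))"
    using visits2_mono[of x k h s a] \<iota>_ge unfolding n_def
    by (intro divide_left_mono mult_pos_pos real_sqrt_le_mono mult_nonneg_nonneg) auto
  finally show ?thesis .
qed

text \<open>The error splits as \<open>(d_hat - d) * P_hat + d * (P_hat - P)\<close>, averaged over
  Player 1's action. The first part does not grow because the empirical kernel is substochastic. The
  second is weighted with the true occupancy, so it can be compared with observed visits.\<close>

lemma d_hat_gap:
  assumes k: "k \<in> {1..K}"
  shows "h < H \<Longrightarrow> (\<Sum>s\<in>S. \<bar>d_hat k (Suc h) s - d k (Suc h) s\<bar>) \<le>
    (\<Sum>h'=1..h. \<Sum>s\<in>S. \<Sum>a\<in>A. d k h' s * pmf (\<mu> k h' s) a * (4 * sqrt nS * sqrt \<iota> / sqrt (real (max (N2 (k - 1) h' s a) 1))))"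
proof (induction h)
  case (Suc n)
  let ?h = "Suc n"
  have h: "?h \<in> {1..H}" using Suc by auto
  define f where "f s a s' = (d_hat k ?h s - d k ?h s) * pmf (\<mu> k ?h s) a * P_hat G x k ?h s a s'" for s a s'
  define g where "g s a s' = d k ?h s * pmf (\<mu> k ?h s) a * (P_hat G x k ?h s a s' - pmf (P ?h s a) s')" for s a s'
  have "d_hat k (Suc ?h) s' - d k (Suc ?h) s' = (\<Sum>s\<in>S. \<Sum>a\<in>A. f s a s' + g s a s')" for s'
    unfolding reach.simps sum_subtractf[symmetric] f_def g_def
    by (intro sum.cong refl) (simp add: algebra_simps)
  then have "(\<Sum>s'\<in>S. \<bar>d_hat k (Suc ?h) s' - d k (Suc ?h) s'\<bar>) \<le> (\<Sum>s'\<in>S. \<Sum>s\<in>S. \<Sum>a\<in>A. \<bar>f s a s'\<bar> + \<bar>g s a s'\<bar>)"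
    by (auto intro!: sum_mono order_trans[OF sum_abs] abs_triangle_ineq)
  also have "\<dots> = (\<Sum>s\<in>S. \<Sum>a\<in>A. \<Sum>s'\<in>S. \<bar>f s a s'\<bar> + \<bar>g s a s'\<bar>)"
    by (subst sum.swap, rule sum.cong[OF refl], rule sum.swap)
  also have "\<dots> = (\<Sum>s\<in>S. \<Sum>a\<in>A. \<Sum>s'\<in>S. \<bar>f s a s'\<bar>) + (\<Sum>s\<in>S. \<Sum>a\<in>A. \<Sum>s'\<in>S. \<bar>g s a s'\<bar>)"
    by (simp add: sum.distrib)
  also have "(\<Sum>s\<in>S. \<Sum>a\<in>A. \<Sum>s'\<in>S. \<bar>f s a s'\<bar>) \<le> (\<Sum>s\<in>S. \<bar>d_hat k ?h s - d k ?h s\<bar>)"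
  proof (rule sum_mono)
    fix s assume s: "s \<in> S"
    have "(\<Sum>a\<in>A. \<Sum>s'\<in>S. \<bar>f s a s'\<bar>) = (\<Sum>a\<in>A. \<bar>d_hat k ?h s - d k ?h s\<bar> * pmf (\<mu> k ?h s) a * (\<Sum>s'\<in>S. P_hat G x k ?h s a s'))"
      by (simp add: f_def abs_mult P_hat_nonneg sum_distrib_left)
    also have "\<dots> \<le> (\<Sum>a\<in>A. \<bar>d_hat k ?h s - d k ?h s\<bar> * pmf (\<mu> k ?h s) a * 1)"
      by (intro sum_mono mult_left_mono mult_nonneg_nonneg) (auto simp: P_hat_sum[OF k h])
    also have "\<dots> = \<bar>d_hat k ?h s - d k ?h s\<bar>"
      using policy_sum[OF pol1[OF k] finite_sets(2) h s] by (simp add: sum_distrib_left[symmetric])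
    finally show "(\<Sum>a\<in>A. \<Sum>s'\<in>S. \<bar>f s a s'\<bar>) \<le> \<bar>d_hat k ?h s - d k ?h s\<bar>" .
  qed
  also have "(\<Sum>s\<in>S. \<bar>d_hat k ?h s - d k ?h s\<bar>) \<le>
    (\<Sum>h'=1..n. \<Sum>s\<in>S. \<Sum>a\<in>A. d k h' s * pmf (\<mu> k h' s) a * (4 * sqrt nS * sqrt \<iota> / sqrt (real (max (N2 (k - 1) h' s a) 1))))"
    using Suc by simp
  also have "(\<Sum>s\<in>S. \<Sum>a\<in>A. \<Sum>s'\<in>S. \<bar>g s a s'\<bar>) \<le>
     (\<Sum>s\<in>S. \<Sum>a\<in>A. d k ?h s * pmf (\<mu> k ?h s) a * (4 * sqrt nS * sqrt \<iota> / sqrt (real (max (N2 (k - 1) ?h s a) 1))))"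
  proof (intro sum_mono)
    fix s a assume s: "s \<in> S" and a: "a \<in> A"
    have d: "0 \<le> d k ?h s"
      using occ_nonneg[of ?h s "\<mu> k"] h s by auto
    then have "(\<Sum>s'\<in>S. \<bar>g s a s'\<bar>) = d k ?h s * pmf (\<mu> k ?h s) a * (\<Sum>s'\<in>S. \<bar>P_hat G x k ?h s a s' - pmf (P ?h s a) s'\<bar>)"
      by (simp add: g_def abs_mult sum_distrib_left)
    also have "\<dots> \<le> d k ?h s * pmf (\<mu> k ?h s) a * (4 * sqrt nS * sqrt \<iota> / sqrt (real (max (N2 (k - 1) ?h s a) 1)))"
      by (rule mult_left_mono[OF P_hat_gap[OF k h s a]]) (simp add: d)
    finally show "(\<Sum>s'\<in>S. \<bar>g s a s'\<bar>) \<le> d k ?h s * pmf (\<mu> k ?h s) a * (4 * sqrt nS * sqrt \<iota> / sqrt (real (max (N2 (k - 1) ?h s a) 1)))" .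
  qed
  finally show ?case
    by simp
qed simp

section \<open>The three parts of the regret\<close>

lemma sqrt_\<iota>_le: "sqrt \<iota> \<le> 2 * \<iota>"
proof (rule real_le_lsqrt)
  have "\<iota> * 1 \<le> \<iota> * (4 * \<iota>)"
    using \<iota>_ge by (intro mult_left_mono) auto
  then show "\<iota> \<le> (2 * \<iota>)\<^sup>2"
    by (simp add: power2_eq_square)
qed (use \<iota>_ge in auto)

text \<open>Common form of both occupancy estimates, with \<open>c\<close> the number of pairs or of
  triples. The factor 8 is 2 from the fluctuation plus 6 from the sum over visits.\<close>

lemma sqrt_\<iota>_times_le:
  assumes "1 \<le> c"
  shows "sqrt \<iota> * (sqrt (2 * \<iota> * real K) + 3 * sqrt (c * real K)) \<le> 8 * \<iota> * sqrt (c * real K)"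
proof -
  have "sqrt \<iota> * sqrt (2 * \<iota> * real K) = sqrt (\<iota>\<^sup>2 * (2 * real K))"
    by (simp add: real_sqrt_mult[symmetric] power2_eq_square mult_ac)
  also have "\<dots> \<le> sqrt (\<iota>\<^sup>2 * (2\<^sup>2 * (c * real K)))"
  proof (intro real_sqrt_le_mono mult_left_mono)
    have "1 * real K \<le> c * real K"
      using assms by (intro mult_right_mono) auto
    then show "2 * real K \<le> 2\<^sup>2 * (c * real K)" by simp
  qed simp
  also have "\<dots> = 2 * \<iota> * sqrt (c * real K)"
    using \<iota>_ge by (simp add: real_sqrt_mult)
  finally have "sqrt \<iota> * sqrt (2 * \<iota> * real K) \<le> 2 * \<iota> * sqrt (c * real K)" .
  moreover have "sqrt \<iota> * (3 * sqrt (c * real K)) \<le> 2 * \<iota> * (3 * sqrt (c * real K))"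
    using sqrt_\<iota>_le assms by (intro mult_right_mono) auto
  ultimately show ?thesis
    by (simp add: distrib_left)
qed

lemma optimism_bound:
  "(\<Sum>h=1..H. \<Sum>s\<in>S. \<Sum>k=1..K. d k h s * (\<Sum>b\<in>B. pmf (\<nu> k h s) b * (q k h s b - q_tilde k h s b)))
     \<le> 32 * \<iota> * (real H * sqrt (nS * nA * nB * real K))"
proof -
  have "(\<Sum>h=1..H. \<Sum>s\<in>S. \<Sum>k=1..K. d k h s * (\<Sum>b\<in>B. pmf (\<nu> k h s) b * (q k h s b - q_tilde k h s b)))
     \<le> (\<Sum>h=1..H. \<Sum>s\<in>S. \<Sum>k=1..K. 4 * sqrt \<iota> *
          (\<Sum>a\<in>A. \<Sum>b\<in>B. d k h s * pmf (\<mu> k h s) a * pmf (\<nu> k h s) b / sqrt (real (max (N3 (k - 1) h s a b) 1))))"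
  proof (intro sum_mono)
    fix h s k assume h: "h \<in> {1..H}" and s: "s \<in> S" and k: "k \<in> {1..K}"
    have d: "0 \<le> d k h s"
      using occ_nonneg[of h s "\<mu> k"] h s by auto
    have "d k h s * (\<Sum>b\<in>B. pmf (\<nu> k h s) b * (q k h s b - q_tilde k h s b)) =
        (\<Sum>b\<in>B. \<Sum>a\<in>A. d k h s * pmf (\<mu> k h s) a * pmf (\<nu> k h s) b * (r h s a b - r_tilde G K \<delta> x k h s a b))"
      unfolding sum_subtractf[symmetric] sum_distrib_left by (intro sum.cong refl) (simp add: algebra_simps)
    also have "\<dots> \<le> (\<Sum>b\<in>B. \<Sum>a\<in>A. d k h s * pmf (\<mu> k h s) a * pmf (\<nu> k h s) b * (4 * sqrt \<iota> / sqrt (real (max (N3 (k - 1) h s a b) 1))))"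
      using r_tilde_gap(2)[OF k h s] d by (intro sum_mono mult_left_mono) auto
    also have "\<dots> = (\<Sum>a\<in>A. \<Sum>b\<in>B. 4 * sqrt \<iota> * (d k h s * pmf (\<mu> k h s) a * pmf (\<nu> k h s) b / sqrt (real (max (N3 (k - 1) h s a b) 1))))"
      by (subst sum.swap) (simp add: mult_ac)
    finally show "d k h s * (\<Sum>b\<in>B. pmf (\<nu> k h s) b * (q k h s b - q_tilde k h s b)) \<le> 4 * sqrt \<iota> *
          (\<Sum>a\<in>A. \<Sum>b\<in>B. d k h s * pmf (\<mu> k h s) a * pmf (\<nu> k h s) b / sqrt (real (max (N3 (k - 1) h s a b) 1)))"
      by (simp only: sum_distrib_left)
  qed
  also have "\<dots> = (\<Sum>h=1..H. 4 * sqrt \<iota> * (\<Sum>k=1..K. \<Sum>s\<in>S.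
          (\<Sum>a\<in>A. \<Sum>b\<in>B. d k h s * pmf (\<mu> k h s) a * pmf (\<nu> k h s) b / sqrt (real (max (N3 (k - 1) h s a b) 1)))))"
    unfolding sum_distrib_left by (rule sum.cong[OF refl], rule sum.swap)
  also have "\<dots> \<le> (\<Sum>h=1..H. 4 * sqrt \<iota> * (sqrt (2 * \<iota> * real K) + 3 * sqrt (nS * nA * nB * real K)))"
    using \<iota>_ge by (intro sum_mono mult_left_mono sum_occ3) auto
  also have "\<dots> = 4 * real H * (sqrt \<iota> * (sqrt (2 * \<iota> * real K) + 3 * sqrt (nS * nA * nB * real K)))"
    by simp
  \<comment> \<open>The constant 32 is 4 from the reward gap times 8 from the occupancy
    estimate.\<close>
  also have "\<dots> \<le> 4 * real H * (8 * \<iota> * sqrt (nS * nA * nB * real K))"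
  proof (intro mult_left_mono sqrt_\<iota>_times_le)
    show "1 \<le> nS * nA * nB"
      using sizes_ge_1 mult_mono[of 1 nS 1 nA] mult_mono[of 1 "nS * nA" 1 nB] by auto
  qed simp
  finally show ?thesis
    by (simp add: mult_ac)
qed

text \<open>The error at every step is charged with the kernel errors of all \<open>H\<close> steps,
  hence the square of \<open>H\<close>. One \<open>sqrt nS\<close> comes from the kernel error and
  another from the number of pairs.\<close>

lemma model_error_bound:
  "(\<Sum>h=1..H. \<Sum>s\<in>S. \<Sum>k=1..K. \<bar>d_hat k h s - d k h s\<bar>) \<le> 32 * \<iota> * (real H ^ 2 * nS * sqrt (nA * real K))"
proof -
  define e where "e k h = (\<Sum>s\<in>S. \<Sum>a\<in>A. d k h s * pmf (\<mu> k h s) a * (4 * sqrt nS * sqrt \<iota> / sqrt (real (max (N2 (k - 1) h s a) 1))))" for k h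
  have e: "0 \<le> e k h" if "h \<in> {1..H}" for k h
    unfolding e_def using \<iota>_ge that by (intro sum_nonneg mult_nonneg_nonneg divide_nonneg_nonneg occ_nonneg) auto
  have "(\<Sum>h=1..H. \<Sum>s\<in>S. \<Sum>k=1..K. \<bar>d_hat k h s - d k h s\<bar>) = (\<Sum>h=1..H. \<Sum>k=1..K. \<Sum>s\<in>S. \<bar>d_hat k h s - d k h s\<bar>)"
    by (intro sum.cong refl sum.swap)
  also have "\<dots> \<le> (\<Sum>h=1..H. \<Sum>k=1..K. \<Sum>h'=1..H. e k h')"
  proof (intro sum_mono)
    fix h k assume h: "h \<in> {1..H}" and k: "k \<in> {1..K}"
    obtain n where n: "h = Suc n" using h by (cases h) auto
    have "(\<Sum>s\<in>S. \<bar>d_hat k h s - d k h s\<bar>) \<le> (\<Sum>h'=1..n. e k h')"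
      using d_hat_gap[OF k, of n] h unfolding n e_def by simp
    also have "\<dots> \<le> (\<Sum>h'=1..H. e k h')"
      using e h n by (intro sum_mono2) auto
    finally show "(\<Sum>s\<in>S. \<bar>d_hat k h s - d k h s\<bar>) \<le> (\<Sum>h'=1..H. e k h')" .
  qed
  also have "\<dots> = real H * (\<Sum>h=1..H. \<Sum>k=1..K. e k h)"
    by (subst sum.swap) simp
  also have "\<dots> \<le> real H * (\<Sum>h=1..H. 4 * sqrt nS * sqrt \<iota> * (sqrt (2 * \<iota> * real K) + 3 * sqrt (nS * nA * real K)))"
  proof (intro mult_left_mono sum_mono)
    fix h assume h: "h \<in> {1..H}"
    have "(\<Sum>k=1..K. e k h) = 4 * sqrt nS * sqrt \<iota> *
        (\<Sum>k=1..K. \<Sum>s\<in>S. \<Sum>a\<in>A. d k h s * pmf (\<mu> k h s) a / sqrt (real (max (N2 (k - 1) h s a) 1)))"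
      unfolding e_def sum_distrib_left by (intro sum.cong refl) simp
    also have "\<dots> \<le> 4 * sqrt nS * sqrt \<iota> * (sqrt (2 * \<iota> * real K) + 3 * sqrt (nS * nA * real K))"
      using \<iota>_ge by (intro mult_left_mono sum_occ2 h) auto
    finally show "(\<Sum>k=1..K. e k h) \<le> 4 * sqrt nS * sqrt \<iota> * (sqrt (2 * \<iota> * real K) + 3 * sqrt (nS * nA * real K))" .
  qed simp
  also have "\<dots> = 4 * real H ^ 2 * sqrt nS * (sqrt \<iota> * (sqrt (2 * \<iota> * real K) + 3 * sqrt (nS * nA * real K)))"
    by (simp add: power2_eq_square)
  also have "\<dots> \<le> 4 * real H ^ 2 * sqrt nS * (8 * \<iota> * sqrt (nS * nA * real K))"
  proof (intro mult_left_mono sqrt_\<iota>_times_le)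
    show "1 \<le> nS * nA"
      using sizes_ge_1 mult_mono[of 1 nS 1 nA] by auto
  qed simp
  also have "\<dots> = 32 * \<iota> * (real H ^ 2 * (sqrt nS * sqrt nS) * sqrt (nA * real K))"
    by (simp add: real_sqrt_mult)
  finally show ?thesis by simp
qed

lemma regret_bound:
  "regret2 G K x \<le> 35 * \<iota> *
     ((sqrt (nS ^ 2 * nA * real H ^ 3) + sqrt (nS * nA * nB * real H)) * sqrt (real K * real H))"
proof -
  define \<nu>' where "\<nu>' = arg_min (\<lambda>\<nu>. \<Sum>k=1..K. V G (\<mu> k) \<nu> 1 (init G)) (is_policy G B)"
  have \<nu>': "is_policy G B \<nu>'"
    unfolding \<nu>'_def by (rule best_response(1)) (rule pol1)
  define D where "D \<rho> g = (\<Sum>b\<in>B. pmf (\<rho> :: 'b pmf) b * (g b :: real))" for \<rho> g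
  have V: "V G (\<mu> k) \<rho> 1 (init G) = (\<Sum>h=1..H. \<Sum>s\<in>S. d k h s * D (\<rho> h s) (q k h s))"
    if "k \<in> {1..K}" "is_policy G B \<rho>" for k \<rho>
    unfolding D_def by (rule V_eq[OF pol1[OF that(1)] that(2)])
  have "regret2 G K x = (\<Sum>k=1..K. V G (\<mu> k) (\<nu> k) 1 (init G) - V G (\<mu> k) \<nu>' 1 (init G))"
    unfolding regret2_def Let_def \<nu>'_def ..
  also have "\<dots> = (\<Sum>k=1..K. \<Sum>h=1..H. \<Sum>s\<in>S. d k h s * (D (\<nu> k h s) (q k h s) - D (\<nu>' h s) (q k h s)))"
    by (intro sum.cong refl) (simp only: V pol2 \<nu>' right_diff_distrib sum_subtractf)
  also have "\<dots> = (\<Sum>h=1..H. \<Sum>s\<in>S. \<Sum>k=1..K. d k h s * (D (\<nu> k h s) (q k h s) - D (\<nu>' h s) (q k h s)))"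
    by (subst sum.swap, rule sum.cong[OF refl], rule sum.swap)
  also have "\<dots> \<le> (\<Sum>h=1..H. \<Sum>s\<in>S. \<Sum>k=1..K.
      d k h s * D (\<nu> k h s) (\<lambda>b. q k h s b - q_tilde k h s b) + \<bar>d_hat k h s - d k h s\<bar> +
      d_hat k h s * (D (\<nu> k h s) (q_tilde k h s) - D (\<nu>' h s) (q_tilde k h s)))"
  proof (intro sum_mono)
    fix h s k assume h: "h \<in> {1..H}" and s: "s \<in> S" and k: "k \<in> {1..K}"
    have d: "0 \<le> d k h s"
      using occ_nonneg[of h s "\<mu> k"] h s by auto
    have split: "D \<rho> (q k h s) = D \<rho> (\<lambda>b. q k h s b - q_tilde k h s b) + D \<rho> (q_tilde k h s)" for \<rho>
      unfolding D_def by (simp add: right_diff_distrib sum_subtractf)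
    have "0 \<le> D (\<nu>' h s) (\<lambda>b. q k h s b - q_tilde k h s b)"
      unfolding D_def using r_tilde_gap(1)[OF k h s]
      by (intro sum_nonneg mult_nonneg_nonneg) (auto intro!: sum_mono mult_right_mono)
    then have 1: "0 \<le> d k h s * D (\<nu>' h s) (\<lambda>b. q k h s b - q_tilde k h s b)"
      using d by simp
    have range: "D (\<rho> h s) (q_tilde k h s) \<in> {0..1}" if "is_policy G B \<rho>" for \<rho>
      unfolding D_def using policy_mean_range[OF that finite_sets(3) h s, of "q_tilde k h s"] q_tilde_range[OF k h s]
      by (simp add: mult.commute)
    \<comment> \<open>Both averages lie between 0 and 1, so the coefficient of the occupancy error
      is at most 1 in absolute value.\<close>
    have "\<bar>D (\<nu> k h s) (q_tilde k h s) - D (\<nu>' h s) (q_tilde k h s)\<bar> \<le> 1"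
      using range[OF pol2[OF k]] range[OF \<nu>'] by auto
    then have "\<bar>d_hat k h s - d k h s\<bar> * \<bar>D (\<nu> k h s) (q_tilde k h s) - D (\<nu>' h s) (q_tilde k h s)\<bar> \<le> \<bar>d_hat k h s - d k h s\<bar>"
      by (intro mult_left_le) auto
    then have 2: "- ((d_hat k h s - d k h s) * (D (\<nu> k h s) (q_tilde k h s) - D (\<nu>' h s) (q_tilde k h s))) \<le> \<bar>d_hat k h s - d k h s\<bar>"
      unfolding abs_mult[symmetric] by linarith
    show "d k h s * (D (\<nu> k h s) (q k h s) - D (\<nu>' h s) (q k h s)) \<le>
      d k h s * D (\<nu> k h s) (\<lambda>b. q k h s b - q_tilde k h s b) + \<bar>d_hat k h s - d k h s\<bar> +
      d_hat k h s * (D (\<nu> k h s) (q_tilde k h s) - D (\<nu>' h s) (q_tilde k h s))"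
      using 1 2 unfolding split[of "\<nu> k h s"] split[of "\<nu>' h s"] by (simp add: algebra_simps)
  qed
  also have "\<dots> \<le> 32 * \<iota> * (real H * sqrt (nS * nA * nB * real K)) + 32 * \<iota> * (real H ^ 2 * nS * sqrt (nA * real K)) +
      3 / 2 * real H * sqrt (nS * ln nB * real K)"
    unfolding sum.distrib D_def by (intro add_mono optimism_bound model_error_bound mirror_descent_bound \<nu>')
  \<comment> \<open>The mirror descent term is dominated: \<open>nS * ln nB\<close> is at most
    \<open>\<iota> * nS\<^sup>2 * nA\<close>, so it joins the model error and raises the constant
    from 32 to 35.\<close>
  also have "3 / 2 * real H * sqrt (nS * ln nB * real K) \<le> 3 * \<iota> * (real H ^ 2 * nS * sqrt (nA * real K))"
  proof -
    have "sqrt (nS * ln nB * real K) \<le> sqrt (\<iota> * (nS\<^sup>2 * (nA * real K)))"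
    proof (rule real_sqrt_le_mono)
      have "ln nB * (nS * real K) \<le> \<iota> * (nS\<^sup>2 * (nA * real K))"
      proof (rule mult_mono[OF ln_B_le])
        have "nS * (1 * real K) \<le> nS * (nS * nA * real K)"
          using sizes_ge_1 mult_mono[of 1 nS 1 nA] by (intro mult_left_mono mult_right_mono) auto
        then show "nS * real K \<le> nS\<^sup>2 * (nA * real K)"
          by (simp add: power2_eq_square mult_ac)
      qed (use \<iota>_ge in auto)
      then show "nS * ln nB * real K \<le> \<iota> * (nS\<^sup>2 * (nA * real K))"
        by (simp add: mult_ac)
    qed
    also have "\<dots> = sqrt \<iota> * (nS * sqrt (nA * real K))"
      by (simp add: real_sqrt_mult)
    also have "\<dots> \<le> 2 * \<iota> * (nS * sqrt (nA * real K))"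
      by (intro mult_right_mono sqrt_\<iota>_le) auto
    finally have "3 / 2 * real H * sqrt (nS * ln nB * real K) \<le> 3 / 2 * real H * (2 * \<iota> * (nS * sqrt (nA * real K)))"
      by (intro mult_left_mono) auto
    also have "\<dots> \<le> 3 / 2 * real H ^ 2 * (2 * \<iota> * (nS * sqrt (nA * real K)))"
      using sizes_ge_1 \<iota>_ge by (intro mult_right_mono mult_left_mono) (auto simp: power2_eq_square)
    finally show ?thesis
      by (simp add: mult_ac)
  qed
  also have "32 * \<iota> * (real H * sqrt (nS * nA * nB * real K)) + 32 * \<iota> * (real H ^ 2 * nS * sqrt (nA * real K)) +
      3 * \<iota> * (real H ^ 2 * nS * sqrt (nA * real K)) \<le>
      35 * \<iota> * (real H ^ 2 * nS * sqrt (nA * real K) + real H * sqrt (nS * nA * nB * real K))"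
    using \<iota>_ge by (simp add: distrib_left)
  \<comment> \<open>Of the \<open>H ^ 4\<close> under the root, \<open>H ^ 3\<close> goes to
    \<open>C\<close> and \<open>H\<close> to \<open>T\<close>.\<close>
  also have "real H ^ 2 * nS * sqrt (nA * real K) = sqrt (nS ^ 2 * nA * real H ^ 3) * sqrt (real K * real H)"
  proof -
    have "real H ^ 2 * nS * sqrt (nA * real K) = sqrt ((real H ^ 2 * nS)\<^sup>2 * (nA * real K))"
      by (simp add: real_sqrt_mult)
    also have "(real H ^ 2 * nS)\<^sup>2 * (nA * real K) = nS ^ 2 * nA * real H ^ 3 * (real K * real H)"
      by (simp add: eval_nat_numeral)
    finally show ?thesis
      by (simp only: real_sqrt_mult)
  qed
  also have "real H * sqrt (nS * nA * nB * real K) = sqrt (nS * nA * nB * real H) * sqrt (real K * real H)"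
  proof -
    have "real H * sqrt (nS * nA * nB * real K) = sqrt ((real H)\<^sup>2 * (nS * nA * nB * real K))"
      by (simp add: real_sqrt_mult)
    also have "(real H)\<^sup>2 * (nS * nA * nB * real K) = nS * nA * nB * real H * (real K * real H)"
      by (simp add: power2_eq_square)
    finally show ?thesis
      by (simp only: real_sqrt_mult)
  qed
  finally show ?thesis
    by (simp only: distrib_right)
qed

end

section \<open>Probability of the good event\<close>

lemma subalgebra_refl: "subalgebra M M"
  and subalgebra_trans: "subalgebra M F \<Longrightarrow> subalgebra F E \<Longrightarrow> subalgebra M E"
  unfolding subalgebra_def by auto

lemma borel_measurable_of_bool_eq:
  assumes "f \<in> N \<rightarrow>\<^sub>M count_space C"
  shows "(\<lambda>\<omega>. of_bool (f \<omega> = c) :: real) \<in> borel_measurable N"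
  using measurable_compose[OF assms, of "\<lambda>y. of_bool (y = c)" borel] by simp

locale game_protocol = game G for G :: "('s, 'a, 'b) game" +
  fixes K :: nat and M :: "'w measure" and F F' :: "nat \<Rightarrow> nat \<Rightarrow> 'w measure"
    and X :: "'w \<Rightarrow> ('s, 'a, 'b) play"
  assumes protocol: "protocol G K M F F' X"
begin

sublocale prob_space M
  using protocol unfolding protocol_def by blast

lemma
  assumes k: "k \<in> {1..K}"
  shows pol1: "\<omega> \<in> space M \<Longrightarrow> is_policy G A (pol1 (X \<omega>) k)"
    and pol2: "\<omega> \<in> space M \<Longrightarrow> is_policy G B (pol2 (X \<omega>) k)"
    and pol1_meas: "h \<in> {1..H} \<Longrightarrow> s \<in> S \<Longrightarrow> a \<in> A \<Longrightarrow> (\<lambda>\<omega>. pmf (pol1 (X \<omega>) k h s) a) \<in> borel_measurable (F k 1)"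
    and pol2_meas: "h \<in> {1..H} \<Longrightarrow> s \<in> S \<Longrightarrow> b \<in> B \<Longrightarrow> (\<lambda>\<omega>. pmf (pol2 (X \<omega>) k h s) b) \<in> borel_measurable (F k 1)"
    and state_init: "\<omega> \<in> space M \<Longrightarrow> state (X \<omega>) k 1 = init G"
    and state_meas: "h \<in> {1..Suc H} \<Longrightarrow> (\<lambda>\<omega>. state (X \<omega>) k h) \<in> F k h \<rightarrow>\<^sub>M count_space S"
    and act1_meas: "h \<in> {1..H} \<Longrightarrow> (\<lambda>\<omega>. act1 (X \<omega>) k h) \<in> F' k h \<rightarrow>\<^sub>M count_space A"
    and act2_meas: "h \<in> {1..H} \<Longrightarrow> (\<lambda>\<omega>. act2 (X \<omega>) k h) \<in> F' k h \<rightarrow>\<^sub>M count_space B"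
    and rew_meas: "h \<in> {1..H} \<Longrightarrow> (\<lambda>\<omega>. rew (X \<omega>) k h) \<in> borel_measurable (F k (Suc h))"
    and rew_range: "h \<in> {1..H} \<Longrightarrow> \<omega> \<in> space M \<Longrightarrow> rew (X \<omega>) k h \<in> {0..1}"
    and act_cond_exp: "h \<in> {1..H} \<Longrightarrow> a \<in> A \<Longrightarrow> b \<in> B \<Longrightarrow> AE \<omega> in M.
      real_cond_exp M (F k h) (\<lambda>\<omega>. of_bool (act1 (X \<omega>) k h = a \<and> act2 (X \<omega>) k h = b)) \<omega> =
        pmf (pol1 (X \<omega>) k h (state (X \<omega>) k h)) a * pmf (pol2 (X \<omega>) k h (state (X \<omega>) k h)) b"
    and next_cond_exp: "h \<in> {1..H} \<Longrightarrow> s' \<in> S \<Longrightarrow> AE \<omega> in M.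
      real_cond_exp M (F' k h) (\<lambda>\<omega>. of_bool (state (X \<omega>) k (Suc h) = s')) \<omega> =
        pmf (trans G h (state (X \<omega>) k h) (act1 (X \<omega>) k h)) s'"
    and rew_cond_exp: "h \<in> {1..H} \<Longrightarrow> AE \<omega> in M.
      real_cond_exp M (F' k h) (\<lambda>\<omega>. rew (X \<omega>) k h) \<omega> =
        mean_reward G h (state (X \<omega>) k h) (act1 (X \<omega>) k h) (act2 (X \<omega>) k h)"
  using protocol k unfolding protocol_def by meson+

lemma
  assumes k: "k \<in> {1..K}"
  shows F'_F: "h \<in> {1..H} \<Longrightarrow> subalgebra (F' k h) (F k h)"
    and F_F': "h \<in> {1..H} \<Longrightarrow> subalgebra (F k (Suc h)) (F' k h)"
    and M_F_end: "subalgebra M (F k (Suc H))"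
    and F_Suc: "k < K \<Longrightarrow> subalgebra (F (Suc k) 1) (F k (Suc H))"
  using protocol k unfolding protocol_def by meson+

section \<open>Order of the information and ranges of the observations\<close>

lemma F_mono_step:
  assumes k: "k \<in> {1..K}" and h: "1 \<le> h"
  shows "h \<le> h' \<Longrightarrow> h' \<le> Suc H \<Longrightarrow> subalgebra (F k h') (F k h)"
proof (induction h' rule: dec_induct)
  case (step n)
  then have "n \<in> {1..H}" using h by auto
  then show ?case
    using step subalgebra_trans[OF subalgebra_trans[OF F_F'[OF k] F'_F[OF k]]] by auto
qed (rule subalgebra_refl)

lemma F_mono_episode:
  assumes j: "1 \<le> j"
  shows "Suc j \<le> k \<Longrightarrow> k \<le> K \<Longrightarrow> subalgebra (F k 1) (F j (Suc H))"
proof (induction k rule: dec_induct)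
  case base
  then show ?case using F_Suc[of j] j by simp
next
  case (step n)
  then have n: "n \<in> {1..K}" "n < K" using j by auto
  show ?case
    using subalgebra_trans[OF subalgebra_trans[OF F_Suc[OF n] F_mono_step[OF n(1)]]] step by auto
qed

lemma
  assumes k: "k \<in> {1..K}"
  shows M_F: "h \<in> {1..Suc H} \<Longrightarrow> subalgebra M (F k h)"
    and M_F': "h \<in> {1..H} \<Longrightarrow> subalgebra M (F' k h)"
    and F'_F1: "h \<in> {1..H} \<Longrightarrow> subalgebra (F' k h) (F k 1)"
    and F_F1: "h \<in> {1..H} \<Longrightarrow> subalgebra (F k h) (F k 1)"
proof -
  show MF: "subalgebra M (F k h)" if "h \<in> {1..Suc H}" for h
    using subalgebra_trans[OF M_F_end[OF k] F_mono_step[OF k]] that by auto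
  assume h: "h \<in> {1..H}"
  show "subalgebra M (F' k h)"
    using subalgebra_trans[OF MF F_F'[OF k h]] h by auto
  show "subalgebra (F k h) (F k 1)"
    using F_mono_step[OF k, of 1 h] h by auto
  then show "subalgebra (F' k h) (F k 1)"
    using subalgebra_trans[OF F'_F[OF k h]] by blast
qed

lemma
  assumes k: "k \<in> {1..K}" and \<omega>: "\<omega> \<in> space M"
  shows state_in: "h \<in> {1..Suc H} \<Longrightarrow> state (X \<omega>) k h \<in> S"
    and act1_in: "h \<in> {1..H} \<Longrightarrow> act1 (X \<omega>) k h \<in> A"
    and act2_in: "h \<in> {1..H} \<Longrightarrow> act2 (X \<omega>) k h \<in> B"
  using measurable_space[OF measurable_from_subalg[OF M_F[OF k] state_meas[OF k]], of h \<omega>] \<omega>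
    measurable_space[OF measurable_from_subalg[OF M_F'[OF k] act1_meas[OF k]], of h \<omega>]
    measurable_space[OF measurable_from_subalg[OF M_F'[OF k] act2_meas[OF k]], of h \<omega>]
  by auto

text \<open>Functions of the random state and actions are written as finite sums of these indicators
  with coefficients indexed by the triple, as in \<open>sum_visit\<close>. Measurability and
  boundedness then reduce to those of the indicators and coefficients.\<close>

abbreviation visit :: "nat \<Rightarrow> nat \<Rightarrow> 's \<Rightarrow> 'a \<Rightarrow> 'b \<Rightarrow> 'w \<Rightarrow> real" where
  "visit k h s a b \<omega> \<equiv> of_bool (state (X \<omega>) k h = s \<and> act1 (X \<omega>) k h = a \<and> act2 (X \<omega>) k h = b)"

lemma sum_visit:
  assumes "k \<in> {1..K}" "\<omega> \<in> space M" "h \<in> {1..H}"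
  shows "(\<Sum>s\<in>S. \<Sum>a\<in>A. \<Sum>b\<in>B. visit k h s a b \<omega> * f s a b) =
    f (state (X \<omega>) k h) (act1 (X \<omega>) k h) (act2 (X \<omega>) k h)"
proof -
  have "visit k h s a b \<omega> * f s a b =
      (if b = act2 (X \<omega>) k h then if a = act1 (X \<omega>) k h then if s = state (X \<omega>) k h then f s a b else 0 else 0 else 0)" for s a b
    by auto
  then show ?thesis
    using assms state_in[of k \<omega> h] act1_in[of k \<omega> h] act2_in[of k \<omega> h] by simp
qed

section \<open>Conditional laws of visits, successor states and rewards\<close>

lemma visit_meas:
  assumes k: "k \<in> {1..K}" and h: "h \<in> {1..H}"
  shows "visit k h s a b \<in> borel_measurable (F' k h)"
proof -
  have "(\<lambda>\<omega>. of_bool (state (X \<omega>) k h = s) * (of_bool (act1 (X \<omega>) k h = a) * of_bool (act2 (X \<omega>) k h = b)) :: real)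
      \<in> borel_measurable (F' k h)"
    using h by (intro borel_measurable_times borel_measurable_of_bool_eq[OF act1_meas[OF k h]]
        borel_measurable_of_bool_eq[OF act2_meas[OF k h]]
        borel_measurable_of_bool_eq[OF measurable_from_subalg[OF F'_F[OF k h] state_meas[OF k]]]) auto
  then show ?thesis
    by (simp add: of_bool_conj)
qed

lemma state_ind_meas:
  "k \<in> {1..K} \<Longrightarrow> h \<in> {1..Suc H} \<Longrightarrow> (\<lambda>\<omega>. of_bool (state (X \<omega>) k h = s) :: real) \<in> borel_measurable (F k h)"
  by (rule borel_measurable_of_bool_eq[OF state_meas])

text \<open>The protocol evaluates both policies at the random state; multiplying by the indicator
  of the state \<open>s\<close> freezes it.\<close>

lemma cond_mean_action:
  assumes k: "k \<in> {1..K}" and h: "h \<in> {1..H}" and s: "s \<in> S" and a: "a \<in> A" and b: "b \<in> B"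
  shows "cond_mean M (F k h) (visit k h s a b)
    (\<lambda>\<omega>. of_bool (state (X \<omega>) k h = s) * (pmf (pol1 (X \<omega>) k h s) a * pmf (pol2 (X \<omega>) k h s) b))"
proof -
  have MF: "subalgebra M (F k h)"
    using M_F[OF k, of h] h by auto
  have st: "(\<lambda>\<omega>. of_bool (state (X \<omega>) k h = s) :: real) \<in> borel_measurable (F k h)" for s
    using state_ind_meas[OF k, of h s] h by auto
  \<comment> \<open>The product of the policies at the random state, as a finite sum, so that
    measurability of each policy entry suffices.\<close>
  define p where "p \<omega> = (\<Sum>s\<in>S. of_bool (state (X \<omega>) k h = s) * (pmf (pol1 (X \<omega>) k h s) a * pmf (pol2 (X \<omega>) k h s) b))" for \<omega>
  have p: "p \<omega> = pmf (pol1 (X \<omega>) k h (state (X \<omega>) k h)) a * pmf (pol2 (X \<omega>) k h (state (X \<omega>) k h)) b"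
    if "\<omega> \<in> space M" for \<omega>
    using state_in[OF k that, of h] h by (simp add: p_def of_bool_def if_distrib[of "\<lambda>c. c * _"] cong: if_cong)
  have "cond_mean M (F k h) (\<lambda>\<omega>. of_bool (act1 (X \<omega>) k h = a \<and> act2 (X \<omega>) k h = b)) p"
  proof (rule cond_mean_real_cond_exp[OF MF])
    have "(\<lambda>\<omega>. of_bool (act1 (X \<omega>) k h = a) * of_bool (act2 (X \<omega>) k h = b) :: real) \<in> borel_measurable (F' k h)"
      by (intro borel_measurable_times borel_measurable_of_bool_eq[OF act1_meas[OF k h]]
          borel_measurable_of_bool_eq[OF act2_meas[OF k h]])
    then show "(\<lambda>\<omega>. of_bool (act1 (X \<omega>) k h = a \<and> act2 (X \<omega>) k h = b) :: real) \<in> borel_measurable M"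
      using measurable_from_subalg[OF M_F'[OF k h]] by (simp add: of_bool_conj)
    show "p \<in> borel_measurable (F k h)"
      unfolding p_def[abs_def]
      by (intro borel_measurable_sum borel_measurable_times st measurable_from_subalg[OF F_F1[OF k h]]
          pol1_meas[OF k h] pol2_meas[OF k h] a b)
    show "bounded_fun M p"
      unfolding p_def[abs_def]
      by (intro bounded_fun_intros bounded_fun_of_bool bounded_funI[of _ _ 1]) (auto simp: pmf_le_1)
    show "AE \<omega> in M. real_cond_exp M (F k h) (\<lambda>\<omega>. of_bool (act1 (X \<omega>) k h = a \<and> act2 (X \<omega>) k h = b)) \<omega> = p \<omega>"
      using act_cond_exp[OF k h a b] AE_space by eventually_elim (simp add: p)
  qed (rule bounded_fun_of_bool)
  from cond_mean_mult[OF MF this st[of s] bounded_fun_of_bool]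
  show ?thesis
    by (rule cond_mean_cong[OF MF]) (auto simp: p)
qed

lemma cond_mean_next:
  assumes k: "k \<in> {1..K}" and h: "h \<in> {1..H}" and s': "s' \<in> S"
  shows "cond_mean M (F' k h) (\<lambda>\<omega>. of_bool (state (X \<omega>) k (Suc h) = s'))
    (\<lambda>\<omega>. \<Sum>s\<in>S. \<Sum>a\<in>A. \<Sum>b\<in>B. visit k h s a b \<omega> * pmf (P h s a) s')"
proof (rule cond_mean_real_cond_exp[OF M_F'[OF k h]])
  show "(\<lambda>\<omega>. of_bool (state (X \<omega>) k (Suc h) = s') :: real) \<in> borel_measurable M"
    using measurable_from_subalg[OF M_F[OF k] state_ind_meas[OF k]] h by auto
  show "(\<lambda>\<omega>. \<Sum>s\<in>S. \<Sum>a\<in>A. \<Sum>b\<in>B. visit k h s a b \<omega> * pmf (P h s a) s') \<in> borel_measurable (F' k h)"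
    by (intro borel_measurable_sum borel_measurable_times visit_meas[OF k h] borel_measurable_const)
  show "bounded_fun M (\<lambda>\<omega>. \<Sum>s\<in>S. \<Sum>a\<in>A. \<Sum>b\<in>B. visit k h s a b \<omega> * pmf (P h s a) s')"
    by (intro bounded_fun_intros bounded_fun_of_bool)
  show "AE \<omega> in M. real_cond_exp M (F' k h) (\<lambda>\<omega>. of_bool (state (X \<omega>) k (Suc h) = s')) \<omega> =
     (\<Sum>s\<in>S. \<Sum>a\<in>A. \<Sum>b\<in>B. visit k h s a b \<omega> * pmf (P h s a) s')"
    using next_cond_exp[OF k h s'] AE_space by eventually_elim (simp only: sum_visit[OF k _ h])
qed (rule bounded_fun_of_bool)

lemma cond_mean_reward:
  assumes k: "k \<in> {1..K}" and h: "h \<in> {1..H}"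
  shows "cond_mean M (F' k h) (\<lambda>\<omega>. rew (X \<omega>) k h)
    (\<lambda>\<omega>. \<Sum>s\<in>S. \<Sum>a\<in>A. \<Sum>b\<in>B. visit k h s a b \<omega> * r h s a b)"
proof (rule cond_mean_real_cond_exp[OF M_F'[OF k h]])
  show "(\<lambda>\<omega>. rew (X \<omega>) k h) \<in> borel_measurable M"
    using measurable_from_subalg[OF M_F[OF k] rew_meas[OF k]] h by auto
  show "bounded_fun M (\<lambda>\<omega>. rew (X \<omega>) k h)"
    using rew_range[OF k h] by (intro bounded_funI[of _ _ 1]) auto
  show "(\<lambda>\<omega>. \<Sum>s\<in>S. \<Sum>a\<in>A. \<Sum>b\<in>B. visit k h s a b \<omega> * r h s a b) \<in> borel_measurable (F' k h)"
    by (intro borel_measurable_sum borel_measurable_times visit_meas[OF k h] borel_measurable_const)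
  show "bounded_fun M (\<lambda>\<omega>. \<Sum>s\<in>S. \<Sum>a\<in>A. \<Sum>b\<in>B. visit k h s a b \<omega> * r h s a b)"
    by (intro bounded_fun_intros bounded_fun_of_bool)
  show "AE \<omega> in M. real_cond_exp M (F' k h) (\<lambda>\<omega>. rew (X \<omega>) k h) \<omega> =
     (\<Sum>s\<in>S. \<Sum>a\<in>A. \<Sum>b\<in>B. visit k h s a b \<omega> * r h s a b)"
    using rew_cond_exp[OF k h] AE_space by eventually_elim (simp only: sum_visit[OF k _ h])
qed

text \<open>The whole policy of episode \<open>k\<close> is known at its start, hence so is its
  occupancy at every step, however adaptively the policy was chosen.\<close>

lemma occ_meas:
  assumes k: "k \<in> {1..K}"
  shows "h < H \<Longrightarrow> s \<in> S \<Longrightarrow> (\<lambda>\<omega>. occ G (pol1 (X \<omega>) k) (Suc h) s) \<in> borel_measurable (F k 1)"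
proof (induction h arbitrary: s)
  case (Suc n)
  then have "Suc n \<in> {1..H}" by auto
  then show ?case
    unfolding reach.simps using Suc
    by (intro borel_measurable_sum borel_measurable_times borel_measurable_const pol1_meas[OF k]) auto
qed simp

text \<open>The law of the state is a hypothesis because \<open>cond_mean_state\<close> uses this
  step within its induction.\<close>

lemma cond_mean_visit_step:
  assumes k: "k \<in> {1..K}" and h: "h \<in> {1..H}" and s: "s \<in> S" and a: "a \<in> A" and b: "b \<in> B"
    and st: "cond_mean M (F k 1) (\<lambda>\<omega>. of_bool (state (X \<omega>) k h = s)) (\<lambda>\<omega>. occ G (pol1 (X \<omega>) k) h s)"
  shows "cond_mean M (F k 1) (visit k h s a b)
    (\<lambda>\<omega>. occ G (pol1 (X \<omega>) k) h s * pmf (pol1 (X \<omega>) k h s) a * pmf (pol2 (X \<omega>) k h s) b)"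
proof -
  have MF: "subalgebra M (F k 1)"
    using M_F[OF k, of 1] by simp
  have "cond_mean M (F k 1)
      (\<lambda>\<omega>. (pmf (pol1 (X \<omega>) k h s) a * pmf (pol2 (X \<omega>) k h s) b) * of_bool (state (X \<omega>) k h = s))
      (\<lambda>\<omega>. (pmf (pol1 (X \<omega>) k h s) a * pmf (pol2 (X \<omega>) k h s) b) * occ G (pol1 (X \<omega>) k) h s)"
    by (intro cond_mean_mult[OF MF st] borel_measurable_times pol1_meas[OF k h s a] pol2_meas[OF k h s b]
        bounded_fun_mult bounded_funI[of _ _ 1]) (auto simp: pmf_le_1)
  then have "cond_mean M (F k 1)
      (\<lambda>\<omega>. of_bool (state (X \<omega>) k h = s) * (pmf (pol1 (X \<omega>) k h s) a * pmf (pol2 (X \<omega>) k h s) b))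
      (\<lambda>\<omega>. occ G (pol1 (X \<omega>) k) h s * pmf (pol1 (X \<omega>) k h s) a * pmf (pol2 (X \<omega>) k h s) b)"
    by (rule cond_mean_cong[OF MF]) simp_all
  then show ?thesis
    by (rule cond_mean_tower[OF F_F1[OF k h] cond_mean_action[OF k h s a b]])
qed

text \<open>Induction along the episode: the successor is averaged given \<open>F' k h\<close>, the
  visit preceding it given \<open>F k 1\<close>, and the tower property joins the two. This
  identifies the occupancy of a random policy with a conditional probability.\<close>

lemma cond_mean_state:
  assumes k: "k \<in> {1..K}"
  shows "h < H \<Longrightarrow> s \<in> S \<Longrightarrow>
    cond_mean M (F k 1) (\<lambda>\<omega>. of_bool (state (X \<omega>) k (Suc h) = s)) (\<lambda>\<omega>. occ G (pol1 (X \<omega>) k) (Suc h) s)"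
proof (induction h arbitrary: s)
  case 0
  have MF: "subalgebra M (F k 1)"
    using M_F[OF k, of 1] by simp
  have "cond_mean M (F k 1) (\<lambda>\<omega>. of_bool (s = init G)) (\<lambda>\<omega>. of_bool (s = init G))"
    by (rule cond_mean_refl[OF MF _ bounded_fun_of_bool]) simp
  then show ?case
    by (rule cond_mean_cong[OF MF]) (use state_init[OF k] in auto)
next
  case (Suc n)
  have h: "Suc n \<in> {1..H}" using Suc by auto
  have MF: "subalgebra M (F k 1)"
    using M_F[OF k, of 1] by simp
  have "cond_mean M (F k 1)
      (\<lambda>\<omega>. \<Sum>s'\<in>S. \<Sum>a\<in>A. \<Sum>b\<in>B. pmf (P (Suc n) s' a) s * visit k (Suc n) s' a b \<omega>)
      (\<lambda>\<omega>. \<Sum>s'\<in>S. \<Sum>a\<in>A. \<Sum>b\<in>B. pmf (P (Suc n) s' a) s * (occ G (pol1 (X \<omega>) k) (Suc n) s' * pmf (pol1 (X \<omega>) k (Suc n) s') a * pmf (pol2 (X \<omega>) k (Suc n) s') b))"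
    by (intro cond_mean_sum[OF MF] cond_mean_mult[OF MF] cond_mean_visit_step[OF k h] Suc.IH
        borel_measurable_const bounded_fun_const) (use Suc in auto)
  then have "cond_mean M (F k 1)
      (\<lambda>\<omega>. \<Sum>s'\<in>S. \<Sum>a\<in>A. \<Sum>b\<in>B. visit k (Suc n) s' a b \<omega> * pmf (P (Suc n) s' a) s)
      (\<lambda>\<omega>. occ G (pol1 (X \<omega>) k) (Suc (Suc n)) s)"
  proof (rule cond_mean_cong[OF MF])
    fix \<omega> assume \<omega>: "\<omega> \<in> space M"
    show "(\<Sum>s'\<in>S. \<Sum>a\<in>A. \<Sum>b\<in>B. pmf (P (Suc n) s' a) s * (occ G (pol1 (X \<omega>) k) (Suc n) s' * pmf (pol1 (X \<omega>) k (Suc n) s') a * pmf (pol2 (X \<omega>) k (Suc n) s') b))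
       = occ G (pol1 (X \<omega>) k) (Suc (Suc n)) s"
      unfolding reach.simps
    proof (intro sum.cong refl)
      fix s' a assume s': "s' \<in> S"
      have "(\<Sum>b\<in>B. pmf (P (Suc n) s' a) s * (occ G (pol1 (X \<omega>) k) (Suc n) s' * pmf (pol1 (X \<omega>) k (Suc n) s') a * pmf (pol2 (X \<omega>) k (Suc n) s') b)) =
        occ G (pol1 (X \<omega>) k) (Suc n) s' * pmf (pol1 (X \<omega>) k (Suc n) s') a * pmf (P (Suc n) s' a) s * (\<Sum>b\<in>B. pmf (pol2 (X \<omega>) k (Suc n) s') b)"
        by (subst sum_distrib_left) (intro sum.cong refl, simp)
      then show "(\<Sum>b\<in>B. pmf (P (Suc n) s' a) s * (occ G (pol1 (X \<omega>) k) (Suc n) s' * pmf (pol1 (X \<omega>) k (Suc n) s') a * pmf (pol2 (X \<omega>) k (Suc n) s') b)) =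
        occ G (pol1 (X \<omega>) k) (Suc n) s' * pmf (pol1 (X \<omega>) k (Suc n) s') a * pmf (P (Suc n) s' a) s"
        using policy_sum[OF pol2[OF k \<omega>] finite_sets(3) h s'] by simp
    qed
  qed (simp add: mult.commute)
  then show ?case
    by (rule cond_mean_tower[OF F'_F1[OF k h] cond_mean_next[OF k h Suc.prems(2)]])
qed

lemma cond_mean_visit:
  assumes k: "k \<in> {1..K}" and h: "h \<in> {1..H}" and s: "s \<in> S" and a: "a \<in> A" and b: "b \<in> B"
  shows "cond_mean M (F k 1) (visit k h s a b)
    (\<lambda>\<omega>. occ G (pol1 (X \<omega>) k) h s * pmf (pol1 (X \<omega>) k h s) a * pmf (pol2 (X \<omega>) k h s) b)"
proof -
  obtain n where "h = Suc n" using h by (cases h) auto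
  then show ?thesis
    using cond_mean_visit_step[OF k h s a b] cond_mean_state[OF k, of n s] h s by auto
qed

text \<open>Supplies the history hypotheses of the concentration bounds: what happened in an earlier
  episode is known at the start of a later one.\<close>

lemma visit_meas_later:
  assumes "1 \<le> j" "j < k" "k \<le> K" "h \<in> {1..H}"
  shows "visit j h s a b \<in> borel_measurable (F k 1)"
    and "(\<lambda>\<omega>. of_bool (state (X \<omega>) j (Suc h) = s) :: real) \<in> borel_measurable (F k 1)"
    and "(\<lambda>\<omega>. rew (X \<omega>) j h) \<in> borel_measurable (F k 1)"
proof -
  have j: "j \<in> {1..K}" using assms by auto
  have sub: "subalgebra (F k 1) (F j (Suc H))"
    using assms by (intro F_mono_episode) auto
  have "subalgebra (F j (Suc H)) (F j (Suc h))"
    using assms by (intro F_mono_step[OF j]) auto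
  then have sub': "subalgebra (F k 1) (F j (Suc h))"
    using subalgebra_trans[OF sub] by blast
  show "visit j h s a b \<in> borel_measurable (F k 1)"
    using visit_meas[OF j assms(4)]
    by (rule measurable_from_subalg[OF subalgebra_trans[OF sub' F_F'[OF j assms(4)]]])
  show "(\<lambda>\<omega>. of_bool (state (X \<omega>) j (Suc h) = s) :: real) \<in> borel_measurable (F k 1)"
    using state_ind_meas[OF j, of "Suc h"] assms(4) by (intro measurable_from_subalg[OF sub']) auto
  show "(\<lambda>\<omega>. rew (X \<omega>) j h) \<in> borel_measurable (F k 1)"
    by (rule measurable_from_subalg[OF sub' rew_meas[OF j assms(4)]])
qed

section \<open>Visit counts and concentration across episodes\<close>

lemma visits3_meas:
  assumes "k \<in> {1..K}" "h \<in> {1..H}"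
  shows "(\<lambda>\<omega>. real (visits3 (X \<omega>) (k - 1) h s a b)) \<in> borel_measurable (F k 1)"
proof -
  have "real (visits3 (X \<omega>) (k - 1) h s a b) = (\<Sum>j=1..k - 1. visit j h s a b \<omega>)" for \<omega>
    by (simp add: visits3_def Int_def)
  moreover have "(\<lambda>\<omega>. \<Sum>j=1..k - 1. visit j h s a b \<omega>) \<in> borel_measurable (F k 1)"
    using assms by (intro borel_measurable_sum visit_meas_later) auto
  ultimately show ?thesis by simp
qed

text \<open>Lets pair counts inherit measurability from triple counts.\<close>

lemma visits2_eq_sum:
  assumes "k \<le> K" "h \<in> {1..H}" "\<omega> \<in> space M"
  shows "visits2 (X \<omega>) k h s a = (\<Sum>b\<in>B. visits3 (X \<omega>) k h s a b)"
proof -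
  have "{\<tau> \<in> {1..k}. state (X \<omega>) \<tau> h = s \<and> act1 (X \<omega>) \<tau> h = a} =
     (\<Union>b\<in>B. {\<tau> \<in> {1..k}. state (X \<omega>) \<tau> h = s \<and> act1 (X \<omega>) \<tau> h = a \<and> act2 (X \<omega>) \<tau> h = b})"
    using assms act2_in by fastforce
  then show ?thesis
    unfolding visits2_def visits3_def by (subst card_UN_disjoint[symmetric]) auto
qed

lemma F_mono_start:
  assumes "1 \<le> j" "j < k" "k \<le> K"
  shows "subalgebra (F k 1) (F j 1)"
proof (rule subalgebra_trans)
  show "subalgebra (F k 1) (F j (Suc H))"
    using assms by (intro F_mono_episode) auto
  show "subalgebra (F j (Suc H)) (F j 1)"
    using assms by (intro F_mono_step) auto
qed

lemma visits2_meas: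
  assumes k: "k \<in> {1..K}" and h: "h \<in> {1..H}"
  shows "(\<lambda>\<omega>. real (visits2 (X \<omega>) (k - 1) h s a)) \<in> borel_measurable (F k 1)"
proof -
  have "(\<lambda>\<omega>. \<Sum>b\<in>B. real (visits3 (X \<omega>) (k - 1) h s a b)) \<in> borel_measurable (F k 1)"
    by (intro borel_measurable_sum visits3_meas k h)
  moreover have "space (F k 1) = space M"
    using M_F[OF k, of 1] by (auto simp: subalgebra_def)
  ultimately show ?thesis
    using k visits2_eq_sum[of "k - 1" h] h by (subst measurable_cong) auto
qed

text \<open>Hoeffding's bound at one fixed step \<open>h\<close>, across episodes, along the
  filtration \<open>F' k h\<close>. The conditional mean depends on the current state and actions,
  but it equals the constant \<open>c\<close> in every round that counts.\<close>

lemma whp_visit_conc: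
  fixes w Y p :: "nat \<Rightarrow> 'w \<Rightarrow> real"
  assumes h: "h \<in> {1..H}" and t: "0 < t"
    and Y: "\<And>k. k \<in> {1..K} \<Longrightarrow> cond_mean M (F' k h) (Y k) (p k)"
    and w: "\<And>k. k \<in> {1..K} \<Longrightarrow> w k \<in> borel_measurable (F' k h)"
    and hist: "\<And>j k. 1 \<le> j \<Longrightarrow> j < k \<Longrightarrow> k \<le> K \<Longrightarrow> w j \<in> borel_measurable (F k 1) \<and>
                 Y j \<in> borel_measurable (F k 1) \<and> p j \<in> borel_measurable (F k 1)"
    and Y01: "\<And>k \<omega>. k \<in> {1..K} \<Longrightarrow> \<omega> \<in> space M \<Longrightarrow> Y k \<omega> \<in> {0..1}"
    and p01: "\<And>k \<omega>. k \<in> {1..K} \<Longrightarrow> \<omega> \<in> space M \<Longrightarrow> p k \<omega> \<in> {0..1}"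
    and w01: "\<And>k \<omega>. k \<in> {1..K} \<Longrightarrow> \<omega> \<in> space M \<Longrightarrow> w k \<omega> \<in> {0, 1}"
    and c: "\<And>k \<omega>. k \<in> {1..K} \<Longrightarrow> \<omega> \<in> space M \<Longrightarrow> w k \<omega> = 1 \<Longrightarrow> p k \<omega> = c"
  shows "whp (real K ^ 2 * exp (- t)) (\<lambda>\<omega>. \<forall>k\<in>{1..K}.
           (\<Sum>j=1..k. w j \<omega> * (Y j \<omega> - c)) \<le> sqrt (t * (\<Sum>j=1..k. w j \<omega>) / 2))"
proof (rule whp_mono[OF hoeffding_self_normalised[of K "\<lambda>k. F' k h" Y p w t]])
  show "w j \<in> borel_measurable (F' k h) \<and> Y j \<in> borel_measurable (F' k h) \<and> p j \<in> borel_measurable (F' k h)"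
    if "1 \<le> j" "j < k" "k \<le> K" for j k
    using hist[OF that] measurable_from_subalg[OF F'_F1[of k h]] that h by auto
  fix \<omega> assume \<omega>: "\<omega> \<in> space M"
    and le: "\<forall>k\<in>{1..K}. (\<Sum>j=1..k. w j \<omega> * (Y j \<omega> - p j \<omega>)) \<le> sqrt (t * (\<Sum>j=1..k. w j \<omega>) / 2)"
  have "w j \<omega> * (Y j \<omega> - c) = w j \<omega> * (Y j \<omega> - p j \<omega>)" if "j \<in> {1..K}" for j
    using w01[OF that \<omega>] c[OF that \<omega>] by auto
  then have "(\<Sum>j=1..k. w j \<omega> * (Y j \<omega> - c)) = (\<Sum>j=1..k. w j \<omega> * (Y j \<omega> - p j \<omega>))" if "k \<in> {1..K}" for k
    using that by (intro sum.cong) auto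
  then show "\<forall>k\<in>{1..K}. (\<Sum>j=1..k. w j \<omega> * (Y j \<omega> - c)) \<le> sqrt (t * (\<Sum>j=1..k. w j \<omega>) / 2)"
    using le by auto
qed (use Y w Y01 p01 w01 t M_F' h in auto)

lemma whp_reward:
  assumes h: "h \<in> {1..H}" and s: "s \<in> S" and a: "a \<in> A" and b: "b \<in> B" and t: "0 < t"
  shows "whp (2 * (real K ^ 2 * exp (- t))) (\<lambda>\<omega>. \<forall>k\<in>{1..K}.
     \<bar>\<Sum>j=1..k. visit j h s a b \<omega> * (rew (X \<omega>) j h - r h s a b)\<bar> \<le> sqrt (t * real (visits3 (X \<omega>) k h s a b) / 2))"
proof -
  define p where "p k \<omega> = (\<Sum>s\<in>S. \<Sum>a\<in>A. \<Sum>b\<in>B. visit k h s a b \<omega> * r h s a b)" for k \<omega>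
  have p_eq: "p k \<omega> = r h (state (X \<omega>) k h) (act1 (X \<omega>) k h) (act2 (X \<omega>) k h)"
    if "k \<in> {1..K}" "\<omega> \<in> space M" for k \<omega>
    unfolding p_def using that h by (rule sum_visit)
  have p01: "p k \<omega> \<in> {0..1}" if "k \<in> {1..K}" "\<omega> \<in> space M" for k \<omega>
    unfolding p_eq[OF that] using that h by (intro r_range state_in act1_in act2_in) auto
  have Y: "cond_mean M (F' k h) (\<lambda>\<omega>. rew (X \<omega>) k h) (p k)" if "k \<in> {1..K}" for k
    using cond_mean_reward[OF that h] by (simp add: p_def[abs_def])
  have meas: "visit j h s a b \<in> borel_measurable (F k 1)" "(\<lambda>\<omega>. rew (X \<omega>) j h) \<in> borel_measurable (F k 1)"
    "p j \<in> borel_measurable (F k 1)" if "1 \<le> j" "j < k" "k \<le> K" for j k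
    unfolding p_def[abs_def]
    by (intro borel_measurable_sum borel_measurable_times borel_measurable_const visit_meas_later that h)+
  have upper: "whp (real K ^ 2 * exp (- t)) (\<lambda>\<omega>. \<forall>k\<in>{1..K}.
      (\<Sum>j=1..k. visit j h s a b \<omega> * (rew (X \<omega>) j h - r h s a b)) \<le> sqrt (t * (\<Sum>j=1..k. visit j h s a b \<omega>) / 2))"
    by (rule whp_visit_conc[OF h t Y visit_meas]) (use h p01 p_eq rew_range meas in auto)
  \<comment> \<open>The lower tail is the upper tail for \<open>1 - rew\<close>.\<close>
  have lower: "whp (real K ^ 2 * exp (- t)) (\<lambda>\<omega>. \<forall>k\<in>{1..K}.
      (\<Sum>j=1..k. visit j h s a b \<omega> * (1 - rew (X \<omega>) j h - (1 - r h s a b))) \<le> sqrt (t * (\<Sum>j=1..k. visit j h s a b \<omega>) / 2))"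
  proof (rule whp_visit_conc[OF h t cond_mean_compl[OF M_F' Y] visit_meas])
    show "visit j h s a b \<in> borel_measurable (F k 1) \<and> (\<lambda>\<omega>. 1 - rew (X \<omega>) j h) \<in> borel_measurable (F k 1) \<and>
        (\<lambda>\<omega>. 1 - p j \<omega>) \<in> borel_measurable (F k 1)" if "1 \<le> j" "j < k" "k \<le> K" for j k
      using meas[OF that] by auto
  qed (use h p01 p_eq rew_range in auto)
  have "whp (real K ^ 2 * exp (- t) + real K ^ 2 * exp (- t)) (\<lambda>\<omega>. \<forall>k\<in>{1..K}.
     \<bar>\<Sum>j=1..k. visit j h s a b \<omega> * (rew (X \<omega>) j h - r h s a b)\<bar> \<le> sqrt (t * real (visits3 (X \<omega>) k h s a b) / 2))"
  proof (rule whp_mono[OF whp_conj[OF upper lower]], intro ballI)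
    fix \<omega> k assume k: "k \<in> {1..K}"
      and le: "(\<forall>k\<in>{1..K}. (\<Sum>j=1..k. visit j h s a b \<omega> * (rew (X \<omega>) j h - r h s a b)) \<le> sqrt (t * (\<Sum>j=1..k. visit j h s a b \<omega>) / 2)) \<and>
       (\<forall>k\<in>{1..K}. (\<Sum>j=1..k. visit j h s a b \<omega> * (1 - rew (X \<omega>) j h - (1 - r h s a b))) \<le> sqrt (t * (\<Sum>j=1..k. visit j h s a b \<omega>) / 2))"
    have N: "(\<Sum>j=1..k. visit j h s a b \<omega>) = real (visits3 (X \<omega>) k h s a b)"
      by (simp add: visits3_def Int_def)
    have "(\<Sum>j=1..k. visit j h s a b \<omega> * (1 - rew (X \<omega>) j h - (1 - r h s a b))) =
        (\<Sum>j=1..k. - (visit j h s a b \<omega> * (rew (X \<omega>) j h - r h s a b)))"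
      by (intro sum.cong refl) (simp add: algebra_simps)
    then have neg: "(\<Sum>j=1..k. visit j h s a b \<omega> * (1 - rew (X \<omega>) j h - (1 - r h s a b))) =
        - (\<Sum>j=1..k. visit j h s a b \<omega> * (rew (X \<omega>) j h - r h s a b))"
      by (simp only: sum_negf)
    show "\<bar>\<Sum>j=1..k. visit j h s a b \<omega> * (rew (X \<omega>) j h - r h s a b)\<bar> \<le> sqrt (t * real (visits3 (X \<omega>) k h s a b) / 2)"
      unfolding abs_le_iff neg[symmetric] N[symmetric] using le k by blast
  qed
  then show ?thesis
    unfolding mult_2 .
qed

lemma whp_transition:
  assumes h: "h \<in> {1..H}" and s: "s \<in> S" and a: "a \<in> A" and U: "U \<subseteq> S" and t: "0 < t"
  shows "whp (real K ^ 2 * exp (- t)) (\<lambda>\<omega>. \<forall>k\<in>{1..K}.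
     (\<Sum>j=1..k. of_bool (state (X \<omega>) j h = s \<and> act1 (X \<omega>) j h = a) *
        (of_bool (state (X \<omega>) j (Suc h) \<in> U) - (\<Sum>s'\<in>U. pmf (P h s a) s'))) \<le> sqrt (t * real (visits2 (X \<omega>) k h s a) / 2))"
proof -
  have finU: "finite U" using U finite_subset finite_sets(1) by blast
  define p where "p k \<omega> = (\<Sum>s'\<in>U. \<Sum>s\<in>S. \<Sum>a\<in>A. \<Sum>b\<in>B. visit k h s a b \<omega> * pmf (P h s a) s')" for k \<omega>
  define Y where "Y k \<omega> = (\<Sum>s'\<in>U. of_bool (state (X \<omega>) k (Suc h) = s') :: real)" for k \<omega>
  \<comment> \<open>Summing over Player 2's actions turns triple visits into pair visits.\<close>
  define w where "w k \<omega> = (\<Sum>b\<in>B. visit k h s a b \<omega>)" for k \<omega>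
  have Y_eq: "Y k \<omega> = of_bool (state (X \<omega>) k (Suc h) \<in> U)" for k \<omega>
    using finU by (simp add: Y_def of_bool_def)
  have w_eq: "w k \<omega> = of_bool (state (X \<omega>) k h = s \<and> act1 (X \<omega>) k h = a)" if "k \<in> {1..K}" "\<omega> \<in> space M" for k \<omega>
  proof -
    have "w k \<omega> = (\<Sum>b\<in>B. if b = act2 (X \<omega>) k h then of_bool (state (X \<omega>) k h = s \<and> act1 (X \<omega>) k h = a) else 0)"
      unfolding w_def by (intro sum.cong) auto
    then show ?thesis
      using act2_in[OF that h] by simp
  qed
  have p_eq: "p k \<omega> = (\<Sum>s'\<in>U. pmf (P h (state (X \<omega>) k h) (act1 (X \<omega>) k h)) s')"
    if "k \<in> {1..K}" "\<omega> \<in> space M" for k \<omega>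
    unfolding p_def using that h by (intro sum.cong refl) (rule sum_visit)
  have p01: "p k \<omega> \<in> {0..1}" if "k \<in> {1..K}" "\<omega> \<in> space M" for k \<omega>
  proof -
    have "p k \<omega> \<le> (\<Sum>s'\<in>S. pmf (P h (state (X \<omega>) k h) (act1 (X \<omega>) k h)) s')"
      unfolding p_eq[OF that] using U by (intro sum_mono2) auto
    also have "\<dots> = 1"
      using that h by (intro P_sum state_in act1_in) auto
    finally show ?thesis
      unfolding p_eq[OF that] by (auto intro: sum_nonneg)
  qed
  have "whp (real K ^ 2 * exp (- t)) (\<lambda>\<omega>. \<forall>k\<in>{1..K}.
      (\<Sum>j=1..k. w j \<omega> * (Y j \<omega> - (\<Sum>s'\<in>U. pmf (P h s a) s'))) \<le> sqrt (t * (\<Sum>j=1..k. w j \<omega>) / 2))"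
  proof (rule whp_visit_conc[OF h t])
    show "cond_mean M (F' k h) (Y k) (p k)" if "k \<in> {1..K}" for k
      unfolding p_def[abs_def] Y_def[abs_def] using U by (intro cond_mean_sum M_F' cond_mean_next that h) auto
    show "w k \<in> borel_measurable (F' k h)" if "k \<in> {1..K}" for k
      unfolding w_def[abs_def] by (intro borel_measurable_sum visit_meas that h)
    show "w j \<in> borel_measurable (F k 1) \<and> Y j \<in> borel_measurable (F k 1) \<and> p j \<in> borel_measurable (F k 1)"
      if "1 \<le> j" "j < k" "k \<le> K" for j k
      unfolding w_def[abs_def] p_def[abs_def] Y_def[abs_def]
      by (intro conjI borel_measurable_sum borel_measurable_times borel_measurable_const visit_meas_later that h)
    show "Y k \<omega> \<in> {0..1}" for k \<omega>
      by (simp add: Y_eq)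
    show "w k \<omega> \<in> {0, 1}" if "k \<in> {1..K}" "\<omega> \<in> space M" for k \<omega>
      by (simp add: w_eq[OF that])
    show "p k \<omega> = (\<Sum>s'\<in>U. pmf (P h s a) s')" if "k \<in> {1..K}" "\<omega> \<in> space M" "w k \<omega> = 1" for k \<omega>
      using that(3) unfolding p_eq[OF that(1,2)] w_eq[OF that(1,2)] by simp
  qed (rule p01)
  then show ?thesis
  proof (rule whp_mono, intro ballI)
    fix \<omega> k assume \<omega>: "\<omega> \<in> space M" and k: "k \<in> {1..K}"
      and le: "\<forall>k\<in>{1..K}. (\<Sum>j=1..k. w j \<omega> * (Y j \<omega> - (\<Sum>s'\<in>U. pmf (P h s a) s'))) \<le> sqrt (t * (\<Sum>j=1..k. w j \<omega>) / 2)"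
    have w: "w j \<omega> = of_bool (state (X \<omega>) j h = s \<and> act1 (X \<omega>) j h = a)" if "j \<in> {1..k}" for j
      using that k \<omega> by (intro w_eq) auto
    have N: "(\<Sum>j=1..k. w j \<omega>) = real (visits2 (X \<omega>) k h s a)"
      using w by (simp add: visits2_def Int_def)
    have "(\<Sum>j=1..k. of_bool (state (X \<omega>) j h = s \<and> act1 (X \<omega>) j h = a) *
        (of_bool (state (X \<omega>) j (Suc h) \<in> U) - (\<Sum>s'\<in>U. pmf (P h s a) s'))) =
        (\<Sum>j=1..k. w j \<omega> * (Y j \<omega> - (\<Sum>s'\<in>U. pmf (P h s a) s')))"
      by (intro sum.cong refl) (simp only: w Y_eq)
    also have "\<dots> \<le> sqrt (t * (\<Sum>j=1..k. w j \<omega>) / 2)"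
      using le k by blast
    finally show "(\<Sum>j=1..k. of_bool (state (X \<omega>) j h = s \<and> act1 (X \<omega>) j h = a) *
        (of_bool (state (X \<omega>) j (Suc h) \<in> U) - (\<Sum>s'\<in>U. pmf (P h s a) s'))) \<le> sqrt (t * real (visits2 (X \<omega>) k h s a) / 2)"
      unfolding N .
  qed
qed

text \<open>A weight known at the start of the episode passes through the conditional law of the
  visit, so \<open>q\<close> is the conditional mean of \<open>Z\<close>. Every round counts here,
  hence the width of order \<open>sqrt K\<close>.\<close>

lemma whp_occupancy:
  fixes u :: "nat \<Rightarrow> 's \<Rightarrow> 'a \<Rightarrow> 'b \<Rightarrow> 'w \<Rightarrow> real"
  assumes h: "h \<in> {1..H}" and t: "0 < t" and K: "1 \<le> K"
    and u: "\<And>k s a b. k \<in> {1..K} \<Longrightarrow> s \<in> S \<Longrightarrow> a \<in> A \<Longrightarrow> b \<in> B \<Longrightarrow> u k s a b \<in> borel_measurable (F k 1)"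
    and u01: "\<And>k s a b \<omega>. u k s a b \<omega> \<in> {0..1}"
  shows "whp (real K ^ 2 * exp (- t)) (\<lambda>\<omega>.
    (\<Sum>k=1..K. (\<Sum>s\<in>S. \<Sum>a\<in>A. \<Sum>b\<in>B. occ G (pol1 (X \<omega>) k) h s * pmf (pol1 (X \<omega>) k h s) a * pmf (pol2 (X \<omega>) k h s) b * u k s a b \<omega>)
       - u k (state (X \<omega>) k h) (act1 (X \<omega>) k h) (act2 (X \<omega>) k h) \<omega>) \<le> sqrt (t * real K / 2))"
proof -
  define q where "q k \<omega> = (\<Sum>s\<in>S. \<Sum>a\<in>A. \<Sum>b\<in>B. u k s a b \<omega> * (occ G (pol1 (X \<omega>) k) h s * pmf (pol1 (X \<omega>) k h s) a * pmf (pol2 (X \<omega>) k h s) b))" for k \<omega>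
  define Z where "Z k \<omega> = (\<Sum>s\<in>S. \<Sum>a\<in>A. \<Sum>b\<in>B. u k s a b \<omega> * visit k h s a b \<omega>)" for k \<omega>
  have MF: "subalgebra M (F k 1)" if "k \<in> {1..K}" for k
    using M_F[OF that, of 1] by simp
  have bu: "bounded_fun M (u k s a b)" for k s a b
    using u01[of k s a b] by (intro bounded_funI[of _ _ 1]) auto
  have cm: "cond_mean M (F k 1) (Z k) (q k)" if k: "k \<in> {1..K}" for k
    unfolding Z_def[abs_def] q_def[abs_def]
    by (intro cond_mean_sum[OF MF[OF k]] cond_mean_mult[OF MF[OF k]] cond_mean_visit[OF k h] u[OF k] bu)
  have Z_eq: "Z k \<omega> = u k (state (X \<omega>) k h) (act1 (X \<omega>) k h) (act2 (X \<omega>) k h) \<omega>"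
    if "k \<in> {1..K}" "\<omega> \<in> space M" for k \<omega>
    unfolding Z_def by (subst mult.commute) (rule sum_visit[OF that h])
  have q01: "q k \<omega> \<in> {0..1}" if k: "k \<in> {1..K}" and \<omega>: "\<omega> \<in> space M" for k \<omega>
  proof -
    have h': "h \<le> H" using h by simp
    have o: "0 \<le> occ G (pol1 (X \<omega>) k) h s" if "s \<in> S" for s
      using occ_nonneg[OF h' that] .
    have "q k \<omega> \<le> (\<Sum>s\<in>S. \<Sum>a\<in>A. \<Sum>b\<in>B. 1 * (occ G (pol1 (X \<omega>) k) h s * pmf (pol1 (X \<omega>) k h s) a * pmf (pol2 (X \<omega>) k h s) b))"
      unfolding q_def using u01 o by (intro sum_mono mult_right_mono) auto
    also have "\<dots> = (\<Sum>s\<in>S. occ G (pol1 (X \<omega>) k) h s)"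
      using policy_sum[OF pol1[OF k \<omega>] finite_sets(2) h] policy_sum[OF pol2[OF k \<omega>] finite_sets(3) h]
      by (simp add: sum_distrib_left[symmetric])
    also have "\<dots> \<le> 1"
      by (rule occ_sum_le_1[OF pol1[OF k \<omega>] h'])
    finally have "q k \<omega> \<le> 1" .
    moreover have "0 \<le> q k \<omega>"
      unfolding q_def using u01 o by (intro sum_nonneg mult_nonneg_nonneg) auto
    ultimately show ?thesis by simp
  qed
  \<comment> \<open>Expected minus actual weight is the upper deviation of
    \<open>1 - Z\<close>.\<close>
  have "whp (real K ^ 2 * exp (- t)) (\<lambda>\<omega>. \<forall>k\<in>{1..K}.
       (\<Sum>j=1..k. 1 * ((1 - Z j \<omega>) - (1 - q j \<omega>))) \<le> sqrt (t * (\<Sum>j=1..k. 1) / 2))"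
  proof (rule hoeffding_self_normalised[of K "\<lambda>k. F k 1" "\<lambda>k \<omega>. 1 - Z k \<omega>" "\<lambda>k \<omega>. 1 - q k \<omega>" "\<lambda>_ _. 1", OF _ _ _ _ _ _ _ t])
    show "cond_mean M (F k 1) (\<lambda>\<omega>. 1 - Z k \<omega>) (\<lambda>\<omega>. 1 - q k \<omega>)" if "k \<in> {1..K}" for k
      by (rule cond_mean_compl[OF MF[OF that] cm[OF that]])
    show "(\<lambda>_. 1) \<in> borel_measurable (F k 1) \<and> (\<lambda>\<omega>. 1 - Z j \<omega>) \<in> borel_measurable (F k 1) \<and>
        (\<lambda>\<omega>. 1 - q j \<omega>) \<in> borel_measurable (F k 1)" if "1 \<le> j" "j < k" "k \<le> K" for j k
    proof -
      have j: "j \<in> {1..K}" using that by auto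
      have "q j \<in> borel_measurable (F k 1)"
        using cm[OF j] measurable_from_subalg[OF F_mono_start[OF that]] unfolding cond_mean_def by blast
      moreover have "Z j \<in> borel_measurable (F k 1)"
        unfolding Z_def[abs_def]
        by (intro borel_measurable_sum borel_measurable_times visit_meas_later that h
            measurable_from_subalg[OF F_mono_start[OF that]] u[OF j])
      ultimately show ?thesis by simp
    qed
    show "1 - Z k \<omega> \<in> {0..1}" if "k \<in> {1..K}" "\<omega> \<in> space M" for k \<omega>
      using u01[of k "state (X \<omega>) k h" "act1 (X \<omega>) k h" "act2 (X \<omega>) k h" \<omega>] by (simp add: Z_eq[OF that])
    show "1 - q k \<omega> \<in> {0..1}" if "k \<in> {1..K}" "\<omega> \<in> space M" for k \<omega>
      using q01[OF that] by simp
  qed (use MF in auto)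
  then show ?thesis
  proof (rule whp_mono)
    fix \<omega> assume \<omega>: "\<omega> \<in> space M" and le: "\<forall>k\<in>{1..K}. (\<Sum>j=1..k. 1 * ((1 - Z j \<omega>) - (1 - q j \<omega>))) \<le> sqrt (t * (\<Sum>j=1..k. 1) / 2)"
    have "(\<Sum>k=1..K. q k \<omega> - Z k \<omega>) \<le> sqrt (t * real K / 2)"
      using le[rule_format, of K] K by simp
    moreover have "(\<Sum>k=1..K. q k \<omega> - Z k \<omega>) =
      (\<Sum>k=1..K. (\<Sum>s\<in>S. \<Sum>a\<in>A. \<Sum>b\<in>B. occ G (pol1 (X \<omega>) k) h s * pmf (pol1 (X \<omega>) k h s) a * pmf (pol2 (X \<omega>) k h s) b * u k s a b \<omega>)
       - u k (state (X \<omega>) k h) (act1 (X \<omega>) k h) (act2 (X \<omega>) k h) \<omega>)"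
      by (intro sum.cong refl arg_cong2[where f = "(-)"]) (simp_all only: Z_eq[OF _ \<omega>] q_def mult.commute[of "u _ _ _ _ _"])
    ultimately show "(\<Sum>k=1..K. (\<Sum>s\<in>S. \<Sum>a\<in>A. \<Sum>b\<in>B. occ G (pol1 (X \<omega>) k) h s * pmf (pol1 (X \<omega>) k h s) a * pmf (pol2 (X \<omega>) k h s) b * u k s a b \<omega>)
       - u k (state (X \<omega>) k h) (act1 (X \<omega>) k h) (act2 (X \<omega>) k h) \<omega>) \<le> sqrt (t * real K / 2)"
      by simp
  qed
qed

lemma whp_occupancy3:
  assumes h: "h \<in> {1..H}" and t: "0 < t" and K: "1 \<le> K"
  shows "whp (real K ^ 2 * exp (- t)) (\<lambda>\<omega>.
    (\<Sum>k=1..K. (\<Sum>s\<in>S. \<Sum>a\<in>A. \<Sum>b\<in>B. occ G (pol1 (X \<omega>) k) h s * pmf (pol1 (X \<omega>) k h s) a * pmf (pol2 (X \<omega>) k h s) b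
          / sqrt (real (max (visits3 (X \<omega>) (k - 1) h s a b) 1)))
       - 1 / sqrt (real (max (visits3 (X \<omega>) (k - 1) h (state (X \<omega>) k h) (act1 (X \<omega>) k h) (act2 (X \<omega>) k h)) 1))) \<le> sqrt (t * real K / 2))"
proof -
  \<comment> \<open>The maximum is taken in the reals, so that measurability follows from that of
    the real-valued count.\<close>
  define u where "u k s a b \<omega> = 1 / sqrt (max (real (visits3 (X \<omega>) (k - 1) h s a b)) 1)" for k s a b \<omega>
  have "whp (real K ^ 2 * exp (- t)) (\<lambda>\<omega>.
    (\<Sum>k=1..K. (\<Sum>s\<in>S. \<Sum>a\<in>A. \<Sum>b\<in>B. occ G (pol1 (X \<omega>) k) h s * pmf (pol1 (X \<omega>) k h s) a * pmf (pol2 (X \<omega>) k h s) b * u k s a b \<omega>)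
       - u k (state (X \<omega>) k h) (act1 (X \<omega>) k h) (act2 (X \<omega>) k h) \<omega>) \<le> sqrt (t * real K / 2))"
  proof (rule whp_occupancy[OF h t K])
    show "u k s a b \<in> borel_measurable (F k 1)" if "k \<in> {1..K}" for k s a b
    proof -
      note [measurable] = visits3_meas[OF that h, of s a b]
      show ?thesis
        unfolding u_def[abs_def] by measurable
    qed
  qed (simp add: u_def)
  then show ?thesis
    by (simp add: u_def of_nat_max)
qed

lemma whp_occupancy2:
  assumes h: "h \<in> {1..H}" and t: "0 < t" and K: "1 \<le> K"
  shows "whp (real K ^ 2 * exp (- t)) (\<lambda>\<omega>.
    (\<Sum>k=1..K. (\<Sum>s\<in>S. \<Sum>a\<in>A. occ G (pol1 (X \<omega>) k) h s * pmf (pol1 (X \<omega>) k h s) a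
          / sqrt (real (max (visits2 (X \<omega>) (k - 1) h s a) 1)))
       - 1 / sqrt (real (max (visits2 (X \<omega>) (k - 1) h (state (X \<omega>) k h) (act1 (X \<omega>) k h)) 1))) \<le> sqrt (t * real K / 2))"
proof -
  \<comment> \<open>The weight ignores \<open>b\<close>, so that summing out Player 2's policy
    leaves the version for pairs.\<close>
  define u where "u k s a b \<omega> = 1 / sqrt (max (real (visits2 (X \<omega>) (k - 1) h s a)) 1)" for k s a and b :: 'b and \<omega>
  have "whp (real K ^ 2 * exp (- t)) (\<lambda>\<omega>.
    (\<Sum>k=1..K. (\<Sum>s\<in>S. \<Sum>a\<in>A. \<Sum>b\<in>B. occ G (pol1 (X \<omega>) k) h s * pmf (pol1 (X \<omega>) k h s) a * pmf (pol2 (X \<omega>) k h s) b * u k s a b \<omega>)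
       - u k (state (X \<omega>) k h) (act1 (X \<omega>) k h) (act2 (X \<omega>) k h) \<omega>) \<le> sqrt (t * real K / 2))"
  proof (rule whp_occupancy[OF h t K])
    show "u k s a b \<in> borel_measurable (F k 1)" if "k \<in> {1..K}" for k s a b
    proof -
      note [measurable] = visits2_meas[OF that h, of s a]
      show ?thesis
        unfolding u_def[abs_def] by measurable
    qed
  qed (simp add: u_def)
  then show ?thesis
  proof (rule whp_mono)
    fix \<omega> assume \<omega>: "\<omega> \<in> space M"
    have "(\<Sum>b\<in>B. occ G (pol1 (X \<omega>) k) h s * pmf (pol1 (X \<omega>) k h s) a * pmf (pol2 (X \<omega>) k h s) b * u k s a b \<omega>) =
      occ G (pol1 (X \<omega>) k) h s * pmf (pol1 (X \<omega>) k h s) a / sqrt (real (max (visits2 (X \<omega>) (k - 1) h s a) 1))"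
      if "k \<in> {1..K}" "s \<in> S" for k s a
    proof -
      have "(\<Sum>b\<in>B. occ G (pol1 (X \<omega>) k) h s * pmf (pol1 (X \<omega>) k h s) a * pmf (pol2 (X \<omega>) k h s) b * u k s a b \<omega>) =
        (\<Sum>b\<in>B. (occ G (pol1 (X \<omega>) k) h s * pmf (pol1 (X \<omega>) k h s) a / sqrt (real (max (visits2 (X \<omega>) (k - 1) h s a) 1))) * pmf (pol2 (X \<omega>) k h s) b)"
        by (intro sum.cong refl) (simp add: u_def of_nat_max)
      then show ?thesis
        using policy_sum[OF pol2[OF that(1) \<omega>] finite_sets(3) h that(2)] by (simp only: sum_distrib_left[symmetric] mult_1_right)
    qed
    moreover assume "(\<Sum>k=1..K. (\<Sum>s\<in>S. \<Sum>a\<in>A. \<Sum>b\<in>B. occ G (pol1 (X \<omega>) k) h s * pmf (pol1 (X \<omega>) k h s) a * pmf (pol2 (X \<omega>) k h s) b * u k s a b \<omega>)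
       - u k (state (X \<omega>) k h) (act1 (X \<omega>) k h) (act2 (X \<omega>) k h) \<omega>) \<le> sqrt (t * real K / 2)"
    ultimately show "(\<Sum>k=1..K. (\<Sum>s\<in>S. \<Sum>a\<in>A. occ G (pol1 (X \<omega>) k) h s * pmf (pol1 (X \<omega>) k h s) a
          / sqrt (real (max (visits2 (X \<omega>) (k - 1) h s a) 1)))
       - 1 / sqrt (real (max (visits2 (X \<omega>) (k - 1) h (state (X \<omega>) k h) (act1 (X \<omega>) k h)) 1))) \<le> sqrt (t * real K / 2)"
      by (simp add: u_def of_nat_max)
  qed
qed

section \<open>Measurability of the regret and the total failure probability\<close>

lemma regret_meas: "(\<lambda>\<omega>. regret2 G K (X \<omega>)) \<in> borel_measurable M"
proof -
  define val where "val \<omega> = (\<Sum>k=1..K. \<Sum>h=1..H. \<Sum>s\<in>S. occ G (pol1 (X \<omega>) k) h s *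
      (\<Sum>b\<in>B. pmf (pol2 (X \<omega>) k h s) b * (\<Sum>a\<in>A. r h s a b * pmf (pol1 (X \<omega>) k h s) a)))" for \<omega>
  define best where "best \<omega> = (\<Sum>h=1..H. \<Sum>s\<in>S. Min ((\<lambda>b. loss K (pol1 (X \<omega>)) h s b) ` B))" for \<omega>
  have o: "(\<lambda>\<omega>. occ G (pol1 (X \<omega>) k) h s) \<in> borel_measurable M" if k: "k \<in> {1..K}" and h: "h \<in> {1..H}" and s: "s \<in> S" for k h s
  proof -
    obtain n where n: "h = Suc n" "n < H" using h by (cases h) auto
    have "subalgebra M (F k 1)"
      using M_F[OF k, of 1] by simp
    then show ?thesis
      unfolding n(1) by (rule measurable_from_subalg[OF _ occ_meas[OF k n(2) s]])
  qed
  have \<mu>: "(\<lambda>\<omega>. pmf (pol1 (X \<omega>) k h s) a) \<in> borel_measurable M"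
    if "k \<in> {1..K}" "h \<in> {1..H}" "s \<in> S" "a \<in> A" for k h s a
    using M_F[OF that(1), of 1] by (intro measurable_from_subalg[OF _ pol1_meas[OF that]]) simp
  have \<nu>: "(\<lambda>\<omega>. pmf (pol2 (X \<omega>) k h s) b) \<in> borel_measurable M"
    if "k \<in> {1..K}" "h \<in> {1..H}" "s \<in> S" "b \<in> B" for k h s b
    using M_F[OF that(1), of 1] by (intro measurable_from_subalg[OF _ pol2_meas[OF that]]) simp
  have "val \<in> borel_measurable M"
    unfolding val_def[abs_def] by (intro borel_measurable_sum borel_measurable_times borel_measurable_const o \<mu> \<nu>)
  moreover have "best \<in> borel_measurable M"
    unfolding best_def[abs_def] loss_def
    by (intro borel_measurable_sum borel_measurable_Min finite_sets borel_measurable_times borel_measurable_const o \<mu>)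
  moreover have "regret2 G K (X \<omega>) = val \<omega> - best \<omega>" if \<omega>: "\<omega> \<in> space M" for \<omega>
  proof -
    have "regret2 G K (X \<omega>) = (\<Sum>k=1..K. V G (pol1 (X \<omega>) k) (pol2 (X \<omega>) k) 1 (init G)) - best \<omega>"
      unfolding regret2_def Let_def sum_subtractf best_def
      using best_response(2)[of K "pol1 (X \<omega>)"] pol1[OF _ \<omega>] by simp
    also have "(\<Sum>k=1..K. V G (pol1 (X \<omega>) k) (pol2 (X \<omega>) k) 1 (init G)) = val \<omega>"
      unfolding val_def by (intro sum.cong refl V_eq pol1 pol2 \<omega>)
    finally show ?thesis .
  qed
  ultimately show ?thesis
    by (subst measurable_cong[where g = "\<lambda>\<omega>. val \<omega> - best \<omega>"]) auto
qed

text \<open>All policies of Player 2 have the same value. The case is separate since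
  \<open>ln 1 = 0\<close> makes the step size 0, and exponential weights require a positive
  one.\<close>

lemma regret_zero:
  assumes "card B = 1" and \<omega>: "\<omega> \<in> space M"
  shows "regret2 G K (X \<omega>) = 0"
proof -
  obtain b0 where b0: "B = {b0}"
    using assms(1) card_1_singletonE by blast
  have V: "V G (pol1 (X \<omega>) k) \<nu> 1 (init G) =
      (\<Sum>h=1..H. \<Sum>s\<in>S. occ G (pol1 (X \<omega>) k) h s * (\<Sum>a\<in>A. r h s a b0 * pmf (pol1 (X \<omega>) k h s) a))"
    if "k \<in> {1..K}" "is_policy G B \<nu>" for k \<nu>
    unfolding V_eq[OF pol1[OF that(1) \<omega>] that(2)]
    using policy_sum[OF that(2) finite_sets(3)] by (intro sum.cong refl) (simp add: b0)
  have "is_policy G B (arg_min (\<lambda>\<nu>. \<Sum>k=1..K. V G (pol1 (X \<omega>) k) \<nu> 1 (init G)) (is_policy G B))"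
    by (rule best_response(1)[OF pol1[OF _ \<omega>]])
  then show ?thesis
    unfolding regret2_def Let_def using V pol2[OF _ \<omega>] by (intro sum.neutral) auto
qed

lemma whp_regret:
  fixes \<delta> :: real
  assumes K: "1 \<le> K" and \<delta>: "0 < \<delta>" "\<delta> < 1" and card_B: "2 \<le> card B"
    and alg: "\<And>\<omega>. \<omega> \<in> space M \<Longrightarrow> player2_algorithm G K \<delta>
            (sqrt (real (card S) * ln (real (card B)) / real K)) (X \<omega>)"
  shows "whp (2 * \<delta>) (\<lambda>\<omega>. regret2 G K (X \<omega>) \<le> 35 * log_factor G K \<delta> *
     ((sqrt (real (card S) ^ 2 * real (card A) * real H ^ 3) +
       sqrt (real (card S) * real (card A) * real (card B) * real H)) * sqrt (real K * real H)))" (is "whp _ (\<lambda>\<omega>. _ \<le> ?bound)")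
proof -
  have run: "game_run G K \<delta> (X \<omega>)" if \<omega>: "\<omega> \<in> space M" for \<omega>
    using K \<delta> card_B alg[OF \<omega>] pol1[OF _ \<omega>] pol2[OF _ \<omega>] state_in[OF _ \<omega>] act1_in[OF _ \<omega>] act2_in[OF _ \<omega>]
      rew_range[OF _ _ \<omega>] wf
    by unfold_locales blast+
  \<comment> \<open>An arbitrary outcome gives access to the facts about sizes and
    \<open>\<iota>\<close>, which do not depend on it.\<close>
  obtain \<omega>0 where "\<omega>0 \<in> space M"
    using not_empty by blast
  then interpret R0: game_run G K \<delta> "X \<omega>0"
    by (rule run)
  define \<iota> where "\<iota> = log_factor G K \<delta>"
  define nS where "nS = real (card S)"
  define nA where "nA = real (card A)"
  define nB where "nB = real (card B)"
  define nH where "nH = real H"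
  define Q where "Q = nS * nA * nB * nH * real K"
  define e where "e = exp (- (4 * \<iota>))"
  note sizes = R0.sizes_ge_1[folded nS_def nA_def nB_def nH_def]
  have t: "0 < 4 * \<iota>" "0 < 4 * \<iota> + nS * ln 2"
    using R0.\<iota>_ge sizes by (auto simp: \<iota>_def intro: add_pos_nonneg)
  have 1: "whp (real (card {1..H}) * (nS * (nA * (nB * (2 * (real K ^ 2 * e)))))) (\<lambda>\<omega>.
      \<forall>h\<in>{1..H}. \<forall>s\<in>S. \<forall>a\<in>A. \<forall>b\<in>B. \<forall>k\<in>{1..K}.
     \<bar>\<Sum>j=1..k. visit j h s a b \<omega> * (rew (X \<omega>) j h - r h s a b)\<bar> \<le> sqrt (4 * \<iota> * real (visits3 (X \<omega>) k h s a b) / 2))"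
    unfolding e_def nS_def nA_def nB_def
    by (intro whp_ball whp_reward finite_sets finite_atLeastAtMost t)
  have 2: "whp (real (card {1..H}) * (nS * (nA * (real (card (Pow S)) * (real K ^ 2 * exp (- (4 * \<iota> + nS * ln 2))))))) (\<lambda>\<omega>.
      \<forall>h\<in>{1..H}. \<forall>s\<in>S. \<forall>a\<in>A. \<forall>U\<in>Pow S. \<forall>k\<in>{1..K}.
     (\<Sum>j=1..k. of_bool (state (X \<omega>) j h = s \<and> act1 (X \<omega>) j h = a) *
        (of_bool (state (X \<omega>) j (Suc h) \<in> U) - (\<Sum>s'\<in>U. pmf (P h s a) s'))) \<le> sqrt ((4 * \<iota> + nS * ln 2) * real (visits2 (X \<omega>) k h s a) / 2))"
    unfolding nA_def nS_def
    by (intro whp_ball whp_transition finite_sets finite_Pow_iff[THEN iffD2] finite_atLeastAtMost t[unfolded nS_def]) auto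
  have 3: "whp (real (card {1..H}) * (real K ^ 2 * e)) (\<lambda>\<omega>. \<forall>h\<in>{1..H}.
    (\<Sum>k=1..K. (\<Sum>s\<in>S. \<Sum>a\<in>A. occ G (pol1 (X \<omega>) k) h s * pmf (pol1 (X \<omega>) k h s) a
          / sqrt (real (max (visits2 (X \<omega>) (k - 1) h s a) 1)))
       - 1 / sqrt (real (max (visits2 (X \<omega>) (k - 1) h (state (X \<omega>) k h) (act1 (X \<omega>) k h)) 1))) \<le> sqrt (4 * \<iota> * real K / 2))"
    unfolding e_def by (intro whp_ball whp_occupancy2 finite_atLeastAtMost t K)
  have 4: "whp (real (card {1..H}) * (real K ^ 2 * e)) (\<lambda>\<omega>. \<forall>h\<in>{1..H}.
    (\<Sum>k=1..K. (\<Sum>s\<in>S. \<Sum>a\<in>A. \<Sum>b\<in>B. occ G (pol1 (X \<omega>) k) h s * pmf (pol1 (X \<omega>) k h s) a * pmf (pol2 (X \<omega>) k h s) b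
          / sqrt (real (max (visits3 (X \<omega>) (k - 1) h s a b) 1)))
       - 1 / sqrt (real (max (visits3 (X \<omega>) (k - 1) h (state (X \<omega>) k h) (act1 (X \<omega>) k h) (act2 (X \<omega>) k h)) 1))) \<le> sqrt (4 * \<iota> * real K / 2))"
    unfolding e_def by (intro whp_ball whp_occupancy3 finite_atLeastAtMost t K)
  define c where "c = real (card {1..H}) * (nS * (nA * (nB * (2 * (real K ^ 2 * e))))) +
     (real (card {1..H}) * (nS * (nA * (real (card (Pow S)) * (real K ^ 2 * exp (- (4 * \<iota> + nS * ln 2)))))) +
     (real (card {1..H}) * (real K ^ 2 * e) + real (card {1..H}) * (real K ^ 2 * e)))"
  have "c \<le> 2 * \<delta>"
  proof -
    have e0: "0 \<le> e" by (simp add: e_def)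
    have SA: "1 \<le> nS * nA"
      using sizes mult_mono[of 1 nS 1 nA] by auto
    have SAB: "nS * nA * 2 \<le> nS * nA * nB"
      using sizes SA by (intro mult_left_mono) auto
    have HK: "1 \<le> nH * real K"
      using sizes mult_mono[of 1 nH 1 "real K"] by auto
    have Q2: "2 \<le> Q"
      using mult_mono[of 2 "nS * nA * nB" 1 "nH * real K"] SA SAB HK by (simp add: Q_def mult_ac)
    \<comment> \<open>The number of sets \<open>U\<close> cancels against
      \<open>exp (- (nS * ln 2))\<close>, so the transition events cost no more than one event for
      each pair and step.\<close>
    have "exp (- (nS * ln 2)) = 1 / 2 ^ card S"
      by (simp add: nS_def exp_minus exp_of_nat_mult inverse_eq_divide)
    then have "exp (- (4 * \<iota> + nS * ln 2)) = e * (1 / 2 ^ card S)"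
      by (simp add: e_def exp_diff exp_minus inverse_eq_divide exp_add)
    then have "real (card (Pow S)) * (real K ^ 2 * exp (- (4 * \<iota> + nS * ln 2))) = real K ^ 2 * e"
      by (simp add: card_Pow)
    then have "c = (nH * real K ^ 2 * e) * (2 * (nS * nA * nB) + nS * nA + 2)"
      by (simp add: c_def nH_def algebra_simps)
    also have "\<dots> \<le> (nH * real K ^ 2 * e) * (5 * (nS * nA * nB))"
    proof (rule mult_left_mono)
      show "2 * (nS * nA * nB) + nS * nA + 2 \<le> 5 * (nS * nA * nB)"
        using SA SAB by linarith
    qed (use e0 in \<open>simp add: nH_def\<close>)
    also have "\<dots> = 5 * e * (Q * real K)"
      by (simp add: Q_def power2_eq_square)
    \<comment> \<open>The union costs a factor of at most \<open>5 * Q\<^sup>2\<close>, while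
      \<open>e\<close> is \<open>(\<delta> / Q) ^ 4\<close>. As \<open>Q\<close> is at least 2, the
      total is at most \<open>5 * \<delta> / 4\<close>, so the exponent \<open>4 * \<iota>\<close>
      is ample.\<close>
    also have "\<dots> \<le> 5 * e * (Q * Q)"
    proof (intro mult_left_mono)
      have "1 \<le> nS * nA * nB"
        using SA SAB by linarith
      then have "1 * real K \<le> (nS * nA * nB * nH) * real K"
        using sizes SA SAB mult_mono[of 1 "nS * nA * nB" 1 nH] by (intro mult_right_mono; linarith)
      then show "real K \<le> Q" by (simp add: Q_def)
    qed (use e0 Q2 in auto)
    also have "e = \<delta> ^ 4 / Q ^ 4"
    proof -
      have "exp (4 * \<iota>) = exp \<iota> ^ 4"
        using exp_of_nat_mult[of 4 \<iota>] by simp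
      also have "exp \<iota> = Q / \<delta>"
        unfolding \<iota>_def log_factor_def Q_def[unfolded nS_def nA_def nB_def nH_def, symmetric]
        using Q2 \<delta> by (intro exp_ln) auto
      finally show ?thesis
        by (simp add: e_def exp_minus power_divide)
    qed
    also have "5 * (\<delta> ^ 4 / Q ^ 4) * (Q * Q) = 5 * \<delta> ^ 4 / Q ^ 2"
      using Q2 by (simp add: field_simps eval_nat_numeral)
    also have "\<dots> \<le> 5 * \<delta> / 4"
    proof (rule frac_le)
      show "5 * \<delta> ^ 4 \<le> 5 * \<delta>"
        using \<delta> power_decreasing[of 1 4 \<delta>] by simp
      show "4 \<le> Q ^ 2"
        using Q2 power_mono[of 2 Q 2] by simp
    qed (use \<delta> in auto)
    also have "\<dots> \<le> 2 * \<delta>"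
      using \<delta> by simp
    finally show ?thesis .
  qed
  have "whp c (\<lambda>\<omega>. regret2 G K (X \<omega>) \<le> ?bound)"
    unfolding c_def
  proof (rule whp_mono[OF whp_conj[OF 1 whp_conj[OF 2 whp_conj[OF 3 4]]]], elim conjE)
    fix \<omega> assume \<omega>: "\<omega> \<in> space M"
    interpret R: game_run G K \<delta> "X \<omega>"
      by (rule run[OF \<omega>])
    assume reward: "\<forall>h\<in>{1..H}. \<forall>s\<in>S. \<forall>a\<in>A. \<forall>b\<in>B. \<forall>k\<in>{1..K}.
     \<bar>\<Sum>j=1..k. visit j h s a b \<omega> * (rew (X \<omega>) j h - r h s a b)\<bar> \<le> sqrt (4 * \<iota> * real (visits3 (X \<omega>) k h s a b) / 2)"
      and transition: "\<forall>h\<in>{1..H}. \<forall>s\<in>S. \<forall>a\<in>A. \<forall>U\<in>Pow S. \<forall>k\<in>{1..K}.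
     (\<Sum>j=1..k. of_bool (state (X \<omega>) j h = s \<and> act1 (X \<omega>) j h = a) *
        (of_bool (state (X \<omega>) j (Suc h) \<in> U) - (\<Sum>s'\<in>U. pmf (P h s a) s'))) \<le> sqrt ((4 * \<iota> + nS * ln 2) * real (visits2 (X \<omega>) k h s a) / 2)"
      and occupancy2: "\<forall>h\<in>{1..H}.
    (\<Sum>k=1..K. (\<Sum>s\<in>S. \<Sum>a\<in>A. occ G (pol1 (X \<omega>) k) h s * pmf (pol1 (X \<omega>) k h s) a
          / sqrt (real (max (visits2 (X \<omega>) (k - 1) h s a) 1)))
       - 1 / sqrt (real (max (visits2 (X \<omega>) (k - 1) h (state (X \<omega>) k h) (act1 (X \<omega>) k h)) 1))) \<le> sqrt (4 * \<iota> * real K / 2)"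
      and occupancy3: "\<forall>h\<in>{1..H}.
    (\<Sum>k=1..K. (\<Sum>s\<in>S. \<Sum>a\<in>A. \<Sum>b\<in>B. occ G (pol1 (X \<omega>) k) h s * pmf (pol1 (X \<omega>) k h s) a * pmf (pol2 (X \<omega>) k h s) b
          / sqrt (real (max (visits3 (X \<omega>) (k - 1) h s a b) 1)))
       - 1 / sqrt (real (max (visits3 (X \<omega>) (k - 1) h (state (X \<omega>) k h) (act1 (X \<omega>) k h) (act2 (X \<omega>) k h)) 1))) \<le> sqrt (4 * \<iota> * real K / 2)"
    have "good_run G K \<delta> (X \<omega>)"
    proof (unfold_locales, goal_cases)
      case (1 k h s a b)
      show ?case by (rule reward[unfolded \<iota>_def, rule_format, OF 1(2-5) 1(1)])
    next
      case (2 k h s a U)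
      show ?case by (rule transition[unfolded \<iota>_def nS_def, rule_format, OF 2(2-4) PowI[OF 2(5)] 2(1)])
    next
      case (3 h)
      show ?case by (rule occupancy2[unfolded \<iota>_def, rule_format, OF 3])
    next
      case (4 h)
      show ?case by (rule occupancy3[unfolded \<iota>_def, rule_format, OF 4])
    qed
    then show "regret2 G K (X \<omega>) \<le> ?bound"
      by (rule good_run.regret_bound)
  qed
  then obtain N where N: "N \<in> events" "prob N \<le> c" "\<forall>\<omega>\<in>space M - N. regret2 G K (X \<omega>) \<le> ?bound"
    unfolding whp_def by blast
  show ?thesis
    unfolding whp_def by (intro bexI[of _ N] conjI order_trans[OF N(2) \<open>c \<le> 2 * \<delta>\<close>] N)
qed

end

theorem theorem5p2:
  "\<exists>(c::real) (p::nat). c > 0 \<and>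
     (\<forall>(G :: ('s, 'a, 'b) game) (K::nat) (\<delta>::real) (M :: 'w measure) F F' X.
        wf_game G \<longrightarrow> K \<ge> 1 \<longrightarrow> 0 < \<delta> \<longrightarrow> \<delta> < 1 \<longrightarrow>
        protocol G K M F F' X \<longrightarrow>
        (\<forall>\<omega>\<in>space M. player2_algorithm G K \<delta>
            (sqrt (real (card (states G)) * ln (real (card (acts2 G))) / real K)) (X \<omega>)) \<longrightarrow>
        (let S = real (card (states G)); A = real (card (acts1 G)); B = real (card (acts2 G));
             H = real (horizon G); T = real K * H;
             C = sqrt (S ^ 2 * A * H ^ 3) + sqrt (S * A * B * H)
         in measure M {\<omega> \<in> space M. regret2 G K (X \<omega>) \<le> c * log_factor G K \<delta> ^ p * (C * sqrt T)}
              \<ge> 1 - 2 * \<delta>))"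
proof (intro exI[of _ "35::real"] exI[of _ "1::nat"] conjI allI impI)
  fix G :: "('s, 'a, 'b) game" and K :: nat and \<delta> :: real and M :: "'w measure" and F F' X
  assume wf: "wf_game G" and K: "K \<ge> 1" and \<delta>: "0 < \<delta>" "\<delta> < 1" and prot: "protocol G K M F F' X"
    and alg: "\<forall>\<omega>\<in>space M. player2_algorithm G K \<delta>
            (sqrt (real (card (states G)) * ln (real (card (acts2 G))) / real K)) (X \<omega>)"
  interpret game_protocol G K M F F' X
    by unfold_locales (rule wf, rule prot)
  define bd where "bd = 35 * log_factor G K \<delta> *
     ((sqrt (real (card S) ^ 2 * real (card A) * real H ^ 3) +
       sqrt (real (card S) * real (card A) * real (card B) * real H)) * sqrt (real K * real H))"
  have "whp (2 * \<delta>) (\<lambda>\<omega>. regret2 G K (X \<omega>) \<le> bd)"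
  proof (cases "card B = 1")
    case True
    \<comment> \<open>The regret is 0 here, so it remains to see that the bound is not
      negative.\<close>
    have "1 \<le> real (card S * card A * card B * H * K)"
      using nonempty_sets H_ge_1 K by (simp add: Suc_le_eq card_gt_0_iff del: of_nat_mult)
    also have "\<dots> \<le> real (card S * card A * card B * H * K) / \<delta>"
      using \<delta> by (simp add: pos_le_divide_eq mult_left_le)
    finally have "0 \<le> log_factor G K \<delta>"
      by (simp add: log_factor_def)
    then have "0 \<le> bd"
      by (simp add: bd_def)
    then show ?thesis
      unfolding whp_def using \<delta> regret_zero[OF True] by (intro bexI[of _ "{}"]) auto
  next
    case False
    then have "2 \<le> card B"
      using nonempty_sets(3) card_gt_0_iff[of B] by (simp add: Suc_le_eq)
    then show ?thesis
      unfolding bd_def using alg by (intro whp_regret K \<delta>) auto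
  qed
  then obtain N where N: "N \<in> events" "prob N \<le> 2 * \<delta>" "\<forall>\<omega>\<in>space M - N. regret2 G K (X \<omega>) \<le> bd"
    unfolding whp_def by blast
  have "1 - 2 * \<delta> \<le> prob (space M - N)"
    using N by (simp add: prob_compl)
  \<comment> \<open>The exceptional set alone does not suffice: \<open>measure\<close> is 0 on sets
    that are not measurable, so the event of the theorem must be shown measurable.\<close>
  also have "\<dots> \<le> prob {\<omega> \<in> space M. regret2 G K (X \<omega>) \<le> bd}"
  proof (rule finite_measure_mono)
    note [measurable] = regret_meas
    show "{\<omega> \<in> space M. regret2 G K (X \<omega>) \<le> bd} \<in> events"
      by measurable
  qed (use N in auto)
  finally show "let S = real (card (states G)); A = real (card (acts1 G)); B = real (card (acts2 G));
             H = real (horizon G); T = real K * H;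
             C = sqrt (S ^ 2 * A * H ^ 3) + sqrt (S * A * B * H)
         in measure M {\<omega> \<in> space M. regret2 G K (X \<omega>) \<le> 35 * log_factor G K \<delta> ^ 1 * (C * sqrt T)}
              \<ge> 1 - 2 * \<delta>"
    unfolding Let_def bd_def by simp
qed simp

end
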